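(* Let $\sigma$ be a finite relational signature, P a numerical predicate collection and $d,k,\ell,r,w\in\mathbb{N}$. There are $s\in\mathbb{N}$ and an algorithm with only local access to a finite $\sigma$-structure $\mathcal{B}$ of degree at most $d$, receiving a training sequence $T\in(U(\mathcal{B})^k\times\{0,1\})^t$ as input, with the following properties: (1) The algorithm always returns a hypothesis $(\phi^*(\bar{x};\bar{y}),\bar{v}^* )$, where $\phi^*$ is a first-order formula that is a Boolean combination of sphere formulas with locality radius smaller than $(2w+1)^r$ and $\bar{v}^*\in U(\mathcal{B})^\ell$, such that for all $\epsilon,\delta\in(0,1)$ and every probability distribution $\mathcal{D}$ on $U(\mathcal{B})^k\times\{0,1\}$, if the input sequence $T$ consists of $t\ge s\left\lceil\frac{\log(|\mathcal{B}|/\delta)}{\epsilon^2}\right\rceil$ examples drawn i.i.d. from $\mathcal{D}$, then $$\mathcal{P}_{T\sim\mathcal{D}^t}\Big[\mathrm{err}_{\mathcal{D}}([\![\phi^*(\bar{x};\bar{v}^* )]\!]^{\mathcal{B}})-\min_{C\in\mathcal{C}}\mathrm{err}_{\mathcal{D}}(C)\le\epsilon\Big]\ge1-\delta.$$ (2) If $|T|=s\left\lceil\frac{\log(|\mathcal{B}|/\delta)}{\epsilon^2}\right\rceil$, the algorithm runs in time $(\log|\mathcal{B}|+1/\epsilon+\log(1/\delta))^{O(1)}$ with only local access to $\mathcal{B}$. (3) The returned hypothesis can be evaluated in time $(\log|\mathcal{B}|)^{O(1)}$ with only local access to $\mathcal{B}$.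
   Context: All structures are finite. For a $\sigma$-structure $\mathcal{A}$, the Gaifman graph has vertex set $U(\mathcal{A})$ and an edge between distinct elements occurring together in a tuple of some relation; the degree of $\mathcal{A}$ is its maximum degree. $N_s^{\mathcal{A}}(\bar{u})$ is the set of elements at Gaifman distance $\le s$ from some entry of $\bar{u}$; $\mathcal{N}_s^{\mathcal{A}}(\bar{u})=(\mathcal{A}[N_s^{\mathcal{A}}(\bar{u})],\bar{u})$ (centers as constants; isomorphisms respect centers). For an $s$-type $\tau$ (a structure $(\mathcal{A},a_1,\dots,a_m)$ with $U(\mathcal{A})=N_s^{\mathcal{A}}(a_1,\dots,a_m)$), a sphere formula $\mathrm{sph}_\tau(\bar{z})$ is a first-order formula with $\mathcal{B}\models\mathrm{sph}_\tau(\bar{b})$ iff $\mathcal{N}_s^{\mathcal{B}}(\bar{b})\cong\tau$; its locality radius is $s$. A numerical predicate collection P consists of names $P$ with arity $\mathrm{ar}(P)\ge1$ and semantics $[\![P]\!]\subseteq\mathbb{Z}^{\mathrm{ar}(P)}$. FOCN(P) extends first-order logic by counting terms $\#(x_1,\dots,x_s).\psi$ (number of satisfying tuples), integers, number variables, $+$, $\cdot$, atoms $P(t_1,\dots,t_{\mathrm{ar}(P)})$ on counting terms and $\exists\kappa$ for number variables ranging over $\{0,\dots,|U(\mathcal{A})|\}$; binding rank $\mathrm{br}$ is the maximal nesting depth of $\exists x,\forall x$ (structure variables) and $\#\bar{x}$; binding width $\mathrm{bw}$ is the maximal length of $\bar{x}$ in a term $\#\bar{x}.\psi$, and if there is none,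 $1$ if there is a quantifier over a structure variable and $0$ otherwise. For $\phi(\bar{x};\bar{y},\bar{\kappa})$ ($\bar{x}$ a $k$-tuple, $\bar{y}$ an $\ell$-tuple of structure variables, $\bar{\kappa}$ number variables), $[\![\phi(\bar{x};\bar{v},\bar{\lambda})]\!]^{\mathcal{B}}:U(\mathcal{B})^k\to\{0,1\}$ maps $\bar{u}$ to $1$ iff $\mathcal{B}\models\phi(\bar{u};\bar{v},\bar{\lambda})$. $\mathcal{C}=\{[\![\phi(\bar{x};\bar{v},\bar{\lambda})]\!]^{\mathcal{B}}\mid\phi$ an FOCN(P)-formula with $\mathrm{bw}(\phi)\le w$, $\mathrm{br}(\phi)\le r$, $\bar{v}\in U(\mathcal{B})^\ell$, $\bar{\lambda}\in\{0,\dots,|\mathcal{B}|\}^{|\bar{\kappa}|}\}$. The generalization error of $H:U(\mathcal{B})^k\to\{0,1\}$ w.r.t. $\mathcal{D}$ is $\mathrm{err}_{\mathcal{D}}(H)=\mathcal{P}_{(\bar{u},c)\sim\mathcal{D}}(H(\bar{u})\ne c)$. Only local access: $\mathcal{B}$ is accessed only by queries "is $\bar{a}\in R(\mathcal{B})$?" and "list all Gaifman neighbors of $u$". *)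

theory Defs
  imports "HOL-Probability.Probability" "HOL-Library.Log_Nat"
begin

section \<open>Finite relational structures\<close>

text \<open>
  A finite relational signature is the list of the arities of its relation symbols; the
  symbols themselves are the indices of that list.  Structures being finite, their elements
  are taken to be natural numbers.
\<close>

type_synonym signature = "nat list"

record fin_struct =
  univ :: "nat set"
  rel :: "nat \<Rightarrow> nat list set"

definition tuples :: "nat \<Rightarrow> 'a set \<Rightarrow> 'a list set" where
  "tuples k X = {xs. length xs = k \<and> set xs \<subseteq> X}"

text \<open>
  The universe may be empty here, because the neighbourhood of the empty tuple is empty.
\<close>

definition is_structure :: "signature \<Rightarrow> fin_struct \<Rightarrow> bool" where
  "is_structure \<sigma> A \<longleftrightarrow> finite (univ A) \<and>
     (\<forall>i. rel A i \<subseteq> (if i < length \<sigma> then tuples (\<sigma> ! i) (univ A) else {}))"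

definition gaifman :: "fin_struct \<Rightarrow> (nat \<times> nat) set" where
  "gaifman A = {(a, b). a \<in> univ A \<and> b \<in> univ A \<and> a \<noteq> b \<and>
     (\<exists>i. \<exists>t \<in> rel A i. a \<in> set t \<and> b \<in> set t)}"

definition neighbours :: "fin_struct \<Rightarrow> nat \<Rightarrow> nat set" where
  "neighbours A a = {b. (a, b) \<in> gaifman A}"

definition gaifman_degree :: "fin_struct \<Rightarrow> nat" where
  "gaifman_degree A = Max ((\<lambda>a. card (neighbours A a)) ` univ A)"

definition nbhd :: "nat \<Rightarrow> fin_struct \<Rightarrow> nat list \<Rightarrow> nat set" where
  "nbhd s A us = {b \<in> univ A. \<exists>a \<in> set us. \<exists>j \<le> s. (a, b) \<in> gaifman A ^^ j}"

definition induced :: "fin_struct \<Rightarrow> nat set \<Rightarrow> fin_struct" where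
  "induced A X = \<lparr>univ = X, rel = (\<lambda>i. rel A i \<inter> lists X)\<rparr>"

definition nbhd_struct :: "nat \<Rightarrow> fin_struct \<Rightarrow> nat list \<Rightarrow> fin_struct \<times> nat list" where
  "nbhd_struct s A us = (induced A (nbhd s A us), us)"

definition iso_centred :: "fin_struct \<times> nat list \<Rightarrow> fin_struct \<times> nat list \<Rightarrow> bool" where
  "iso_centred = (\<lambda>(A, as) (B, bs). \<exists>f. bij_betw f (univ A) (univ B) \<and>
     (\<forall>i. \<forall>t \<in> lists (univ A). t \<in> rel A i \<longleftrightarrow> map f t \<in> rel B i) \<and> map f as = bs)"

definition is_type :: "signature \<Rightarrow> nat \<Rightarrow> fin_struct \<times> nat list \<Rightarrow> bool" where
  "is_type \<sigma> s = (\<lambda>(A, as). is_structure \<sigma> A \<and> set as \<subseteq> univ A \<and> univ A = nbhd s A as)"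

section \<open>First-order logic with counting\<close>

record 'p numpred =
  names :: "'p set"
  arity :: "'p \<Rightarrow> nat"
  sem :: "'p \<Rightarrow> int list set"

definition is_numpred :: "'p numpred \<Rightarrow> bool" where
  "is_numpred P \<longleftrightarrow> (\<forall>p \<in> names P. arity P p \<ge> 1 \<and> sem P p \<subseteq> {xs. length xs = arity P p})"

text \<open>
  Structure variables and number variables are two separate sorts, both indexed by natural
  numbers.  The constant \<open>Truth\<close> makes sure that there is a sentence of binding rank 0 even if
  neither the signature nor the predicate collection provides one.
\<close>

datatype 'p form =
    Truth
  | Equal nat nat
  | Rel nat "nat list"
  | Neg "'p form"
  | Conj "'p form" "'p form"
  | Disj "'p form" "'p form"
  | Exists nat "'p form"
  | Forall nat "'p form"
  | Pred 'p "'p cterm list"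
  | ExistsNum nat "'p form"
and 'p cterm =
    Count "nat list" "'p form"
  | IntConst int
  | NumVar nat
  | Plus "'p cterm" "'p cterm"
  | Times "'p cterm" "'p cterm"

text \<open>
  A counting term binds a nonempty tuple of pairwise distinct variables.
\<close>

primrec wf_form :: "'p numpred \<Rightarrow> signature \<Rightarrow> 'p form \<Rightarrow> bool"
  and wf_term :: "'p numpred \<Rightarrow> signature \<Rightarrow> 'p cterm \<Rightarrow> bool" where
  "wf_form P \<sigma> Truth \<longleftrightarrow> True"
| "wf_form P \<sigma> (Equal x y) \<longleftrightarrow> True"
| "wf_form P \<sigma> (Rel i xs) \<longleftrightarrow> i < length \<sigma> \<and> length xs = \<sigma> ! i"
| "wf_form P \<sigma> (Neg \<phi>) \<longleftrightarrow> wf_form P \<sigma> \<phi>"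
| "wf_form P \<sigma> (Conj \<phi> \<psi>) \<longleftrightarrow> wf_form P \<sigma> \<phi> \<and> wf_form P \<sigma> \<psi>"
| "wf_form P \<sigma> (Disj \<phi> \<psi>) \<longleftrightarrow> wf_form P \<sigma> \<phi> \<and> wf_form P \<sigma> \<psi>"
| "wf_form P \<sigma> (Exists x \<phi>) \<longleftrightarrow> wf_form P \<sigma> \<phi>"
| "wf_form P \<sigma> (Forall x \<phi>) \<longleftrightarrow> wf_form P \<sigma> \<phi>"
| "wf_form P \<sigma> (Pred p ts) \<longleftrightarrow> p \<in> names P \<and> length ts = arity P p \<and> list_all (wf_term P \<sigma>) ts"
| "wf_form P \<sigma> (ExistsNum \<kappa> \<phi>) \<longleftrightarrow> wf_form P \<sigma> \<phi>"
| "wf_term P \<sigma> (Count xs \<phi>) \<longleftrightarrow> xs \<noteq> [] \<and> distinct xs \<and> wf_form P \<sigma> \<phi>"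
| "wf_term P \<sigma> (IntConst z) \<longleftrightarrow> True"
| "wf_term P \<sigma> (NumVar \<kappa>) \<longleftrightarrow> True"
| "wf_term P \<sigma> (Plus t u) \<longleftrightarrow> wf_term P \<sigma> t \<and> wf_term P \<sigma> u"
| "wf_term P \<sigma> (Times t u) \<longleftrightarrow> wf_term P \<sigma> t \<and> wf_term P \<sigma> u"

text \<open>Free structure variables.\<close>

primrec fv_form :: "'p form \<Rightarrow> nat set" and fv_term :: "'p cterm \<Rightarrow> nat set" where
  "fv_form Truth = {}"
| "fv_form (Equal x y) = {x, y}"
| "fv_form (Rel i xs) = set xs"
| "fv_form (Neg \<phi>) = fv_form \<phi>"
| "fv_form (Conj \<phi> \<psi>) = fv_form \<phi> \<union> fv_form \<psi>"
| "fv_form (Disj \<phi> \<psi>) = fv_form \<phi> \<union> fv_form \<psi>"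
| "fv_form (Exists x \<phi>) = fv_form \<phi> - {x}"
| "fv_form (Forall x \<phi>) = fv_form \<phi> - {x}"
| "fv_form (Pred p ts) = \<Union> (set (map fv_term ts))"
| "fv_form (ExistsNum \<kappa> \<phi>) = fv_form \<phi>"
| "fv_term (Count xs \<phi>) = fv_form \<phi> - set xs"
| "fv_term (IntConst z) = {}"
| "fv_term (NumVar \<kappa>) = {}"
| "fv_term (Plus t u) = fv_term t \<union> fv_term u"
| "fv_term (Times t u) = fv_term t \<union> fv_term u"

primrec is_fo :: "'p form \<Rightarrow> bool" where
  "is_fo Truth \<longleftrightarrow> True"
| "is_fo (Equal x y) \<longleftrightarrow> True"
| "is_fo (Rel i xs) \<longleftrightarrow> True"
| "is_fo (Neg \<phi>) \<longleftrightarrow> is_fo \<phi>"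
| "is_fo (Conj \<phi> \<psi>) \<longleftrightarrow> is_fo \<phi> \<and> is_fo \<psi>"
| "is_fo (Disj \<phi> \<psi>) \<longleftrightarrow> is_fo \<phi> \<and> is_fo \<psi>"
| "is_fo (Exists x \<phi>) \<longleftrightarrow> is_fo \<phi>"
| "is_fo (Forall x \<phi>) \<longleftrightarrow> is_fo \<phi>"
| "is_fo (Pred p ts) \<longleftrightarrow> False"
| "is_fo (ExistsNum \<kappa> \<phi>) \<longleftrightarrow> False"

definition upd_list :: "(nat \<Rightarrow> nat) \<Rightarrow> nat list \<Rightarrow> nat list \<Rightarrow> nat \<Rightarrow> nat" where
  "upd_list \<beta> xs as = (\<lambda>y. case map_of (zip xs as) y of None \<Rightarrow> \<beta> y | Some a \<Rightarrow> a)"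

primrec sat :: "'p numpred \<Rightarrow> fin_struct \<Rightarrow> 'p form \<Rightarrow> (nat \<Rightarrow> nat) \<Rightarrow> (nat \<Rightarrow> nat) \<Rightarrow> bool"
  and val :: "'p numpred \<Rightarrow> fin_struct \<Rightarrow> 'p cterm \<Rightarrow> (nat \<Rightarrow> nat) \<Rightarrow> (nat \<Rightarrow> nat) \<Rightarrow> int" where
  "sat P A Truth \<beta> \<mu> \<longleftrightarrow> True"
| "sat P A (Equal x y) \<beta> \<mu> \<longleftrightarrow> \<beta> x = \<beta> y"
| "sat P A (Rel i xs) \<beta> \<mu> \<longleftrightarrow> map \<beta> xs \<in> rel A i"
| "sat P A (Neg \<phi>) \<beta> \<mu> \<longleftrightarrow> \<not> sat P A \<phi> \<beta> \<mu>"
| "sat P A (Conj \<phi> \<psi>) \<beta> \<mu> \<longleftrightarrow> sat P A \<phi> \<beta> \<mu> \<and> sat P A \<psi> \<beta> \<mu>"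
| "sat P A (Disj \<phi> \<psi>) \<beta> \<mu> \<longleftrightarrow> sat P A \<phi> \<beta> \<mu> \<or> sat P A \<psi> \<beta> \<mu>"
| "sat P A (Exists x \<phi>) \<beta> \<mu> \<longleftrightarrow> (\<exists>a \<in> univ A. sat P A \<phi> (\<beta>(x := a)) \<mu>)"
| "sat P A (Forall x \<phi>) \<beta> \<mu> \<longleftrightarrow> (\<forall>a \<in> univ A. sat P A \<phi> (\<beta>(x := a)) \<mu>)"
| "sat P A (Pred p ts) \<beta> \<mu> \<longleftrightarrow> map (\<lambda>t. val P A t \<beta> \<mu>) ts \<in> sem P p"
| "sat P A (ExistsNum \<kappa> \<phi>) \<beta> \<mu> \<longleftrightarrow> (\<exists>j \<le> card (univ A). sat P A \<phi> \<beta> (\<mu>(\<kappa> := j)))"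
| "val P A (Count xs \<phi>) \<beta> \<mu> =
     int (card {as \<in> tuples (length xs) (univ A). sat P A \<phi> (upd_list \<beta> xs as) \<mu>})"
| "val P A (IntConst z) \<beta> \<mu> = z"
| "val P A (NumVar \<kappa>) \<beta> \<mu> = int (\<mu> \<kappa>)"
| "val P A (Plus t u) \<beta> \<mu> = val P A t \<beta> \<mu> + val P A u \<beta> \<mu>"
| "val P A (Times t u) \<beta> \<mu> = val P A t \<beta> \<mu> * val P A u \<beta> \<mu>"


primrec br_form :: "'p form \<Rightarrow> nat" and br_term :: "'p cterm \<Rightarrow> nat" where
  "br_form Truth = 0"
| "br_form (Equal x y) = 0"
| "br_form (Rel i xs) = 0"
| "br_form (Neg \<phi>) = br_form \<phi>"
| "br_form (Conj \<phi> \<psi>) = max (br_form \<phi>) (br_form \<psi>)"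
| "br_form (Disj \<phi> \<psi>) = max (br_form \<phi>) (br_form \<psi>)"
| "br_form (Exists x \<phi>) = br_form \<phi> + 1"
| "br_form (Forall x \<phi>) = br_form \<phi> + 1"
| "br_form (Pred p ts) = foldr max (map br_term ts) 0"
| "br_form (ExistsNum \<kappa> \<phi>) = br_form \<phi>"
| "br_term (Count xs \<phi>) = br_form \<phi> + 1"
| "br_term (IntConst z) = 0"
| "br_term (NumVar \<kappa>) = 0"
| "br_term (Plus t u) = max (br_term t) (br_term u)"
| "br_term (Times t u) = max (br_term t) (br_term u)"

primrec widths_form :: "'p form \<Rightarrow> nat set" and widths_term :: "'p cterm \<Rightarrow> nat set" where
  "widths_form Truth = {}"
| "widths_form (Equal x y) = {}"
| "widths_form (Rel i xs) = {}"
| "widths_form (Neg \<phi>) = widths_form \<phi>"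
| "widths_form (Conj \<phi> \<psi>) = widths_form \<phi> \<union> widths_form \<psi>"
| "widths_form (Disj \<phi> \<psi>) = widths_form \<phi> \<union> widths_form \<psi>"
| "widths_form (Exists x \<phi>) = widths_form \<phi>"
| "widths_form (Forall x \<phi>) = widths_form \<phi>"
| "widths_form (Pred p ts) = \<Union> (set (map widths_term ts))"
| "widths_form (ExistsNum \<kappa> \<phi>) = widths_form \<phi>"
| "widths_term (Count xs \<phi>) = insert (length xs) (widths_form \<phi>)"
| "widths_term (IntConst z) = {}"
| "widths_term (NumVar \<kappa>) = {}"
| "widths_term (Plus t u) = widths_term t \<union> widths_term u"
| "widths_term (Times t u) = widths_term t \<union> widths_term u"

primrec quant_form :: "'p form \<Rightarrow> bool" and quant_term :: "'p cterm \<Rightarrow> bool" where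
  "quant_form Truth \<longleftrightarrow> False"
| "quant_form (Equal x y) \<longleftrightarrow> False"
| "quant_form (Rel i xs) \<longleftrightarrow> False"
| "quant_form (Neg \<phi>) \<longleftrightarrow> quant_form \<phi>"
| "quant_form (Conj \<phi> \<psi>) \<longleftrightarrow> quant_form \<phi> \<or> quant_form \<psi>"
| "quant_form (Disj \<phi> \<psi>) \<longleftrightarrow> quant_form \<phi> \<or> quant_form \<psi>"
| "quant_form (Exists x \<phi>) \<longleftrightarrow> True"
| "quant_form (Forall x \<phi>) \<longleftrightarrow> True"
| "quant_form (Pred p ts) \<longleftrightarrow> True \<in> set (map quant_term ts)"
| "quant_form (ExistsNum \<kappa> \<phi>) \<longleftrightarrow> quant_form \<phi>"
| "quant_term (Count xs \<phi>) \<longleftrightarrow> quant_form \<phi>"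
| "quant_term (IntConst z) \<longleftrightarrow> False"
| "quant_term (NumVar \<kappa>) \<longleftrightarrow> False"
| "quant_term (Plus t u) \<longleftrightarrow> quant_term t \<or> quant_term u"
| "quant_term (Times t u) \<longleftrightarrow> quant_term t \<or> quant_term u"

definition bw_form :: "'p form \<Rightarrow> nat" where
  "bw_form \<phi> = (if widths_form \<phi> \<noteq> {} then Max (widths_form \<phi>)
                else if quant_form \<phi> then 1 else 0)"

section \<open>Sphere formulas\<close>

definition is_sphere_formula ::
    "'p numpred \<Rightarrow> signature \<Rightarrow> nat \<Rightarrow> nat list \<Rightarrow> 'p form \<Rightarrow> bool" where
  "is_sphere_formula P \<sigma> s zs \<phi> \<longleftrightarrow>
     is_fo \<phi> \<and> wf_form P \<sigma> \<phi> \<and> fv_form \<phi> \<subseteq> set zs \<and>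
     (\<exists>\<tau>. is_type \<sigma> s \<tau> \<and> length (snd \<tau>) = length zs \<and>
       (\<forall>B \<beta> \<mu>. is_structure \<sigma> B \<and> univ B \<noteq> {} \<and> \<beta> ` set zs \<subseteq> univ B \<longrightarrow>
          (sat P B \<phi> \<beta> \<mu> \<longleftrightarrow> iso_centred (nbhd_struct s B (map \<beta> zs)) \<tau>)))"

inductive sphere_comb :: "'p numpred \<Rightarrow> signature \<Rightarrow> nat \<Rightarrow> nat set \<Rightarrow> 'p form \<Rightarrow> bool"
  for P :: "'p numpred" and \<sigma> :: signature and \<rho> :: nat and V :: "nat set" where
  sphere: "is_sphere_formula P \<sigma> s zs \<phi> \<Longrightarrow> s < \<rho> \<Longrightarrow> set zs \<subseteq> V \<Longrightarrow> sphere_comb P \<sigma> \<rho> V \<phi>"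
| neg: "sphere_comb P \<sigma> \<rho> V \<phi> \<Longrightarrow> sphere_comb P \<sigma> \<rho> V (Neg \<phi>)"
| conj: "sphere_comb P \<sigma> \<rho> V \<phi> \<Longrightarrow> sphere_comb P \<sigma> \<rho> V \<psi> \<Longrightarrow> sphere_comb P \<sigma> \<rho> V (Conj \<phi> \<psi>)"
| disj: "sphere_comb P \<sigma> \<rho> V \<phi> \<Longrightarrow> sphere_comb P \<sigma> \<rho> V \<psi> \<Longrightarrow> sphere_comb P \<sigma> \<rho> V (Disj \<phi> \<psi>)"

section \<open>Hypotheses and their errors\<close>

text \<open>
  In a formula \<open>\<phi>(x; y, \<kappa>)\<close> the variables \<open>x\<close> are the structure variables \<open>0, \<dots>, k - 1\<close> and the
  variables \<open>y\<close> are \<open>k, \<dots>, k + l - 1\<close>.  The values of \<open>\<kappa>\<close> are given by an assignment \<open>\<mu>\<close> of all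
  number variables, of which only finitely many can occur.
\<close>

definition hyp :: "'p numpred \<Rightarrow> fin_struct \<Rightarrow> 'p form \<Rightarrow> nat list \<Rightarrow> (nat \<Rightarrow> nat) \<Rightarrow> nat list \<Rightarrow> bool"
  where "hyp P B \<phi> v \<mu> u = sat P B \<phi> (upd_list (\<lambda>_. 0) [0..<length (u @ v)] (u @ v)) \<mu>"

definition concepts ::
    "'p numpred \<Rightarrow> signature \<Rightarrow> nat \<Rightarrow> nat \<Rightarrow> nat \<Rightarrow> nat \<Rightarrow> fin_struct \<Rightarrow> (nat list \<Rightarrow> bool) set" where
  "concepts P \<sigma> k l r w B =
     {hyp P B \<phi> v \<mu> | \<phi> v \<mu>. wf_form P \<sigma> \<phi> \<and> fv_form \<phi> \<subseteq> {..<k + l} \<and>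
        bw_form \<phi> \<le> w \<and> br_form \<phi> \<le> r \<and>
        v \<in> tuples l (univ B) \<and> (\<forall>\<kappa>. \<mu> \<kappa> \<le> card (univ B))}"

definition err :: "(nat list \<times> bool) pmf \<Rightarrow> (nat list \<Rightarrow> bool) \<Rightarrow> real" where
  "err D H = measure_pmf.prob D {(u, c). H u \<noteq> c}"

section \<open>Algorithms with local access\<close>

text \<open>
  Algorithms are programs of a WHILE language over binary trees in the style of Jones.  The
  leaves are empty or carry an atom, which is the name of an element or a symbol of an output
  alphabet.  There is no arithmetic on atoms; they can only be compared, copied and used in
  queries.  Every elementary operation costs one step, and operations that inspect whole trees
  (comparisons and queries) additionally cost the size of the trees, where an atom \<open>a\<close> counts
  with its bit length, so that running times agree with those of Turing machines with oracle
  access up to a polynomial.  Input structures with \<open>n\<close> elements are meant to have universe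
  \<open>{..<n}\<close>, so that names have at most \<open>log 2 n + 1\<close> bits.  A program may contain constant atoms;
  this allows it to name some element even if the training sequence mentions none.
\<close>

datatype data = Empty | Atom nat | Node data data

primrec dsize :: "data \<Rightarrow> nat" where
  "dsize Empty = 1"
| "dsize (Atom a) = 1 + floorlog 2 a"
| "dsize (Node x y) = 1 + dsize x + dsize y"

fun left :: "data \<Rightarrow> data" where
  "left (Node x y) = x"
| "left _ = Empty"

fun right :: "data \<Rightarrow> data" where
  "right (Node x y) = y"
| "right _ = Empty"

definition enc_bool :: "bool \<Rightarrow> data" where
  "enc_bool b = (if b then Node Empty Empty else Empty)"

definition enc_list :: "('a \<Rightarrow> data) \<Rightarrow> 'a list \<Rightarrow> data" where
  "enc_list f xs = foldr (\<lambda>x. Node (f x)) xs Empty"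

abbreviation enc_tuple :: "nat list \<Rightarrow> data" where
  "enc_tuple \<equiv> enc_list Atom"

definition enc_sample :: "(nat list \<times> bool) list \<Rightarrow> data" where
  "enc_sample = enc_list (\<lambda>(u, c). Node (enc_tuple u) (enc_bool c))"

text \<open>
  Only first-order formulas are encoded; every other formula gets a subtree \<open>Empty\<close>, which never
  is the code of a first-order formula.
\<close>

primrec enc_form :: "'p form \<Rightarrow> data" where
  "enc_form Truth = Node (Atom 0) Empty"
| "enc_form (Equal x y) = Node (Atom 1) (Node (Atom x) (Atom y))"
| "enc_form (Rel i xs) = Node (Atom 2) (Node (Atom i) (enc_tuple xs))"
| "enc_form (Neg \<phi>) = Node (Atom 3) (enc_form \<phi>)"
| "enc_form (Conj \<phi> \<psi>) = Node (Atom 4) (Node (enc_form \<phi>) (enc_form \<psi>))"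
| "enc_form (Disj \<phi> \<psi>) = Node (Atom 5) (Node (enc_form \<phi>) (enc_form \<psi>))"
| "enc_form (Exists x \<phi>) = Node (Atom 6) (Node (Atom x) (enc_form \<phi>))"
| "enc_form (Forall x \<phi>) = Node (Atom 7) (Node (Atom x) (enc_form \<phi>))"
| "enc_form (Pred p ts) = Empty"
| "enc_form (ExistsNum \<kappa> \<phi>) = Empty"

lemma enc_tuple_inject [simp]: "enc_tuple xs = enc_tuple ys \<longleftrightarrow> xs = ys"
proof (induction xs arbitrary: ys)
  case Nil
  then show ?case by (cases ys) (auto simp: enc_list_def)
next
  case (Cons a xs)
  then show ?case by (cases ys) (auto simp: enc_list_def)
qed

lemma enc_form_inject:
  assumes "is_fo \<phi>" and "enc_form \<phi> = enc_form \<psi>"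
  shows "\<phi> = \<psi>"
  using assms
proof (induction \<phi> arbitrary: \<psi> rule: form.induct[where ?P2.0 = "\<lambda>_. True"])
  case Truth
  then show ?case by (cases \<psi>) auto
next
  case (Equal x y)
  then show ?case by (cases \<psi>) auto
next
  case (Rel i xs)
  then show ?case by (cases \<psi>) auto
next
  case (Neg \<phi>)
  then show ?case by (cases \<psi>) auto
next
  case (Conj \<phi>1 \<phi>2)
  then show ?case by (cases \<psi>) auto
next
  case (Disj \<phi>1 \<phi>2)
  then show ?case by (cases \<psi>) auto
next
  case (Exists x \<phi>)
  then show ?case by (cases \<psi>) auto
next
  case (Forall x \<phi>)
  then show ?case by (cases \<psi>) auto
qed auto

datatype exp =
    Var nat
  | Const data
  | Pair exp exp
  | Left exp
  | Right exp
  | Same exp exp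

primrec evl :: "exp \<Rightarrow> (nat \<Rightarrow> data) \<Rightarrow> data" where
  "evl (Var x) m = m x"
| "evl (Const d) m = d"
| "evl (Pair e f) m = Node (evl e m) (evl f m)"
| "evl (Left e) m = left (evl e m)"
| "evl (Right e) m = right (evl e m)"
| "evl (Same e f) m = enc_bool (evl e m = evl f m)"

primrec cost :: "exp \<Rightarrow> (nat \<Rightarrow> data) \<Rightarrow> nat" where
  "cost (Var x) m = 1"
| "cost (Const d) m = 1"
| "cost (Pair e f) m = 1 + cost e m + cost f m"
| "cost (Left e) m = 1 + cost e m"
| "cost (Right e) m = 1 + cost e m"
| "cost (Same e f) m = 1 + cost e m + cost f m + dsize (evl e m) + dsize (evl f m)"

text \<open>
  \<open>AskRel x i e\<close> asks whether the tuple denoted by \<open>e\<close> is in the \<open>i\<close>-th relation, and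
  \<open>AskNbs x e\<close> asks for the list of all Gaifman neighbours of the element denoted by \<open>e\<close>;
  the answer is stored in \<open>x\<close>.
\<close>

datatype com =
    Skip
  | Assign nat exp
  | Seq com com
  | If exp com com
  | While exp com
  | AskRel nat nat exp
  | AskNbs nat exp

text \<open>
  The order in which neighbours are listed is not under the control of the algorithm.
\<close>

definition neighbour_listing :: "fin_struct \<Rightarrow> (nat \<Rightarrow> nat list) \<Rightarrow> bool" where
  "neighbour_listing B nb \<longleftrightarrow>
     (\<forall>a \<in> univ B. distinct (nb a) \<and> set (nb a) = neighbours B a)"

definition rel_answer :: "fin_struct \<Rightarrow> nat \<Rightarrow> data \<Rightarrow> data" where
  "rel_answer B i d = enc_bool (\<exists>t \<in> rel B i. d = enc_tuple t)"

definition nbs_answer :: "fin_struct \<Rightarrow> (nat \<Rightarrow> nat list) \<Rightarrow> data \<Rightarrow> data" where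
  "nbs_answer B nb d =
     (case d of Atom a \<Rightarrow> if a \<in> univ B then enc_tuple (nb a) else Empty | _ \<Rightarrow> Empty)"

inductive exec :: "fin_struct \<Rightarrow> (nat \<Rightarrow> nat list) \<Rightarrow> com \<Rightarrow> (nat \<Rightarrow> data) \<Rightarrow> nat \<Rightarrow> (nat \<Rightarrow> data) \<Rightarrow> bool"
  for B :: fin_struct and nb :: "nat \<Rightarrow> nat list" where
  Skip: "exec B nb Skip m 1 m"
| Assign: "exec B nb (Assign x e) m (1 + cost e m) (m(x := evl e m))"
| Seq: "exec B nb p m t1 m' \<Longrightarrow> exec B nb q m' t2 m'' \<Longrightarrow> exec B nb (Seq p q) m (t1 + t2) m''"
| IfTrue: "evl e m \<noteq> Empty \<Longrightarrow> exec B nb p m t m' \<Longrightarrow> exec B nb (If e p q) m (1 + cost e m + t) m'"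
| IfFalse: "evl e m = Empty \<Longrightarrow> exec B nb q m t m' \<Longrightarrow> exec B nb (If e p q) m (1 + cost e m + t) m'"
| WhileFalse: "evl e m = Empty \<Longrightarrow> exec B nb (While e p) m (1 + cost e m) m"
| WhileTrue: "evl e m \<noteq> Empty \<Longrightarrow> exec B nb p m t1 m' \<Longrightarrow> exec B nb (While e p) m' t2 m'' \<Longrightarrow>
    exec B nb (While e p) m (1 + cost e m + t1 + t2) m''"
| AskRel: "exec B nb (AskRel x i e) m (1 + cost e m + dsize (evl e m))
    (m(x := rel_answer B i (evl e m)))"
| AskNbs: "exec B nb (AskNbs x e) m
    (1 + cost e m + dsize (evl e m) + dsize (nbs_answer B nb (evl e m)))
    (m(x := nbs_answer B nb (evl e m)))"

inductive_cases exec_SkipE: "exec B nb Skip m t m'"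
inductive_cases exec_AssignE: "exec B nb (Assign x e) m t m'"
inductive_cases exec_SeqE: "exec B nb (Seq p q) m t m'"
inductive_cases exec_IfE: "exec B nb (If e p q) m t m'"
inductive_cases exec_WhileE: "exec B nb (While e p) m t m'"
inductive_cases exec_AskRelE: "exec B nb (AskRel x i e) m t m'"
inductive_cases exec_AskNbsE: "exec B nb (AskNbs x e) m t m'"

lemma exec_deterministic:
  assumes "exec B nb p m t m'" and "exec B nb p m u m''"
  shows "t = u \<and> m' = m''"
  using assms
proof (induction arbitrary: u m'' rule: exec.induct)
  case (Skip m)
  then show ?case by (auto elim: exec_SkipE)
next
  case (Assign x e m)
  then show ?case by (auto elim: exec_AssignE)
next
  case (Seq p m t1 m' q t2 m2)
  from Seq.prems obtain u1 n1 u2 where "exec B nb p m u1 n1" "exec B nb q n1 u2 m''" "u = u1 + u2"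
    by (rule exec_SeqE)
  with Seq.IH show ?case by metis
next
  case (IfTrue e m p t m' q)
  from IfTrue.prems IfTrue.hyps(1) obtain u1 where "exec B nb p m u1 m''" "u = 1 + cost e m + u1"
    by (auto elim!: exec_IfE)
  with IfTrue.IH show ?case by metis
next
  case (IfFalse e m q t m' p)
  from IfFalse.prems IfFalse.hyps(1) obtain u1 where "exec B nb q m u1 m''" "u = 1 + cost e m + u1"
    by (auto elim!: exec_IfE)
  with IfFalse.IH show ?case by metis
next
  case (WhileFalse e m p)
  from WhileFalse.prems show ?case
    by (rule exec_WhileE) (use WhileFalse.hyps in simp_all)
next
  case (WhileTrue e m p t1 m1 t2 m2)
  from WhileTrue.prems obtain u1 n1 u2
    where "exec B nb p m u1 n1" "exec B nb (While e p) n1 u2 m''" "u = 1 + cost e m + u1 + u2"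
    by (rule exec_WhileE) (use WhileTrue.hyps(1) in simp_all)
  with WhileTrue.IH show ?case by metis
next
  case (AskRel x i e m)
  then show ?case by (auto elim: exec_AskRelE)
next
  case (AskNbs x e m)
  then show ?case by (auto elim: exec_AskNbsE)
qed

text \<open>
  Program \<open>p\<close> transforms input \<open>x\<close> into output \<open>y\<close> in exactly \<open>t\<close> steps; variable 0 holds both.
\<close>

definition computes ::
    "fin_struct \<Rightarrow> (nat \<Rightarrow> nat list) \<Rightarrow> com \<Rightarrow> data \<Rightarrow> data \<Rightarrow> nat \<Rightarrow> bool" where
  "computes B nb p x y t \<longleftrightarrow> (\<exists>m. exec B nb p ((\<lambda>_. Empty)(0 := x)) t m \<and> m 0 = y)"

definition returns ::
    "fin_struct \<Rightarrow> (nat \<Rightarrow> nat list) \<Rightarrow> com \<Rightarrow> (nat list \<times> bool) list \<Rightarrow> 'p form \<Rightarrow> nat list \<Rightarrow> nat \<Rightarrow> bool"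
  where
  "returns B nb p T \<phi> v t \<longleftrightarrow>
     computes B nb p (enc_sample T) (Node (enc_form \<phi>) (enc_tuple v)) t"

definition evaluates ::
    "fin_struct \<Rightarrow> (nat \<Rightarrow> nat list) \<Rightarrow> com \<Rightarrow> 'p form \<Rightarrow> nat list \<Rightarrow> nat list \<Rightarrow> bool \<Rightarrow> nat \<Rightarrow> bool"
  where
  "evaluates B nb p \<phi> v u b t \<longleftrightarrow>
     computes B nb p (Node (Node (enc_form \<phi>) (enc_tuple v)) (enc_tuple u)) (enc_bool b) t"

definition examples :: "nat \<Rightarrow> fin_struct \<Rightarrow> (nat list \<times> bool) set" where
  "examples k B = tuples k (univ B) \<times> UNIV"

definition sample_bound :: "nat \<Rightarrow> fin_struct \<Rightarrow> real \<Rightarrow> real \<Rightarrow> nat" where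
  "sample_bound s B \<epsilon> \<delta> = s * nat \<lceil>log 2 (real (card (univ B)) / \<delta>) / \<epsilon>\<^sup>2\<rceil>"

end

theory Submission
  imports Defs
begin

text \<open>
  Formulas of binding rank at most \<open>r\<close> and binding width at most \<open>w\<close> are local with radius
  \<open>(2w + 1)\<^sup>r - 1\<close>: if two tuples have isomorphic neighbourhoods of radius \<open>w(2R + 2) + R\<close>, then their
  extensions by up to \<open>w\<close> elements can be matched bijectively so that matched extensions have
  isomorphic neighbourhoods of radius \<open>R\<close>.  In structures of degree at most \<open>d\<close> only finitely many
  types of that radius occur, so every concept is given, with the same parameters, by one of a fixed
  finite list of disjunctions of sphere formulas.  Moreover, replacing a parameter that is far from
  all examples by a fixed element only renames types consistently on the sample.  Empirical risk
  minimisation may therefore be restricted to parameters near the sample, which makes it local and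
  polynomial in the length of the sample, while Hoeffding's inequality and a union bound over the
  polynomially many hypotheses give generalisation.  The sample bound is too weak for this union
  bound when \<open>|B| = 1\<close> and \<open>\<delta>\<close> is close to 1; there it suffices that the more likely label wins the
  majority vote with probability at least 1/4.
\<close>

section \<open>Locality of counting logic\<close>

text \<open>The locality theorem compares two assignments in one and the same structure, under the
  same values of the number variables. A numerical predicate is then applied to equal arguments on
  both sides, so nothing about it has to be known or computed. The price: the set of types on which
  a concept is true depends on the structure and on the number parameters, so the learner has to try
  every set of types. The radius obeys R' + 1 = (2w + 1)(R + 1). Up to w new elements may form a
  chain that starts at the old tuple, with links of length at most 2R + 1, the largest distance at
  which two R-balls still touch; one further unit per element lets an isomorphism recognise that
  distance. Parameters near the sample are random, whereas a union bound needs a class that is fixed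
  in advance. The bound therefore ranges over all |B|^l parameter tuples, which the logarithm of |B|
  in the sample size pays for; nearness serves local access and running time, not the
  statistics.\<close>

definition gball :: "fin_struct \<Rightarrow> nat \<Rightarrow> nat set \<Rightarrow> nat set" where
  "gball A s X = {b \<in> univ A. \<exists>a \<in> X. \<exists>j \<le> s. (a, b) \<in> gaifman A ^^ j}"

lemma nbhd_eq_gball: "nbhd s A us = gball A s (set us)"
  by (simp add: nbhd_def gball_def)

lemma gaifman_sym: "(a, b) \<in> gaifman A \<Longrightarrow> (b, a) \<in> gaifman A"
  by (auto simp: gaifman_def)

lemma gaifman_pow_sym: "(a, b) \<in> gaifman A ^^ j \<Longrightarrow> (b, a) \<in> gaifman A ^^ j"
proof (induction j arbitrary: b)
  case (Suc j)
  then obtain c where "(a, c) \<in> gaifman A ^^ j" "(c, b) \<in> gaifman A" by auto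
  with Suc.IH show ?case by (meson gaifman_sym relpow_Suc_I2)
qed auto

lemma gball_subset: "gball A s X \<subseteq> univ A"
  by (auto simp: gball_def)

lemma gball_mono: "X \<subseteq> Y \<Longrightarrow> s \<le> t \<Longrightarrow> gball A s X \<subseteq> gball A t Y"
  by (auto simp: gball_def) (meson order_trans subsetD)

lemma gball_Un: "gball A s (X \<union> Y) = gball A s X \<union> gball A s Y"
  by (auto simp: gball_def)

lemma gball_eq_UN: "gball A s X = (\<Union>x\<in>X. gball A s {x})"
  by (auto simp: gball_def)

lemma gball_0: "gball A 0 X = X \<inter> univ A"
  by (auto simp: gball_def)

lemma gball_self: "X \<subseteq> univ A \<Longrightarrow> X \<subseteq> gball A s X"
  by (metis gball_0 gball_mono inf.absorb1 order_refl zero_le)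

lemma gaifman_pow_univ: "(a, b) \<in> gaifman A ^^ j \<Longrightarrow> b \<in> univ A \<Longrightarrow> a \<in> univ A"
proof (induction j arbitrary: b)
  case (Suc j)
  then obtain c where "(a, c) \<in> gaifman A ^^ j" "(c, b) \<in> gaifman A" by auto
  with Suc.IH show ?case by (auto simp: gaifman_def)
qed auto

lemma gball_add: "gball A (s + t) X = gball A t (gball A s X)"
proof (intro equalityI subsetI)
  fix b assume "b \<in> gball A (s + t) X"
  then obtain a j where b: "b \<in> univ A" "a \<in> X" "j \<le> s + t" "(a, b) \<in> gaifman A ^^ j"
    by (auto simp: gball_def)
  \<comment> \<open>The walk is cut after \<open>min j s\<close> steps, so both pieces are short
    enough even when \<open>j < s\<close>.\<close>
  have "min j s + (j - min j s) = j" by simp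
  with b(4) have "(a, b) \<in> gaifman A ^^ (min j s + (j - min j s))" by simp
  then obtain c where c: "(a, c) \<in> gaifman A ^^ min j s" "(c, b) \<in> gaifman A ^^ (j - min j s)"
    by (auto simp only: relpow_add)
  have "c \<in> univ A" using c(2) b(1) gaifman_pow_univ by blast
  with b c(1) have "c \<in> gball A s X" by (auto simp: gball_def intro!: bexI[of _ a] exI[of _ "min j s"])
  with b c(2) show "b \<in> gball A t (gball A s X)"
    by (auto simp: gball_def[of A t] intro!: bexI[of _ c] exI[of _ "j - min j s"])
next
  fix b assume "b \<in> gball A t (gball A s X)"
  then obtain c a i j where "b \<in> univ A" "(c, b) \<in> gaifman A ^^ i" "i \<le> t" "a \<in> X"
     "(a, c) \<in> gaifman A ^^ j" "j \<le> s" by (auto simp: gball_def)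
  then show "b \<in> gball A (s + t) X"
    by (auto simp: gball_def relpow_add intro!: bexI[of _ a] exI[of _ "j + i"])
qed

lemma gball_sym: "b \<in> gball A s {a} \<Longrightarrow> a \<in> univ A \<Longrightarrow> a \<in> gball A s {b}"
  by (auto simp: gball_def dest: gaifman_pow_sym)

lemma gball_1: "a \<in> univ A \<Longrightarrow> b \<in> gball A (Suc 0) {a} \<longleftrightarrow> b = a \<or> (a, b) \<in> gaifman A"
proof -
  have "(\<exists>j \<le> Suc 0. (a, b) \<in> gaifman A ^^ j) \<longleftrightarrow> b = a \<or> (a, b) \<in> gaifman A"
    by (auto simp: le_Suc_eq)
  moreover assume "a \<in> univ A"
  ultimately show ?thesis by (auto simp: gball_def) (auto simp: gaifman_def)
qed

lemma gball_Suc: "gball A (Suc s) X = {b. \<exists>a \<in> gball A s X. b = a \<or> (a, b) \<in> gaifman A}"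
proof -
  have "gball A (Suc s) X = (\<Union>a\<in>gball A s X. gball A (Suc 0) {a})"
    using gball_add[of A s "Suc 0" X] gball_eq_UN[of A "Suc 0" "gball A s X"] by simp
  then show ?thesis using gball_1 gball_subset[of A s X] by blast
qed

section \<open>Matching finite sets up to an equivalence\<close>

text \<open>For an equivalence \<open>E\<close> on finite sets this means that every class has as
  many members in \<open>X\<close> as in \<open>Y\<close>. A bijection serves counting and existence
  alike and survives disjoint unions.\<close>

definition matched :: "('a \<Rightarrow> 'a \<Rightarrow> bool) \<Rightarrow> 'a set \<Rightarrow> 'a set \<Rightarrow> bool" where
  "matched E X Y \<longleftrightarrow> (\<exists>F. bij_betw F X Y \<and> (\<forall>x \<in> X. E x (F x)))"

lemma matched_mono:
  "matched E X Y \<Longrightarrow> (\<And>x y. x \<in> X \<Longrightarrow> y \<in> Y \<Longrightarrow> E x y \<Longrightarrow> E' x y) \<Longrightarrow> matched E' X Y"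
  unfolding matched_def by (metis bij_betwE)

lemma matched_filter:
  assumes "matched E X Y" "\<And>x y. x \<in> X \<Longrightarrow> y \<in> Y \<Longrightarrow> E x y \<Longrightarrow> \<phi> x \<longleftrightarrow> \<psi> y"
  shows "matched E {x \<in> X. \<phi> x} {y \<in> Y. \<psi> y}"
proof -
  obtain F where F: "bij_betw F X Y" "\<forall>x \<in> X. E x (F x)" using assms(1) by (auto simp: matched_def)
  have "\<phi> x \<longleftrightarrow> \<psi> (F x)" if "x \<in> X" for x
    using that assms(2)[of x "F x"] F bij_betwE[OF F(1)] by auto
  then have "F ` {x \<in> X. \<phi> x} = {y \<in> Y. \<psi> y}" using F(1) by (auto simp: bij_betw_def)
  then have "bij_betw F {x \<in> X. \<phi> x} {y \<in> Y. \<psi> y}"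
    using bij_betw_subset[OF F(1), of "{x \<in> X. \<phi> x}"] by auto
  then show ?thesis using F(2) by (auto simp: matched_def)
qed

lemma matched_UN:
  assumes "\<And>i. i \<in> I \<Longrightarrow> matched E (X i) (Y i)" "disjoint_family_on X I" "disjoint_family_on Y I"
  shows "matched E (\<Union>i\<in>I. X i) (\<Union>i\<in>I. Y i)"
proof -
  obtain F where F: "\<And>i. i \<in> I \<Longrightarrow> bij_betw (F i) (X i) (Y i) \<and> (\<forall>x \<in> X i. E x (F i x))"
    using assms(1) unfolding matched_def by metis
  define G where "G x = F (THE i. i \<in> I \<and> x \<in> X i) x" for x
  have G: "G x = F i x" if "i \<in> I" "x \<in> X i" for i x
  proof -
    have "(THE i. i \<in> I \<and> x \<in> X i) = i"
      by (rule the_equality) (use that assms(2) in \<open>auto simp: disjoint_family_on_def\<close>)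
    then show ?thesis by (simp add: G_def)
  qed
  have "bij_betw G (X i) (Y i)" if "i \<in> I" for i
    using F[OF that] bij_betw_cong[of "X i" G "F i" "Y i"] G[OF that] by auto
  then have "bij_betw G (\<Union>i\<in>I. X i) (\<Union>i\<in>I. Y i)"
    by (rule bij_betw_UNION_disjoint[OF assms(3)])
  moreover have "\<forall>x \<in> (\<Union>i\<in>I. X i). E x (G x)" using F G by auto
  ultimately show ?thesis by (auto simp: matched_def)
qed

lemma matched_Un:
  assumes "matched E X Y" "matched E X' Y'" "X \<inter> X' = {}" "Y \<inter> Y' = {}"
  shows "matched E (X \<union> X') (Y \<union> Y')"
proof -
  have "matched E (\<Union>b\<in>UNIV. if b then X else X') (\<Union>b\<in>UNIV. if b then Y else Y')"
    by (rule matched_UN) (use assms in \<open>auto simp: disjoint_family_on_def\<close>)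
  then show ?thesis by (simp add: UNIV_bool Un_commute)
qed

text \<open>The bijection between \<open>X\<close> and \<open>Y\<close> need not send
  \<open>X0\<close> to \<open>Y0\<close>, so it cannot be restricted. Counting inside each class of
  \<open>E\<close> works: there the numbers subtract, and any bijection within a class respects
  \<open>E\<close>.\<close>

lemma matched_Diff:
  assumes sym: "\<And>x y. E x y \<Longrightarrow> E y x" and trans: "\<And>x y z. E x y \<Longrightarrow> E y z \<Longrightarrow> E x z"
    and fin: "finite X" "finite Y" and M: "matched E X Y" and M0: "matched E X0 Y0"
    and sub: "X0 \<subseteq> X" "Y0 \<subseteq> Y"
  shows "matched E (X - X0) (Y - Y0)"
proof -
  define cl where "cl c = Collect (E c)" for c
  define I where "I = cl ` (X \<union> Y)"
  have card_eq: "card (X' \<inter> cl c) = card (Y' \<inter> cl c)" if "matched E X' Y'" for X' Y' c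
  proof -
    have "matched E {x \<in> X'. x \<in> cl c} {y \<in> Y'. y \<in> cl c}"
      by (rule matched_filter[OF that]) (unfold cl_def mem_Collect_eq, use sym trans in blast)
    then show ?thesis by (auto simp: matched_def Int_def dest: bij_betw_same_card)
  qed
  \<comment> \<open>Every element of \<open>X\<close> or \<open>Y\<close> has a partner; going there
    and back gives reflexivity.\<close>
  have refl: "E x x" if "x \<in> X \<union> Y" for x
  proof -
    obtain F where "bij_betw F X Y" "\<forall>x \<in> X. E x (F x)" using M by (auto simp: matched_def)
    then have "\<exists>y. E x y" using that sym unfolding bij_betw_def by blast
    then show ?thesis using sym trans by blast
  qed
  have "matched E (\<Union>C\<in>I. (X - X0) \<inter> C) (\<Union>C\<in>I. (Y - Y0) \<inter> C)"
  proof (rule matched_UN)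
    fix C assume "C \<in> I"
    then obtain c where C: "C = cl c" by (auto simp: I_def)
    have "card ((X - X0) \<inter> cl c) = card (X \<inter> cl c) - card (X0 \<inter> cl c)"
      using sub fin by (subst card_Diff_subset[symmetric])
        (auto intro: finite_subset simp: Diff_Int_distrib2)
    also have "\<dots> = card (Y \<inter> cl c) - card (Y0 \<inter> cl c)" using card_eq M M0 by simp
    also have "\<dots> = card ((Y - Y0) \<inter> cl c)"
      using sub fin by (subst card_Diff_subset[symmetric])
        (auto intro: finite_subset simp: Diff_Int_distrib2)
    finally obtain F where F: "bij_betw F ((X - X0) \<inter> C) ((Y - Y0) \<inter> C)"
      using fin C finite_same_card_bij[of "(X - X0) \<inter> C" "(Y - Y0) \<inter> C"] by auto
    have "E x (F x)" if "x \<in> (X - X0) \<inter> C" for x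
      using that bij_betwE[OF F] C sym trans unfolding cl_def by blast
    with F show "matched E ((X - X0) \<inter> C) ((Y - Y0) \<inter> C)" by (auto simp: matched_def)
  next
    have "C \<inter> C' = {}" if "C \<in> I" "C' \<in> I" "C \<noteq> C'" for C C'
      using that sym trans unfolding I_def cl_def by blast
    then show "disjoint_family_on (\<lambda>C. (X - X0) \<inter> C) I" "disjoint_family_on (\<lambda>C. (Y - Y0) \<inter> C) I"
      unfolding disjoint_family_on_def by blast+
  qed
  moreover have "(\<Union>C\<in>I. (X - X0) \<inter> C) = X - X0" "(\<Union>C\<in>I. (Y - Y0) \<inter> C) = Y - Y0"
    using refl by (auto simp: I_def cl_def)
  ultimately show ?thesis by simp
qed

text \<open>The assignments over which a binder of the variables \<open>J\<close> ranges.\<close>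

definition Ext :: "'b set \<Rightarrow> 'a set \<Rightarrow> ('a \<Rightarrow> 'b) \<Rightarrow> ('a \<Rightarrow> 'b) set" where
  "Ext U J p = {p'. (\<forall>i \<in> J. p' i \<in> U) \<and> (\<forall>i. i \<notin> J \<longrightarrow> p' i = p i)}"

lemma finite_Ext: "finite U \<Longrightarrow> finite J \<Longrightarrow> finite (Ext U J p)"
proof -
  assume "finite U" "finite J"
  then have "finite ((\<lambda>g i. if i \<in> J then g i else p i) ` (J \<rightarrow>\<^sub>E U))" by (intro finite_imageI finite_PiE)
  moreover have "Ext U J p \<subseteq> (\<lambda>g i. if i \<in> J then g i else p i) ` (J \<rightarrow>\<^sub>E U)"
  proof
    fix p' assume "p' \<in> Ext U J p"
    then show "p' \<in> (\<lambda>g i. if i \<in> J then g i else p i) ` (J \<rightarrow>\<^sub>E U)"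
      by (intro image_eqI[of _ _ "restrict p' J"]) (auto simp: Ext_def fun_eq_iff)
  qed
  ultimately show ?thesis by (rule finite_subset[rotated])
qed

section \<open>Isomorphisms between Gaifman balls\<close>

locale finite_structure =
  fixes A :: fin_struct
  assumes finite_univ: "finite (univ A)"
    and rel_univ: "t \<in> rel A i \<Longrightarrow> set t \<subseteq> univ A"
begin

lemma gball_tuple: "t \<in> rel A i \<Longrightarrow> a \<in> set t \<Longrightarrow> a \<in> gball A e X \<Longrightarrow> set t \<subseteq> gball A (Suc e) X"
proof
  fix b assume t: "t \<in> rel A i" "a \<in> set t" "a \<in> gball A e X" "b \<in> set t"
  then have "b = a \<or> (a, b) \<in> gaifman A" using rel_univ[of t i] by (auto simp: gaifman_def)
  then show "b \<in> gball A (Suc e) X" using t(3) by (auto simp: gball_Suc)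
qed

text \<open>An isomorphism between the substructures of \<open>A\<close> induced by \<open>X\<close>
  and \<open>Y\<close>; centres are left to \<open>sim\<close>.\<close>

definition piso :: "(nat \<Rightarrow> nat) \<Rightarrow> nat set \<Rightarrow> nat set \<Rightarrow> bool" where
  "piso f X Y \<longleftrightarrow> bij_betw f X Y \<and> (\<forall>i. \<forall>t \<in> lists X. t \<in> rel A i \<longleftrightarrow> map f t \<in> rel A i)"

lemma piso_rel: "piso f X Y \<Longrightarrow> set t \<subseteq> X \<Longrightarrow> map f t \<in> rel A i \<longleftrightarrow> t \<in> rel A i"
  by (simp add: piso_def in_lists_conv_set subset_iff)

lemma piso_restrict: "piso f X Y \<Longrightarrow> X' \<subseteq> X \<Longrightarrow> piso f X' (f ` X')"
  using lists_mono[of X' X] unfolding piso_def bij_betw_def by (meson inj_on_subset subsetD)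

lemma piso_inv: "piso f X Y \<Longrightarrow> piso (inv_into X f) Y X"
proof -
  assume f: "piso f X Y"
  have "t \<in> rel A i \<longleftrightarrow> map (inv_into X f) t \<in> rel A i" if "t \<in> lists Y" for t i
  proof -
    have "map (inv_into X f) t \<in> lists X"
      using that f inv_into_into[of _ f X] by (auto simp: piso_def bij_betw_def)
    moreover have "map f (map (inv_into X f) t) = t"
      using that f by (auto simp: piso_def bij_betw_def f_inv_into_f intro!: map_idI)
    ultimately show ?thesis using f by (metis piso_def)
  qed
  with f show ?thesis by (simp add: piso_def bij_betw_inv_into)
qed

lemma piso_comp: "piso f X Y \<Longrightarrow> piso g Y Z \<Longrightarrow> piso (g \<circ> f) X Z"
proof -
  assume f: "piso f X Y" and g: "piso g Y Z"
  have "t \<in> rel A i \<longleftrightarrow> map (g \<circ> f) t \<in> rel A i" if "t \<in> lists X" for t i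
  proof -
    have "map f t \<in> lists Y" using that f by (auto simp: piso_def bij_betw_def)
    then show ?thesis using that f g by (metis map_map piso_def)
  qed
  with f g show ?thesis by (auto simp: piso_def intro: bij_betw_trans)
qed

text \<open>An edge is witnessed by a tuple of a relation, and \<open>f\<close> sees that tuple only
  if all of it lies in the ball. Depth \<open>e < D\<close> guarantees this; on the rim an edge may
  be witnessed only by tuples that leave the ball.\<close>

lemma piso_gaifman:
  assumes f: "piso f (gball A D P) Y" and a: "a \<in> gball A e P" "e < D" and ab: "(a, b) \<in> gaifman A"
  shows "(f a, f b) \<in> gaifman A"
proof -
  obtain i t where t: "t \<in> rel A i" "a \<in> set t" "b \<in> set t" "a \<noteq> b" using ab by (auto simp: gaifman_def)
  have sub: "set t \<subseteq> gball A D P"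
    using gball_tuple[OF t(1,2) a(1)] gball_mono[of P P "Suc e" D A] a(2) by auto
  then have "map f t \<in> rel A i" using piso_rel[OF f] t(1) by simp
  moreover have "f a \<noteq> f b" using f t(2-4) sub unfolding piso_def bij_betw_def inj_on_def by blast
  ultimately show ?thesis using t rel_univ[of "map f t" i] by (force simp: gaifman_def)
qed

text \<open>A path of length \<open>t\<close> that starts at depth \<open>e\<close> never gets
  deeper than \<open>D\<close>, so its edges can be pushed forward one by one. Only this inclusion
  is direct; \<open>piso_gball_eq\<close> gets the other one from the inverse map.\<close>

lemma piso_gball_le:
  assumes f: "piso f (gball A D P) Y" "Y \<subseteq> univ A"
    and x: "x \<in> gball A e P" "e + t \<le> D" and y: "y \<in> gball A t {x}"
  shows "f y \<in> gball A t {f x}"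
  using y x(2)
proof (induction t arbitrary: y)
  case 0
  then have "f x \<in> Y" using f x(1) gball_mono[of P P e D A] by (auto simp: piso_def bij_betw_def)
  with 0 f(2) show ?case by (auto simp: gball_0)
next
  case (Suc t)
  from Suc.prems obtain z where z: "z \<in> gball A t {x}" "y = z \<or> (z, y) \<in> gaifman A"
    by (auto simp: gball_Suc)
  have "z \<in> gball A (e + t) P" using z(1) x(1) by (auto simp: gball_add gball_eq_UN[of A t "gball A e P"])
  then have "f y = f z \<or> (f z, f y) \<in> gaifman A"
    using piso_gaifman[OF f(1), of z "e + t" y] z(2) Suc.prems(2) by auto
  moreover have "f z \<in> gball A t {f x}" using Suc.IH[OF z(1)] Suc.prems by simp
  ultimately show ?case by (auto simp: gball_Suc)
qed

lemma piso_gball_eq: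
  assumes f: "piso f (gball A D P) (gball A D Q)" "f ` P = Q" "P \<subseteq> univ A"
    and Z: "Z \<subseteq> gball A e P" "e + t \<le> D"
  shows "f ` gball A t Z = gball A t (f ` Z)"
proof -
  let ?g = "inv_into (gball A D P) f"
  have inj: "inj_on f (gball A D P)" using f(1) by (simp add: piso_def bij_betw_def)
  have P: "P \<subseteq> gball A D P" using gball_self f(3) .
  have g: "piso ?g (gball A D Q) (gball A D P)" using piso_inv f(1) .
  have gf: "?g (f x) = x" if "x \<in> gball A D P" for x using inj that by simp
  have ZD: "Z \<subseteq> gball A D P" using Z gball_mono[of P P e D A] by auto
  \<comment> \<open>The images lie no deeper around \<open>Q\<close> than \<open>Z\<close> lies
    around \<open>P\<close>, so the inverse map can be treated in the same way.\<close>
  have fZ: "f z \<in> gball A e Q" if z: "z \<in> Z" for z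
  proof -
    obtain a where a: "a \<in> P" "z \<in> gball A e {a}" using z Z(1) by (auto simp: gball_eq_UN[of A e P])
    have "a \<in> gball A 0 P" using a(1) f(3) by (auto simp: gball_0)
    then have "f z \<in> gball A e {f a}"
      using piso_gball_le[OF f(1) gball_subset _ _ a(2), of 0] Z(2) by auto
    then show ?thesis using gball_mono[of "{f a}" Q e e A] a(1) f(2) by auto
  qed
  have one: "f ` gball A t {z} = gball A t {f z}" if z: "z \<in> Z" for z
  proof (intro equalityI subsetI)
    fix y assume "y \<in> f ` gball A t {z}"
    then show "y \<in> gball A t {f z}" using piso_gball_le[OF f(1) gball_subset _ Z(2)] z Z(1) by auto
  next
    fix y assume y: "y \<in> gball A t {f z}"
    then have "?g y \<in> gball A t {?g (f z)}" using piso_gball_le[OF g gball_subset fZ[OF z] Z(2)] by auto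
    then have "?g y \<in> gball A t {z}" using gf ZD z by auto
    moreover have "y \<in> gball A D Q"
      using y fZ[OF z] Z(2) gball_mono[of "{f z}" "gball A e Q" t t A] gball_add[of A e t Q]
        gball_mono[of Q Q "e + t" D A] by auto
    then have "f (?g y) = y" using f(1) by (auto simp: piso_def bij_betw_def f_inv_into_f)
    ultimately show "y \<in> f ` gball A t {z}" by force
  qed
  show ?thesis
    using one by (subst (1 2) gball_eq_UN) (simp add: image_UN)
qed

lemma piso_gball:
  assumes "piso f (gball A D P) (gball A D Q)" "f ` P = Q" "P \<subseteq> univ A"
    and "Z \<subseteq> gball A e P" "e + t \<le> D"
  shows "piso f (gball A t Z) (gball A t (f ` Z))"
proof -
  have "gball A t Z \<subseteq> gball A D P"
    using assms(4,5) gball_mono[of Z "gball A e P" t t A] gball_add[of A e t P]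
        gball_mono[of P P "e + t" D A] by auto
  then show ?thesis using piso_restrict[OF assms(1)] piso_gball_eq[OF assms] by metis
qed

text \<open>Distance 2R + 1 is tested by letting balls of radius R + 1 and R meet in the middle.
  Following whole paths from \<open>x\<close> would need depth e + 2R + 1; this way e + R + 1
  suffices.\<close>

lemma piso_near:
  assumes f: "piso f (gball A D P) (gball A D Q)" "f ` P = Q" "P \<subseteq> univ A"
    and xy: "x \<in> gball A e P" "y \<in> gball A e P" "e + Suc R \<le> D"
  shows "y \<in> gball A (2 * R + 1) {x} \<longleftrightarrow> f y \<in> gball A (2 * R + 1) {f x}"
proof -
  have inj: "inj_on f (gball A D P)" using f(1) by (simp add: piso_def bij_betw_def)
  have near: "b \<in> gball A (2 * R + 1) {a} \<longleftrightarrow> gball A (Suc R) {a} \<inter> gball A R {b} \<noteq> {}"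
    if "a \<in> univ A" "b \<in> univ A" for a b
  proof -
    have "gball A (2 * R + 1) {a} = (\<Union>z\<in>gball A (Suc R) {a}. gball A R {z})"
      using gball_add[of A "Suc R" R "{a}"] gball_eq_UN[of A R "gball A (Suc R) {a}"] by (simp add: mult_2)
    then show ?thesis using that gball_sym[of _ A R] gball_subset[of A "Suc R" "{a}"] by blast
  qed
  have *: "f ` gball A (Suc R) {x} = gball A (Suc R) {f x}" "f ` gball A R {y} = gball A R {f y}"
    using piso_gball_eq[OF f, of "{x}" e "Suc R"] piso_gball_eq[OF f, of "{y}" e R] xy by auto
  have sub: "gball A t {z} \<subseteq> gball A D P" if "z \<in> gball A e P" "e + t \<le> D" for z t
    using that gball_mono[of "{z}" "gball A e P" t t A] gball_add[of A e t P]
        gball_mono[of P P "e + t" D A] by auto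
  have "f ` (gball A (Suc R) {x} \<inter> gball A R {y}) = f ` gball A (Suc R) {x} \<inter> f ` gball A R {y}"
    by (rule inj_on_image_Int[OF inj]) (use sub xy in auto)
  then have "gball A (Suc R) {x} \<inter> gball A R {y} \<noteq> {} \<longleftrightarrow> gball A (Suc R) {f x} \<inter> gball A R {f y} \<noteq> {}"
    using * by auto
  moreover have "x \<in> univ A" "y \<in> univ A" using xy gball_subset by blast+
  moreover have "f x \<in> univ A" "f y \<in> univ A"
    using f(1) xy gball_mono[of P P e D A] gball_subset[of A D Q]
    by (auto simp: piso_def bij_betw_def)
  ultimately show ?thesis using near by simp
qed

lemma piso_disjoint_union:
  assumes f: "piso f X1 Y1" and g: "piso g X2 Y2"
    and X: "X1 \<inter> X2 = {}" "\<And>i t. t \<in> rel A i \<Longrightarrow> set t \<subseteq> X1 \<union> X2 \<Longrightarrow> set t \<subseteq> X1 \<or> set t \<subseteq> X2"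
    and Y: "Y1 \<inter> Y2 = {}" "\<And>i t. t \<in> rel A i \<Longrightarrow> set t \<subseteq> Y1 \<union> Y2 \<Longrightarrow> set t \<subseteq> Y1 \<or> set t \<subseteq> Y2"
  shows "piso (\<lambda>x. if x \<in> X1 then f x else g x) (X1 \<union> X2) (Y1 \<union> Y2)"
proof -
  let ?h = "\<lambda>x. if x \<in> X1 then f x else g x"
  have b1: "bij_betw ?h X1 Y1" using f by (auto simp: piso_def cong: bij_betw_cong)
  have "bij_betw ?h X2 Y2 \<longleftrightarrow> bij_betw g X2 Y2" by (rule bij_betw_cong) (use X(1) in auto)
  then have b2: "bij_betw ?h X2 Y2" using g by (auto simp: piso_def)
  have bij: "bij_betw ?h (X1 \<union> X2) (Y1 \<union> Y2)" using bij_betw_combine[OF b1 b2 Y(1)] .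
  have h1: "t \<in> rel A i \<longleftrightarrow> map ?h t \<in> rel A i" if "set t \<subseteq> X1" for t i
  proof -
    have "map ?h t = map f t" using that by (intro map_cong) auto
    then show ?thesis using piso_rel[OF f that] by (simp only:)
  qed
  have h2: "t \<in> rel A i \<longleftrightarrow> map ?h t \<in> rel A i" if "set t \<subseteq> X2" for t i
  proof -
    have "map ?h t = map g t" using that X(1) by (intro map_cong) auto
    then show ?thesis using piso_rel[OF g that] by (simp only:)
  qed
  have "t \<in> rel A i \<longleftrightarrow> map ?h t \<in> rel A i" if t: "t \<in> lists (X1 \<union> X2)" for t i
  proof (rule iffI)
    assume r: "t \<in> rel A i"
    then have "set t \<subseteq> X1 \<or> set t \<subseteq> X2" using X(2)[OF r] t by auto
    then show "map ?h t \<in> rel A i" using h1 h2 r by blast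
  next
    assume r: "map ?h t \<in> rel A i"
    have im: "?h x \<in> Y1 \<Longrightarrow> x \<in> X1" "?h x \<in> Y2 \<Longrightarrow> x \<in> X2" if "x \<in> X1 \<union> X2" for x
      using that b1 b2 Y(1) unfolding bij_betw_def by blast+
    have "?h ` set t \<subseteq> Y1 \<union> Y2" using t bij by (auto simp: bij_betw_def subset_iff)
    then have "?h ` set t \<subseteq> Y1 \<or> ?h ` set t \<subseteq> Y2" using Y(2)[OF r] by auto
    then have "set t \<subseteq> X1 \<or> set t \<subseteq> X2" using t im by (smt (verit) image_subset_iff in_listsD subsetI)
    then show "t \<in> rel A i" using h1 h2 r by blast
  qed
  with bij show ?thesis by (auto simp: piso_def)
qed

text \<open>A common element, or a tuple meeting both balls, would join \<open>P\<close> to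
  \<open>Q\<close> by a path of length at most R + 1 + R. This is why everything beyond 2R + 1
  counts as far.\<close>

lemma gball_disjoint:
  assumes P: "P \<subseteq> univ A" "Q \<subseteq> univ A" "Q \<inter> gball A (2 * R + 1) P = {}"
  shows "gball A R P \<inter> gball A R Q = {}"
    and "t \<in> rel A i \<Longrightarrow> set t \<subseteq> gball A R P \<union> gball A R Q \<Longrightarrow> set t \<subseteq> gball A R P \<or> set t \<subseteq> gball A R Q"
proof -
  have *: False if x: "x \<in> gball A R P" "x = y \<or> (x, y) \<in> gaifman A" "y \<in> gball A R Q" for x y
  proof -
    obtain q where q: "q \<in> Q" "y \<in> gball A R {q}" using x(3) by (auto simp: gball_eq_UN[of A R Q])
    have "q \<in> gball A R {y}" using gball_sym q P(2) by blast
    moreover have "y \<in> gball A (Suc R) P" using x by (auto simp: gball_Suc)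
    ultimately have "q \<in> gball A (Suc R + R) P" unfolding gball_add
      by (auto simp: gball_eq_UN[of A R "gball A (Suc R) P"])
    then show False using q(1) P(3) by (auto simp: mult_2)
  qed
  then show "gball A R P \<inter> gball A R Q = {}" by blast
  show "set t \<subseteq> gball A R P \<or> set t \<subseteq> gball A R Q"
    if t: "t \<in> rel A i" "set t \<subseteq> gball A R P \<union> gball A R Q"
  proof (rule ccontr)
    assume "\<not> ?thesis"
    then obtain x y where "x \<in> set t" "y \<in> set t" "x \<in> gball A R P" "y \<in> gball A R Q" using t(2) by blast
    moreover from this have "x = y \<or> (x, y) \<in> gaifman A" using t(1) rel_univ[of t i] by (auto simp: gaifman_def)
    ultimately show False using * by blast
  qed
qed

section \<open>Neighbourhood equivalence of assignments\<close>

definition sim :: "nat \<Rightarrow> nat set \<Rightarrow> (nat \<Rightarrow> nat) \<Rightarrow> (nat \<Rightarrow> nat) \<Rightarrow> bool" where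
  "sim s K p q \<longleftrightarrow> p ` K \<subseteq> univ A \<and> q ` K \<subseteq> univ A \<and>
     (\<exists>f. piso f (gball A s (p ` K)) (gball A s (q ` K)) \<and> (\<forall>i \<in> K. f (p i) = q i))"

lemma sim_refl: "p ` K \<subseteq> univ A \<Longrightarrow> sim s K p p"
  using bij_betw_id[of "gball A s (p ` K)"] by (auto simp: sim_def piso_def id_def intro!: exI[of _ "\<lambda>x. x"])

lemma sim_sym: "sim s K p q \<Longrightarrow> sim s K q p"
proof -
  assume "sim s K p q"
  then obtain f where f: "p ` K \<subseteq> univ A" "q ` K \<subseteq> univ A" "piso f (gball A s (p ` K)) (gball A s (q ` K))"
    "\<forall>i \<in> K. f (p i) = q i" by (auto simp: sim_def)
  have "inv_into (gball A s (p ` K)) f (q i) = p i" if "i \<in> K" for i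
  proof -
    have "p i \<in> gball A s (p ` K)" using gball_self[OF f(1), of s] that by blast
    then have "inv_into (gball A s (p ` K)) f (f (p i)) = p i" using f(3) by (auto simp: piso_def bij_betw_def)
    then show ?thesis using f(4) that by simp
  qed
  then show ?thesis using f piso_inv[OF f(3)] by (auto simp: sim_def)
qed

lemma sim_trans: "sim s K p q \<Longrightarrow> sim s K q p' \<Longrightarrow> sim s K p p'"
  unfolding sim_def by (metis comp_apply piso_comp)

lemma sim_cong: "sim s K p q \<Longrightarrow> (\<And>i. i \<in> K \<Longrightarrow> p i = p' i) \<Longrightarrow> (\<And>i. i \<in> K \<Longrightarrow> q i = q' i) \<Longrightarrow> sim s K p' q'"
proof -
  assume *: "sim s K p q" "\<And>i. i \<in> K \<Longrightarrow> p i = p' i" "\<And>i. i \<in> K \<Longrightarrow> q i = q' i"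
  then have "p ` K = p' ` K" "q ` K = q' ` K" by (auto simp: image_def)
  with * show ?thesis unfolding sim_def by auto
qed

lemma sim_mono: "sim s K p q \<Longrightarrow> K' \<subseteq> K \<Longrightarrow> s' \<le> s \<Longrightarrow> sim s' K' p q"
proof -
  assume s: "sim s K p q" and K: "K' \<subseteq> K" "s' \<le> s"
  then obtain f where f: "p ` K \<subseteq> univ A" "q ` K \<subseteq> univ A" "piso f (gball A s (p ` K)) (gball A s (q ` K))"
    "\<forall>i \<in> K. f (p i) = q i" by (auto simp: sim_def)
  have im: "f ` (p ` K') = q ` K'" "f ` (p ` K) = q ` K" using f(4) K(1) by (auto simp: image_image intro!: image_cong)
  have "piso f (gball A s' (p ` K')) (gball A s' (f ` (p ` K')))"
    by (rule piso_gball[OF f(3) im(2) f(1), of _ 0]) (use K f(1) in \<open>auto simp: gball_0\<close>)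
  then show ?thesis using K f im unfolding sim_def by (intro conjI exI[of _ f]) auto
qed

text \<open>By \<open>gball_disjoint\<close> no tuple connects the two balls on either side, so the
  two isomorphisms can be glued.\<close>

lemma sim_union:
  assumes K: "sim R K p q" and J: "sim R J p q"
    and far: "p ` J \<inter> gball A (2 * R + 1) (p ` K) = {}" "q ` J \<inter> gball A (2 * R + 1) (q ` K) = {}"
  shows "sim R (K \<union> J) p q"
proof -
  obtain f where f: "p ` K \<subseteq> univ A" "q ` K \<subseteq> univ A" "piso f (gball A R (p ` K)) (gball A R (q ` K))"
    "\<forall>i \<in> K. f (p i) = q i" using K by (auto simp: sim_def)
  obtain g where g: "p ` J \<subseteq> univ A" "q ` J \<subseteq> univ A" "piso g (gball A R (p ` J)) (gball A R (q ` J))"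
    "\<forall>i \<in> J. g (p i) = q i" using J by (auto simp: sim_def)
  note d = gball_disjoint[OF f(1) g(1) far(1)] gball_disjoint[OF f(2) g(2) far(2)]
  let ?h = "\<lambda>x. if x \<in> gball A R (p ` K) then f x else g x"
  have "piso ?h (gball A R (p ` K) \<union> gball A R (p ` J)) (gball A R (q ` K) \<union> gball A R (q ` J))"
    by (rule piso_disjoint_union[OF f(3) g(3)]) (use d in auto)
  then have "piso ?h (gball A R (p ` (K \<union> J))) (gball A R (q ` (K \<union> J)))"
    by (simp add: gball_Un image_Un)
  moreover have "?h (p i) = q i" if "i \<in> K \<union> J" for i
    using that f(4) g(4) d(1) gball_self[OF f(1), of R] gball_self[OF g(1), of R] by auto
  ultimately show ?thesis using f g unfolding sim_def by (intro conjI exI[of _ ?h]) auto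
qed

end

section \<open>Matching the extensions of equivalent assignments\<close>

context finite_structure begin

text \<open>An isomorphism of \<open>R\<close>-balls does not by itself control whether two centres
  are within 2R + 1, which decides whether a new element counts as near. The induction over the new
  elements ends at radius \<open>R\<close>, so this information is a separate invariant.\<close>

definition near :: "nat \<Rightarrow> nat set \<Rightarrow> (nat \<Rightarrow> nat) \<Rightarrow> (nat \<Rightarrow> nat) \<Rightarrow> bool" where
  "near R K p q \<longleftrightarrow> (\<forall>i \<in> K. \<forall>j \<in> K.
     p j \<in> gball A (2 * R + 1) {p i} \<longleftrightarrow> q j \<in> gball A (2 * R + 1) {q i})"

lemma near_cong: "near s K p q \<Longrightarrow> (\<And>i. i \<in> K \<Longrightarrow> p i = p' i) \<Longrightarrow> (\<And>i. i \<in> K \<Longrightarrow> q i = q' i) \<Longrightarrow> near s K p' q'"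
  by (simp add: near_def)

abbreviation simN :: "nat \<Rightarrow> nat set \<Rightarrow> (nat \<Rightarrow> nat) \<Rightarrow> (nat \<Rightarrow> nat) \<Rightarrow> bool" where
  "simN R K p q \<equiv> sim R K p q \<and> near R K p q"

text \<open>As long as the radius exceeds \<open>R\<close>, the extra invariant comes for free: this
  is \<open>piso_near\<close> for points at depth 0.\<close>

lemma near_of_sim:
  assumes "sim D K p q" "Suc R \<le> D"
  shows "near R K p q"
proof -
  obtain f where f: "p ` K \<subseteq> univ A" "q ` K \<subseteq> univ A" "piso f (gball A D (p ` K)) (gball A D (q ` K))"
    "\<forall>i \<in> K. f (p i) = q i" using assms by (auto simp: sim_def)
  have "f ` (p ` K) = q ` K" using f(4) by (auto simp: image_image intro!: image_cong)
  note n = piso_near[OF f(3) this f(1), of _ 0 _ R]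
  have "p j \<in> gball A (2 * R + 1) {p i} \<longleftrightarrow> q j \<in> gball A (2 * R + 1) {q i}" if "i \<in> K" "j \<in> K" for i j
  proof -
    have "p i \<in> gball A 0 (p ` K)" "p j \<in> gball A 0 (p ` K)" using that f(1) by (auto simp: gball_0)
    from n[OF this] show ?thesis using that f(4) assms(2) by simp
  qed
  then show ?thesis by (simp add: near_def)
qed

text \<open>
  An extension with some new element near \<open>p ` K\<close> is sorted by the set \<open>I\<close> of its near positions and
  its restriction \<open>z\<close> to them; the near part is transported along the isomorphism \<open>f\<close>, and the
  induction hypothesis matches the rest.  For extensions all of whose new elements are far only
  the type of the new elements alone matters, and every such type is realised equally often by
  the far extensions of \<open>p\<close> and of \<open>q\<close>: this holds for all extensions, and for the near ones by the
  first part.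
\<close>

lemma ext_matched:
  assumes "finite J" "J \<inter> K = {}" "sim (card J * (2 * R + 2) + R) K p q" "near R K p q"
  shows "matched (simN R (K \<union> J)) (Ext (univ A) J p) (Ext (univ A) J q)"
  using assms
proof (induction "card J" arbitrary: J K p q rule: less_induct)
  case less
  define m where "m = 2 * R + 1"
  define D where "D = card J * (2 * R + 2) + R"
  define NP where "NP = gball A m (p ` K)"
  define NQ where "NQ = gball A m (q ` K)"
  obtain f where f: "p ` K \<subseteq> univ A" "q ` K \<subseteq> univ A" "piso f (gball A D (p ` K)) (gball A D (q ` K))"
    "\<forall>i \<in> K. f (p i) = q i" using less.prems(3) by (auto simp: sim_def D_def)
  have fim: "f ` (p ` K) = q ` K" using f(4) by (auto simp: image_image intro!: image_cong)
  let ?E = "simN R (K \<union> J)"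
  \<comment> \<open>An index records which new positions are near and where they go.
    \<open>X\<close> and \<open>Y\<close> collect the extensions of \<open>p\<close> and
    \<open>q\<close> with exactly that near part, \<open>tr\<close> transporting it along
    \<open>f\<close>.\<close>
  define Z where "Z = {(I, z). I \<subseteq> J \<and> I \<noteq> {} \<and> z \<in> Ext NP I p}"
  define tr where "tr I z = (\<lambda>i. if i \<in> I then f (z i) else q i)" for I z
  define X where "X = (\<lambda>(I, z). {p' \<in> Ext (univ A) (J - I) z. \<forall>j \<in> J - I. p' j \<notin> NP})"
  define Y where "Y = (\<lambda>(I, z). {q' \<in> Ext (univ A) (J - I) (tr I z). \<forall>j \<in> J - I. q' j \<notin> NQ})"
  have card: "card J \<ge> 1 \<and> card (J - I) < card J" if "I \<subseteq> J" "I \<noteq> {}" for I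
  proof -
    have "J - I \<subset> J" using that by auto
    then have "card (J - I) < card J" by (rule psubset_card_mono[OF less.prems(1)])
    then show ?thesis by linarith
  qed
  \<comment> \<open>For empty \<open>J\<close> the radius \<open>D\<close> is just \<open>R\<close>
    and need not cover \<open>NP\<close>, but then \<open>Z\<close> is empty as well.\<close>
  have fN: "f ` NP = NQ \<and> NP \<subseteq> gball A D (p ` K)" if "card J \<ge> 1"
  proof -
    have "m \<le> D" using that by (cases "card J") (auto simp: m_def D_def)
    moreover have "p ` K \<subseteq> gball A 0 (p ` K)" using f(1) by (simp add: gball_0)
    ultimately have "f ` gball A m (p ` K) = gball A m (f ` p ` K)"
      by (intro piso_gball_eq[OF f(3) fim f(1), of _ 0]) simp_all
    moreover have "gball A m (p ` K) \<subseteq> gball A D (p ` K)" using \<open>m \<le> D\<close> by (intro gball_mono) simp_all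
    ultimately show ?thesis unfolding NP_def NQ_def fim by simp
  qed
  have inj: "inj_on f (gball A D (p ` K))" using f(3) by (simp add: piso_def bij_betw_def)
  have NPU: "NP \<subseteq> univ A" "NQ \<subseteq> univ A" using gball_subset by (auto simp: NP_def NQ_def)
  have XY: "matched ?E (X (I, z)) (Y (I, z))" if "(I, z) \<in> Z" for I z
  proof -
    have I: "I \<subseteq> J" "I \<noteq> {}" "z \<in> Ext NP I p" using that by (auto simp: Z_def)
    note c = card[OF I(1,2)]
    have z: "z i = p i" if "i \<in> K" for i using that I less.prems(2) by (auto simp: Ext_def)
    have zI: "z i \<in> NP" if "i \<in> I" for i using that I by (auto simp: Ext_def)
    have trz: "tr I z i = f (z i)" if "i \<in> K \<union> I" for i
      using that z f(4) by (auto simp: tr_def)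
    have zN: "z i \<in> NP" if "i \<in> K \<union> I" for i
    proof (cases "i \<in> I")
      case False
      then have "z i \<in> p ` K" using that z by auto
      then show ?thesis using gball_self[OF f(1), of m] unfolding NP_def by blast
    qed (use zI in blast)
    \<comment> \<open>Elements placed near have depth at most \<open>m\<close>. Placing at least one
      of them frees 2R + 2: the distance m = 2R + 1, and one unit more, without which depth m + R +
      1 for \<open>piso_near\<close> would be missing when \<open>J\<close> has one element.\<close>
    have D: "m + Suc R \<le> D" "m + (card (J - I) * (2 * R + 2) + R) \<le> D"
    proof -
      have "Suc (card (J - I)) * (2 * R + 2) \<le> card J * (2 * R + 2)"
        using c by (intro mult_right_mono) auto
      then show "m + (card (J - I) * (2 * R + 2) + R) \<le> D" by (simp add: m_def D_def)
      have "1 * (2 * R + 2) \<le> card J * (2 * R + 2)" using c by (intro mult_right_mono) auto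
      then show "m + Suc R \<le> D" by (simp add: m_def D_def)
    qed
    have sim: "sim (card (J - I) * (2 * R + 2) + R) (K \<union> I) z (tr I z)"
    proof -
      have im: "f ` (z ` (K \<union> I)) = tr I z ` (K \<union> I)" using trz by (auto simp: image_image intro!: image_cong)
      have "piso f (gball A (card (J - I) * (2 * R + 2) + R) (z ` (K \<union> I)))
          (gball A (card (J - I) * (2 * R + 2) + R) (f ` (z ` (K \<union> I))))"
        by (rule piso_gball[OF f(3) fim f(1) _ D(2)]) (use zN in \<open>auto simp: NP_def\<close>)
      moreover have "z ` (K \<union> I) \<subseteq> univ A" using zN NPU by auto
      moreover have "tr I z ` (K \<union> I) \<subseteq> univ A" using zN fN c NPU trz by auto
      ultimately show ?thesis using trz im unfolding sim_def by (intro conjI exI[of _ f]) auto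
    qed
    have near: "near R (K \<union> I) z (tr I z)"
    proof -
      note n = piso_near[OF f(3) fim f(1) _ _ D(1), folded NP_def]
      have "z j \<in> gball A (2 * R + 1) {z i} \<longleftrightarrow> tr I z j \<in> gball A (2 * R + 1) {tr I z i}"
        if "i \<in> K \<union> I" "j \<in> K \<union> I" for i j
        using n[OF zN[OF that(1)] zN[OF that(2)]] trz[OF that(1)] trz[OF that(2)] by simp
      then show ?thesis by (simp add: near_def)
    qed
    \<comment> \<open>The near positions join the fixed ones, so the induction hypothesis applies to
      the strictly smaller set \<open>J - I\<close>.\<close>
    have "matched (simN R ((K \<union> I) \<union> (J - I))) (Ext (univ A) (J - I) z) (Ext (univ A) (J - I) (tr I z))"
      by (rule less.hyps) (use c sim near less.prems(1,2) I in auto)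
    moreover have "(K \<union> I) \<union> (J - I) = K \<union> J" using I by auto
    ultimately have M: "matched ?E (Ext (univ A) (J - I) z) (Ext (univ A) (J - I) (tr I z))" by simp
    show ?thesis unfolding X_def Y_def prod.case
    proof (rule matched_filter[OF M])
      fix p' q' assume p': "p' \<in> Ext (univ A) (J - I) z" and q': "q' \<in> Ext (univ A) (J - I) (tr I z)"
        and E: "?E p' q'"
      have pK: "p' i = p i" "q' i = q i" if "i \<in> K" for i
        using that p' q' z[OF that] trz[of i] f(4) less.prems(2) by (auto simp: Ext_def)
      \<comment> \<open>Here \<open>near\<close> is consumed: lying in the enlarged ball is a
        statement about distances between positions.\<close>
      have "p' j \<in> NP \<longleftrightarrow> q' j \<in> NQ" if "j \<in> J - I" for j
      proof -
        have "p' j \<in> NP \<longleftrightarrow> (\<exists>i\<in>K. p' j \<in> gball A m {p' i})"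
          unfolding NP_def by (subst gball_eq_UN) (simp add: pK)
        also have "\<dots> \<longleftrightarrow> (\<exists>i\<in>K. q' j \<in> gball A m {q' i})"
          using E that by (auto simp: near_def m_def)
        also have "\<dots> \<longleftrightarrow> q' j \<in> NQ"
          unfolding NQ_def by (subst gball_eq_UN) (simp add: pK)
        finally show ?thesis .
      qed
      then show "(\<forall>j\<in>J - I. p' j \<notin> NP) \<longleftrightarrow> (\<forall>j\<in>J - I. q' j \<notin> NQ)" by auto
    qed
  qed
  have Xi: "I = {j \<in> J. p' j \<in> NP} \<and> z = (\<lambda>i. if i \<in> J - I then p i else p' i)"
    if "(I, z) \<in> Z" "p' \<in> X (I, z)" for I z p'
    using that by (auto simp: Z_def X_def Ext_def fun_eq_iff)
  have Yi: "I = {j \<in> J. q' j \<in> NQ} \<and> (\<forall>i \<in> I. z i \<in> NP \<and> f (z i) = q' i) \<and> (\<forall>i. i \<notin> I \<longrightarrow> z i = p i)"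
    if "(I, z) \<in> Z" "q' \<in> Y (I, z)" for I z q'
  proof -
    have "I \<subseteq> J" "I \<noteq> {}" using that by (auto simp: Z_def)
    then show ?thesis using that fN card[of I] by (auto simp: Z_def Y_def Ext_def fun_eq_iff tr_def)
  qed
  have dX: "disjoint_family_on X Z"
    unfolding disjoint_family_on_def
  proof (intro ballI impI)
    fix a b assume ab: "a \<in> Z" "b \<in> Z" "a \<noteq> b"
    obtain I z I' z' where ab': "a = (I, z)" "b = (I', z')" by (metis surj_pair)
    show "X a \<inter> X b = {}"
    proof (rule ccontr)
      assume "X a \<inter> X b \<noteq> {}"
      then obtain p' where "p' \<in> X a" "p' \<in> X b" by auto
      then have "I = I'" "z = z'" using Xi[of I z p'] Xi[of I' z' p'] ab ab' by auto
      then show False using ab ab' by simp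
    qed
  qed
  have dY: "disjoint_family_on Y Z"
    unfolding disjoint_family_on_def
  proof (intro ballI impI)
    fix a b assume ab: "a \<in> Z" "b \<in> Z" "a \<noteq> b"
    obtain I z I' z' where ab': "a = (I, z)" "b = (I', z')" by (metis surj_pair)
    show "Y a \<inter> Y b = {}"
    proof (rule ccontr)
      assume "Y a \<inter> Y b \<noteq> {}"
      then obtain q' where q': "q' \<in> Y a" "q' \<in> Y b" by auto
      have I: "I = I'" "I \<subseteq> J" "I \<noteq> {}" using q' Yi[of I z q'] Yi[of I' z' q'] ab ab' by (auto simp: Z_def)
      \<comment> \<open>\<open>q'\<close> shows the near part only through \<open>f\<close>;
        injectivity on \<open>NP\<close> recovers \<open>z\<close>.\<close>
      have inj': "inj_on f NP" using inj fN card[OF I(2,3)] inj_on_subset by blast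
      have "z i = z' i" for i
      proof (cases "i \<in> I")
        case True
        then have "z i \<in> NP" "z' i \<in> NP" "f (z i) = f (z' i)"
          using Yi[of I z q'] Yi[of I' z' q'] q' ab ab' I(1) by auto
        then show ?thesis using inj' by (auto simp: inj_on_def)
      next
        case False
        then show ?thesis using Yi[of I z q'] Yi[of I' z' q'] q' ab ab' I(1) by auto
      qed
      then show False using ab ab' I(1) by auto
    qed
  qed
  have M1: "matched ?E (\<Union>a\<in>Z. X a) (\<Union>a\<in>Z. Y a)"
    by (rule matched_UN) (use XY dX dY in auto)
  define Xn where "Xn = {p' \<in> Ext (univ A) J p. \<exists>j \<in> J. p' j \<in> NP}"
  define Yn where "Yn = {q' \<in> Ext (univ A) J q. \<exists>j \<in> J. q' j \<in> NQ}"
  have UX: "(\<Union>a\<in>Z. X a) = Xn"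
  proof (intro equalityI subsetI)
    fix p' assume "p' \<in> (\<Union>a\<in>Z. X a)"
    then obtain I z where Iz: "(I, z) \<in> Z" "p' \<in> X (I, z)" by auto
    then have I: "I \<subseteq> J" "I \<noteq> {}" by (auto simp: Z_def)
    have 1: "p' i \<in> NP" "p' i \<in> univ A" if "i \<in> I" for i
      using Iz that NPU by (auto simp: Z_def X_def Ext_def)
    have 2: "p' i = p i" if "i \<notin> J" for i
      using Iz that I by (auto simp: Z_def X_def Ext_def)
    have 3: "p' i \<in> univ A" if "i \<in> J - I" for i
      using Iz that by (auto simp: Z_def X_def Ext_def)
    have "p' i \<in> univ A" if "i \<in> J" for i using that 1(2) 3 by (cases "i \<in> I") auto
    then have "p' \<in> Ext (univ A) J p" unfolding Ext_def using 2 by auto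
    then show "p' \<in> Xn" using 1 I by (auto simp: Xn_def)
  next
    fix p' assume p': "p' \<in> Xn"
    define I where "I = {j \<in> J. p' j \<in> NP}"
    define z where "z = (\<lambda>i. if i \<in> J - I then p i else p' i)"
    have "(I, z) \<in> Z" "p' \<in> X (I, z)"
      using p' by (auto simp: Xn_def Z_def X_def Ext_def I_def z_def)
    then show "p' \<in> (\<Union>a\<in>Z. X a)" by blast
  qed
  have UY: "(\<Union>a\<in>Z. Y a) = Yn"
  proof (intro equalityI subsetI)
    fix q' assume "q' \<in> (\<Union>a\<in>Z. Y a)"
    then obtain I z where Iz: "(I, z) \<in> Z" "q' \<in> Y (I, z)" by auto
    then have I: "I \<subseteq> J" "I \<noteq> {}" by (auto simp: Z_def)
    have 1: "q' i = f (z i)" "f (z i) \<in> NQ" if "i \<in> I" for i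
      using Iz that fN card[OF I] I by (auto simp: Z_def Y_def Ext_def tr_def)
    have 2: "q' i = q i" if "i \<notin> J" for i
      using Iz that I by (auto simp: Z_def Y_def Ext_def tr_def)
    have 3: "q' i \<in> univ A" if "i \<in> J - I" for i
      using Iz that by (auto simp: Z_def Y_def Ext_def tr_def)
    have "q' i \<in> univ A" if "i \<in> J" for i using that 1 3 NPU by (cases "i \<in> I") auto
    then have "q' \<in> Ext (univ A) J q" unfolding Ext_def using 2 by auto
    then show "q' \<in> Yn" using 1 I unfolding Yn_def by (metis (mono_tags, lifting) all_not_in_conv mem_Collect_eq subsetD)
  next
    fix q' assume q': "q' \<in> Yn"
    define I where "I = {j \<in> J. q' j \<in> NQ}"
    have I: "I \<subseteq> J" "I \<noteq> {}" using q' by (auto simp: I_def Yn_def)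
    define z where "z = (\<lambda>i. if i \<in> I then inv_into NP f (q' i) else p i)"
    have z: "z i \<in> NP" "f (z i) = q' i" if "i \<in> I" for i
    proof -
      have "q' i \<in> f ` NP" using that fN card[OF I] by (auto simp: I_def)
      then show "z i \<in> NP" "f (z i) = q' i" using that by (auto simp: z_def inv_into_into f_inv_into_f)
    qed
    have "(I, z) \<in> Z" using z I by (auto simp: Z_def Ext_def z_def)
    moreover have "q' \<in> Y (I, z)"
      using q' z by (auto simp: Y_def Ext_def Yn_def tr_def I_def)
    ultimately show "q' \<in> (\<Union>a\<in>Z. Y a)" by blast
  qed
  have M1: "matched ?E Xn Yn" using M1 UX UY by simp
  have simN_sym: "simN R J q' p'" if "simN R J p' q'" for p' q'
    using that sim_sym unfolding near_def by blast
  have simN_trans: "simN R J p' r'" if "simN R J p' q'" "simN R J q' r'" for p' q' r'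
    using that sim_trans unfolding near_def by blast
  \<comment> \<open>Seen on \<open>J\<close> alone, the extensions of \<open>p\<close> and of
    \<open>q\<close> are the same tuples, and the identity matches them.\<close>
  have MJ: "matched (simN R J) (Ext (univ A) J p) (Ext (univ A) J q)"
    unfolding matched_def
  proof (intro exI conjI ballI)
    show "bij_betw (\<lambda>p' i. if i \<in> J then p' i else q i) (Ext (univ A) J p) (Ext (univ A) J q)"
      by (rule bij_betw_byWitness[where f' = "\<lambda>q' i. if i \<in> J then q' i else p i"])
        (auto simp: Ext_def fun_eq_iff)
  next
    fix p' assume "p' \<in> Ext (univ A) J p"
    then have s: "sim R J p' p'" by (intro sim_refl) (auto simp: Ext_def)
    show "sim R J p' (\<lambda>i. if i \<in> J then p' i else q i)" using s by (rule sim_cong) auto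
    show "near R J p' (\<lambda>i. if i \<in> J then p' i else q i)" by (auto simp: near_def)
  qed
  \<comment> \<open>Equivalence on \<open>J\<close> alone suffices for the far extensions;
    \<open>K\<close> re-enters below because far elements do not interact with it.\<close>
  have "matched (simN R J) (Ext (univ A) J p - Xn) (Ext (univ A) J q - Yn)"
  proof (rule matched_Diff[OF simN_sym simN_trans _ _ MJ])
    show "matched (simN R J) Xn Yn"
      by (rule matched_mono[OF M1]) (auto intro: sim_mono simp: near_def)
  qed (use less.prems(1) finite_univ finite_Ext in \<open>auto simp: Xn_def Yn_def\<close>)
  then have M2: "matched ?E (Ext (univ A) J p - Xn) (Ext (univ A) J q - Yn)"
  proof (rule matched_mono)
    fix p' q' assume p': "p' \<in> Ext (univ A) J p - Xn" and q': "q' \<in> Ext (univ A) J q - Yn"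
      and E: "simN R J p' q'"
    have pK: "p' i = p i" "q' i = q i" if "i \<in> K" for i
      using that p' q' less.prems(2) by (auto simp: Ext_def)
    have imK: "p' ` K = p ` K" "q' ` K = q ` K" using pK by (auto simp: image_def)
    have K: "sim R K p' q'" "near R K p' q'"
    proof -
      have "sim R K p q" by (rule sim_mono[OF less.prems(3)]) auto
      then show "sim R K p' q'" by (rule sim_cong) (use pK in auto)
      show "near R K p' q'" by (rule near_cong[OF less.prems(4)]) (use pK in auto)
    qed
    have far: "p' j \<notin> NP" "q' j \<notin> NQ" if "j \<in> J" for j using p' q' that by (auto simp: Xn_def Yn_def)
    have "sim R (K \<union> J) p' q'"
      by (rule sim_union[OF K(1)]) (use E far in \<open>auto simp: imK NP_def NQ_def m_def\<close>)
    \<comment> \<open>Between \<open>K\<close> and \<open>J\<close> both sides of the equivalence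
      are false, in either order.\<close>
    moreover have "near R (K \<union> J) p' q'"
    proof -
      have fp: "p' j \<notin> gball A m {p' i}" "q' j \<notin> gball A m {q' i}" if "i \<in> K" "j \<in> J" for i j
        using far[OF that(2)] that(1) pK[OF that(1)] gball_mono[of "{p i}" "p ` K" m m A]
          gball_mono[of "{q i}" "q ` K" m m A] unfolding NP_def NQ_def by auto
      have "p' j \<in> univ A" "q' j \<in> univ A" if "j \<in> K \<union> J" for j
        using that p' q' pK f(1,2) by (auto simp: Ext_def)
      then have fp': "p' i \<notin> gball A m {p' j}" "q' i \<notin> gball A m {q' j}" if "i \<in> K" "j \<in> J" for i j
        using fp[OF that] that gball_sym[of _ A m] by auto
      show ?thesis using fp fp' E K(2) unfolding near_def m_def by blast
    qed
    ultimately show "?E p' q'" by simp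
  qed
  have "matched ?E (Xn \<union> (Ext (univ A) J p - Xn)) (Yn \<union> (Ext (univ A) J q - Yn))"
    by (rule matched_Un[OF M1 M2]) auto
  moreover have "Xn \<union> (Ext (univ A) J p - Xn) = Ext (univ A) J p" by (auto simp: Xn_def)
  moreover have "Yn \<union> (Ext (univ A) J q - Yn) = Ext (univ A) J q" by (auto simp: Yn_def)
  ultimately show ?case by simp
qed

text \<open>Writing (2w + 1)^r = R + 1, the radius w(2R + 2) + R that \<open>ext_matched\<close>
  asks for is (2w + 1)(R + 1) - 1. This recursion is the origin of the radius in the
  theorem.\<close>

lemma quant_matched:
  assumes "finite J" "1 \<le> card J" "card J \<le> w" "J \<inter> K = {}"
    and "sim ((2 * w + 1) ^ Suc r - 1) K p q"
  shows "matched (sim ((2 * w + 1) ^ r - 1) (K \<union> J)) (Ext (univ A) J p) (Ext (univ A) J q)"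
proof -
  define R where "R = (2 * w + 1) ^ r - 1"
  have "(2 * w + 1) ^ r = R + 1" by (simp add: R_def)
  then have S: "(2 * w + 1) ^ Suc r - 1 = w * (2 * R + 2) + R" by simp
  have "1 * (2 * R + 2) \<le> w * (2 * R + 2)" using assms by (intro mult_right_mono) auto
  then have "near R K p q" by (intro near_of_sim[OF assms(5)[unfolded S]]) simp
  moreover have "sim (card J * (2 * R + 2) + R) K p q"
    by (rule sim_mono[OF assms(5)[unfolded S]]) (use mult_right_mono[OF assms(3), of "2 * R + 2"] in simp_all)
  ultimately have "matched (simN R (K \<union> J)) (Ext (univ A) J p) (Ext (univ A) J q)"
    by (intro ext_matched assms)
  then show ?thesis unfolding R_def[symmetric] by (rule matched_mono) auto
qed

lemma matched_sat_iff:
  assumes "matched (sim s K') (Ext (univ A) J p) (Ext (univ A) J q)"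
    and "\<And>p' q'. sim s K' p' q' \<Longrightarrow> \<phi> p' \<longleftrightarrow> \<phi> q'"
  shows "card {p' \<in> Ext (univ A) J p. \<phi> p'} = card {q' \<in> Ext (univ A) J q. \<phi> q'}"
    and "(\<exists>p' \<in> Ext (univ A) J p. \<phi> p') \<longleftrightarrow> (\<exists>q' \<in> Ext (univ A) J q. \<phi> q')"
proof -
  have "matched (sim s K') {p' \<in> Ext (univ A) J p. \<phi> p'} {q' \<in> Ext (univ A) J q. \<phi> q'}"
    by (rule matched_filter[OF assms(1)]) (use assms(2) in blast)
  then obtain F where F: "bij_betw F {p' \<in> Ext (univ A) J p. \<phi> p'} {q' \<in> Ext (univ A) J q. \<phi> q'}"
    by (auto simp: matched_def)
  then show "card {p' \<in> Ext (univ A) J p. \<phi> p'} = card {q' \<in> Ext (univ A) J q. \<phi> q'}"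
    by (rule bij_betw_same_card)
  have "F ` {p' \<in> Ext (univ A) J p. \<phi> p'} = {q' \<in> Ext (univ A) J q. \<phi> q'}"
    using F by (rule bij_betw_imp_surj_on)
  from image_is_empty[of F "{p' \<in> Ext (univ A) J p. \<phi> p'}", unfolded this]
  show "(\<exists>p' \<in> Ext (univ A) J p. \<phi> p') \<longleftrightarrow> (\<exists>q' \<in> Ext (univ A) J q. \<phi> q')" by blast
qed

lemma sim_atom:
  assumes "sim s K p q" "x \<in> K" "y \<in> K"
  shows "p x = p y \<longleftrightarrow> q x = q y"
proof -
  obtain f where f: "p ` K \<subseteq> univ A" "piso f (gball A s (p ` K)) (gball A s (q ` K))"
    "\<forall>i \<in> K. f (p i) = q i" using assms by (auto simp: sim_def)
  have "p x \<in> gball A s (p ` K)" "p y \<in> gball A s (p ` K)" using gball_self[OF f(1), of s] assms by auto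
  then have "f (p x) = f (p y) \<longleftrightarrow> p x = p y" using f(2) by (auto simp: piso_def bij_betw_def inj_on_def)
  then show ?thesis using f(3) assms by simp
qed

lemma sim_rel:
  assumes "sim s K p q" "set xs \<subseteq> K"
  shows "map p xs \<in> rel A i \<longleftrightarrow> map q xs \<in> rel A i"
proof -
  obtain f where f: "p ` K \<subseteq> univ A" "piso f (gball A s (p ` K)) (gball A s (q ` K))"
    "\<forall>i \<in> K. f (p i) = q i" using assms by (auto simp: sim_def)
  have "set (map p xs) \<subseteq> gball A s (p ` K)" using gball_self[OF f(1), of s] assms by auto
  then have "map f (map p xs) \<in> rel A i \<longleftrightarrow> map p xs \<in> rel A i" by (rule piso_rel[OF f(2)])
  moreover have "map f (map p xs) = map q xs" using f(3) assms(2) by auto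
  ultimately show ?thesis by (simp only:)
qed

end

section \<open>Locality by induction on formulas\<close>

lemma upd_list_nth:
  assumes "distinct xs" "length as = length xs" "i < length xs"
  shows "upd_list \<beta> xs as (xs ! i) = as ! i"
  using assms by (simp add: upd_list_def map_of_zip_nth)

lemma upd_list_notin: "y \<notin> set xs \<Longrightarrow> upd_list \<beta> xs as y = \<beta> y"
proof -
  assume "y \<notin> set xs"
  then have "map_of (zip xs as) y = None" by (auto simp: map_of_eq_None_iff dest: set_zip_leftD)
  then show ?thesis by (simp add: upd_list_def)
qed

text \<open>Turns the tuples that a counting term counts into the assignments that
  \<open>quant_matched\<close> speaks of.\<close>

lemma upd_list_bij:
  assumes "distinct xs"
  shows "bij_betw (upd_list \<beta> xs) (tuples (length xs) U) (Ext U (set xs) \<beta>)"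
proof (rule bij_betw_byWitness[where f' = "\<lambda>p. map p xs"])
  have *: "map (upd_list \<beta> xs as) xs = as" if "length as = length xs" for as
    by (rule nth_equalityI) (use that assms in \<open>auto simp: upd_list_nth\<close>)
  then show "\<forall>as \<in> tuples (length xs) U. map (upd_list \<beta> xs as) xs = as" by (simp add: tuples_def)
  show "\<forall>p \<in> Ext U (set xs) \<beta>. upd_list \<beta> xs (map p xs) = p"
  proof (intro ballI ext)
    fix p y assume "p \<in> Ext U (set xs) \<beta>"
    then show "upd_list \<beta> xs (map p xs) y = p y"
      using upd_list_nth[OF assms, of "map p xs"] upd_list_notin[of y xs \<beta>]
      by (cases "y \<in> set xs") (auto simp: Ext_def in_set_conv_nth)
  qed
  show "(\<lambda>p. map p xs) ` Ext U (set xs) \<beta> \<subseteq> tuples (length xs) U" by (auto simp: tuples_def Ext_def)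
  show "upd_list \<beta> xs ` tuples (length xs) U \<subseteq> Ext U (set xs) \<beta>"
  proof
    fix p assume "p \<in> upd_list \<beta> xs ` tuples (length xs) U"
    then obtain as where as: "length as = length xs" "set as \<subseteq> U" "p = upd_list \<beta> xs as" by (auto simp: tuples_def)
    have "p y \<in> U" if "y \<in> set xs" for y
    proof -
      obtain i where "i < length xs" "y = xs ! i" using \<open>y \<in> set xs\<close> by (auto simp: in_set_conv_nth)
      then have "p y = as ! i" "as ! i \<in> set as" using upd_list_nth[OF assms as(1)] as by auto
      then show ?thesis using as(2) by auto
    qed
    then show "p \<in> Ext U (set xs) \<beta>" using upd_list_notin[of _ xs \<beta> as] as(3) by (auto simp: Ext_def)
  qed
qed

lemma fun_upd_Ext: "{\<beta>(x := a) | a. a \<in> U} = Ext U {x} \<beta>"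
  by (auto simp: Ext_def fun_eq_iff)

lemma br_foldr: "t \<in> set ts \<Longrightarrow> br_term t \<le> foldr max (map br_term ts) 0"
  by (induction ts) auto

lemma is_structure_finite_structure: "is_structure \<sigma> A \<Longrightarrow> finite_structure A"
  by (unfold_locales) (auto simp: is_structure_def tuples_def split: if_splits)

context finite_structure begin

text \<open>\<open>bw_form\<close> is a case distinction over the whole formula; this consequence of
  it passes to subformulas and subterms by mere inclusion of sets.\<close>

definition small_width :: "nat \<Rightarrow> nat set \<Rightarrow> bool \<Rightarrow> bool" where
  "small_width w W q \<longleftrightarrow> (\<forall>n \<in> W. 1 \<le> n \<and> n \<le> w) \<and> (q \<longrightarrow> 1 \<le> w)"

text \<open>The statement quantifies over everything that a binder changes: rank, variables
  \<open>K\<close>, both assignments and \<open>\<mu>\<close>. Since \<open>p\<close> and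
  \<open>q\<close> refer to one structure, number quantifiers have the same range and predicates get
  equal arguments on both sides.\<close>

lemma locality_aux:
  fixes \<phi> :: "'p form" and t :: "'p cterm"
  shows "\<forall>r K p q \<mu>. br_form \<phi> \<le> r \<longrightarrow> small_width w (widths_form \<phi>) (quant_form \<phi>) \<longrightarrow> wf_form P \<sigma> \<phi> \<longrightarrow>
      fv_form \<phi> \<subseteq> K \<longrightarrow> sim ((2 * w + 1) ^ r - 1) K p q \<longrightarrow> sat P A \<phi> p \<mu> = sat P A \<phi> q \<mu>"
    and "\<forall>r K p q \<mu>. br_term t \<le> r \<longrightarrow> small_width w (widths_term t) (quant_term t) \<longrightarrow> wf_term P \<sigma> t \<longrightarrow>
      fv_term t \<subseteq> K \<longrightarrow> sim ((2 * w + 1) ^ r - 1) K p q \<longrightarrow> val P A t p \<mu> = val P A t q \<mu>"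
proof (induction \<phi> and t)
  case (Equal x y)
  show ?case
  proof (intro allI impI)
    fix r K p q \<mu>
    assume "fv_form (Equal x y :: 'p form) \<subseteq> K" "sim ((2 * w + 1) ^ r - 1) K p q"
    then show "sat P A (Equal x y) p \<mu> = sat P A (Equal x y) q \<mu>" using sim_atom by simp
  qed
next
  case (Rel i xs)
  show ?case
  proof (intro allI impI)
    fix r K p q \<mu>
    assume "fv_form (Rel i xs :: 'p form) \<subseteq> K" "sim ((2 * w + 1) ^ r - 1) K p q"
    then show "sat P A (Rel i xs) p \<mu> = sat P A (Rel i xs) q \<mu>" using sim_rel by simp
  qed
next
  case (Conj \<phi> \<psi>)
  show ?case
  proof (intro allI impI)
    fix r K p q \<mu>
    assume a: "br_form (Conj \<phi> \<psi>) \<le> r" "small_width w (widths_form (Conj \<phi> \<psi>)) (quant_form (Conj \<phi> \<psi>))"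
      "wf_form P \<sigma> (Conj \<phi> \<psi>)" "fv_form (Conj \<phi> \<psi>) \<subseteq> K" "sim ((2 * w + 1) ^ r - 1) K p q"
    have "sat P A \<phi> p \<mu> = sat P A \<phi> q \<mu>"
      by (rule Conj(1)[rule_format, OF _ _ _ _ a(5)]) (use a(1-4) in \<open>auto simp: small_width_def\<close>)
    moreover have "sat P A \<psi> p \<mu> = sat P A \<psi> q \<mu>"
      by (rule Conj(2)[rule_format, OF _ _ _ _ a(5)]) (use a(1-4) in \<open>auto simp: small_width_def\<close>)
    ultimately show "sat P A (Conj \<phi> \<psi>) p \<mu> = sat P A (Conj \<phi> \<psi>) q \<mu>" by simp
  qed
next
  case (Disj \<phi> \<psi>)
  show ?case
  proof (intro allI impI)
    fix r K p q \<mu>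
    assume a: "br_form (Disj \<phi> \<psi>) \<le> r" "small_width w (widths_form (Disj \<phi> \<psi>)) (quant_form (Disj \<phi> \<psi>))"
      "wf_form P \<sigma> (Disj \<phi> \<psi>)" "fv_form (Disj \<phi> \<psi>) \<subseteq> K" "sim ((2 * w + 1) ^ r - 1) K p q"
    have "sat P A \<phi> p \<mu> = sat P A \<phi> q \<mu>"
      by (rule Disj(1)[rule_format, OF _ _ _ _ a(5)]) (use a(1-4) in \<open>auto simp: small_width_def\<close>)
    moreover have "sat P A \<psi> p \<mu> = sat P A \<psi> q \<mu>"
      by (rule Disj(2)[rule_format, OF _ _ _ _ a(5)]) (use a(1-4) in \<open>auto simp: small_width_def\<close>)
    ultimately show "sat P A (Disj \<phi> \<psi>) p \<mu> = sat P A (Disj \<phi> \<psi>) q \<mu>" by simp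
  qed
next
  case (Exists x \<phi>)
  show ?case
  proof (intro allI impI)
    fix r K p q \<mu>
    assume a: "br_form (Exists x \<phi>) \<le> r" "small_width w (widths_form (Exists x \<phi>)) (quant_form (Exists x \<phi>))"
      "wf_form P \<sigma> (Exists x \<phi>)" "fv_form (Exists x \<phi>) \<subseteq> K" "sim ((2 * w + 1) ^ r - 1) K p q"
    from a(1) obtain r' where r: "r = Suc r'" "br_form \<phi> \<le> r'" by (cases r) auto
    \<comment> \<open>The bound variable may also occur in \<open>K\<close>; its old value is
      forgotten, so that the new position is disjoint from the fixed ones.\<close>
    have "sim ((2 * w + 1) ^ Suc r' - 1) (K - {x}) p q" by (rule sim_mono[OF a(5)]) (auto simp: r)
    then have "matched (sim ((2 * w + 1) ^ r' - 1) (K - {x} \<union> {x})) (Ext (univ A) {x} p) (Ext (univ A) {x} q)"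
      by (intro quant_matched) (use a(2) in \<open>auto simp: small_width_def\<close>)
    note m = matched_sat_iff(2)[OF this, of "\<lambda>p. sat P A \<phi> p \<mu>"]
    have "sat P A \<phi> p' \<mu> = sat P A \<phi> q' \<mu>" if "sim ((2 * w + 1) ^ r' - 1) (K - {x} \<union> {x}) p' q'" for p' q'
      by (rule Exists[rule_format, OF r(2) _ _ _ that]) (use a(2-4) in \<open>auto simp: small_width_def\<close>)
    with m have "(\<exists>p' \<in> Ext (univ A) {x} p. sat P A \<phi> p' \<mu>) \<longleftrightarrow> (\<exists>p' \<in> Ext (univ A) {x} q. sat P A \<phi> p' \<mu>)"
      by blast
    then show "sat P A (Exists x \<phi>) p \<mu> = sat P A (Exists x \<phi>) q \<mu>"
      unfolding fun_upd_Ext[symmetric] by auto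
  qed
next
  case (Forall x \<phi>)
  show ?case
  proof (intro allI impI)
    fix r K p q \<mu>
    assume a: "br_form (Forall x \<phi>) \<le> r" "small_width w (widths_form (Forall x \<phi>)) (quant_form (Forall x \<phi>))"
      "wf_form P \<sigma> (Forall x \<phi>)" "fv_form (Forall x \<phi>) \<subseteq> K" "sim ((2 * w + 1) ^ r - 1) K p q"
    from a(1) obtain r' where r: "r = Suc r'" "br_form \<phi> \<le> r'" by (cases r) auto
    have "sim ((2 * w + 1) ^ Suc r' - 1) (K - {x}) p q" by (rule sim_mono[OF a(5)]) (auto simp: r)
    then have "matched (sim ((2 * w + 1) ^ r' - 1) (K - {x} \<union> {x})) (Ext (univ A) {x} p) (Ext (univ A) {x} q)"
      by (intro quant_matched) (use a(2) in \<open>auto simp: small_width_def\<close>)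
    \<comment> \<open>Witnesses are what the matching transfers, so a counterexample to the
      universal formula is transferred.\<close>
    note m = matched_sat_iff(2)[OF this, of "\<lambda>p. \<not> sat P A \<phi> p \<mu>"]
    have "sat P A \<phi> p' \<mu> = sat P A \<phi> q' \<mu>" if "sim ((2 * w + 1) ^ r' - 1) (K - {x} \<union> {x}) p' q'" for p' q'
      by (rule Forall[rule_format, OF r(2) _ _ _ that]) (use a(2-4) in \<open>auto simp: small_width_def\<close>)
    with m have "(\<exists>p' \<in> Ext (univ A) {x} p. \<not> sat P A \<phi> p' \<mu>) \<longleftrightarrow> (\<exists>p' \<in> Ext (univ A) {x} q. \<not> sat P A \<phi> p' \<mu>)"
      by blast
    then show "sat P A (Forall x \<phi>) p \<mu> = sat P A (Forall x \<phi>) q \<mu>"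
      unfolding fun_upd_Ext[symmetric] by auto
  qed
next
  case (Pred u ts)
  show ?case
  proof (intro allI impI)
    fix r K p q \<mu>
    assume a: "br_form (Pred u ts) \<le> r" "small_width w (widths_form (Pred u ts)) (quant_form (Pred u ts))"
      "wf_form P \<sigma> (Pred u ts)" "fv_form (Pred u ts) \<subseteq> K" "sim ((2 * w + 1) ^ r - 1) K p q"
    have "val P A t p \<mu> = val P A t q \<mu>" if "t \<in> set ts" for t
    proof -
      have "br_term t \<le> r" using br_foldr[OF that] a(1) by simp
      moreover have "small_width w (widths_term t) (quant_term t)" "wf_term P \<sigma> t" "fv_term t \<subseteq> K"
        using a(2-4) that by (auto simp: small_width_def list_all_iff)
      ultimately show ?thesis using Pred[OF that] a(5) by blast
    qed
    then have "map (\<lambda>t. val P A t p \<mu>) ts = map (\<lambda>t. val P A t q \<mu>) ts" by simp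
    then show "sat P A (Pred u ts) p \<mu> = sat P A (Pred u ts) q \<mu>" by (simp only: sat.simps)
  qed
next
  case (Count xs \<phi>)
  show ?case
  proof (intro allI impI)
    fix r K p q \<mu>
    assume a: "br_term (Count xs \<phi>) \<le> r" "small_width w (widths_term (Count xs \<phi>)) (quant_term (Count xs \<phi>))"
      "wf_term P \<sigma> (Count xs \<phi>)" "fv_term (Count xs \<phi>) \<subseteq> K" "sim ((2 * w + 1) ^ r - 1) K p q"
    from a(1) obtain r' where r: "r = Suc r'" "br_form \<phi> \<le> r'" by (cases r) auto
    have d: "distinct xs" "card (set xs) = length xs" using a(3) by (auto simp: distinct_card)
    have "sim ((2 * w + 1) ^ Suc r' - 1) (K - set xs) p q" by (rule sim_mono[OF a(5)]) (auto simp: r)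
    then have M: "matched (sim ((2 * w + 1) ^ r' - 1) (K - set xs \<union> set xs)) (Ext (univ A) (set xs) p) (Ext (univ A) (set xs) q)"
      by (intro quant_matched) (use a(2,3) d in \<open>auto simp: small_width_def\<close>)
    have "sat P A \<phi> p' \<mu> = sat P A \<phi> q' \<mu>" if "sim ((2 * w + 1) ^ r' - 1) (K - set xs \<union> set xs) p' q'" for p' q'
      by (rule Count[rule_format, OF r(2) _ _ _ that]) (use a(2-4) in \<open>auto simp: small_width_def\<close>)
    \<comment> \<open>For quantifiers alone a back-and-forth argument would do; equality of these
      numbers is the reason for matching by bijections.\<close>
    then have "card {p' \<in> Ext (univ A) (set xs) p. sat P A \<phi> p' \<mu>} = card {p' \<in> Ext (univ A) (set xs) q. sat P A \<phi> p' \<mu>}"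
      by (rule matched_sat_iff(1)[OF M])
    moreover have "card {as \<in> tuples (length xs) (univ A). sat P A \<phi> (upd_list p xs as) \<mu>}
        = card {p' \<in> Ext (univ A) (set xs) p. sat P A \<phi> p' \<mu>}" for p
    proof (rule bij_betw_same_card)
      show "bij_betw (upd_list p xs) {as \<in> tuples (length xs) (univ A). sat P A \<phi> (upd_list p xs as) \<mu>}
        {p' \<in> Ext (univ A) (set xs) p. sat P A \<phi> p' \<mu>}"
        using upd_list_bij[OF d(1), of p "univ A"] by (rule bij_betw_Collect) simp
    qed
    ultimately show "val P A (Count xs \<phi>) p \<mu> = val P A (Count xs \<phi>) q \<mu>" by simp
  qed
next
  case (Plus t u)
  show ?case
  proof (intro allI impI)
    fix r K p q \<mu>
    assume a: "br_term (Plus t u) \<le> r" "small_width w (widths_term (Plus t u)) (quant_term (Plus t u))"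
      "wf_term P \<sigma> (Plus t u)" "fv_term (Plus t u) \<subseteq> K" "sim ((2 * w + 1) ^ r - 1) K p q"
    have "val P A t p \<mu> = val P A t q \<mu>"
      by (rule Plus(1)[rule_format, OF _ _ _ _ a(5)]) (use a(1-4) in \<open>auto simp: small_width_def\<close>)
    moreover have "val P A u p \<mu> = val P A u q \<mu>"
      by (rule Plus(2)[rule_format, OF _ _ _ _ a(5)]) (use a(1-4) in \<open>auto simp: small_width_def\<close>)
    ultimately show "val P A (Plus t u) p \<mu> = val P A (Plus t u) q \<mu>" by simp
  qed
next
  case (Times t u)
  show ?case
  proof (intro allI impI)
    fix r K p q \<mu>
    assume a: "br_term (Times t u) \<le> r" "small_width w (widths_term (Times t u)) (quant_term (Times t u))"
      "wf_term P \<sigma> (Times t u)" "fv_term (Times t u) \<subseteq> K" "sim ((2 * w + 1) ^ r - 1) K p q"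
    have "val P A t p \<mu> = val P A t q \<mu>"
      by (rule Times(1)[rule_format, OF _ _ _ _ a(5)]) (use a(1-4) in \<open>auto simp: small_width_def\<close>)
    moreover have "val P A u p \<mu> = val P A u q \<mu>"
      by (rule Times(2)[rule_format, OF _ _ _ _ a(5)]) (use a(1-4) in \<open>auto simp: small_width_def\<close>)
    ultimately show "val P A (Times t u) p \<mu> = val P A (Times t u) q \<mu>" by simp
  qed
next
  case (Neg \<phi>)
  show ?case
  proof (intro allI impI)
    fix r K p q \<mu>
    assume a: "br_form (Neg \<phi>) \<le> r" "small_width w (widths_form (Neg \<phi>)) (quant_form (Neg \<phi>))"
      "wf_form P \<sigma> (Neg \<phi>)" "fv_form (Neg \<phi>) \<subseteq> K" "sim ((2 * w + 1) ^ r - 1) K p q"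
    have "sat P A \<phi> p \<mu>' = sat P A \<phi> q \<mu>'" for \<mu>'
      by (rule Neg[rule_format, OF _ _ _ _ a(5)]) (use a(1-4) in \<open>auto simp: small_width_def\<close>)
    then show "sat P A (Neg \<phi>) p \<mu> = sat P A (Neg \<phi>) q \<mu>" by simp
  qed
next
  case (ExistsNum \<kappa> \<phi>)
  show ?case
  proof (intro allI impI)
    fix r K p q \<mu>
    assume a: "br_form (ExistsNum \<kappa> \<phi>) \<le> r" "small_width w (widths_form (ExistsNum \<kappa> \<phi>)) (quant_form (ExistsNum \<kappa> \<phi>))"
      "wf_form P \<sigma> (ExistsNum \<kappa> \<phi>)" "fv_form (ExistsNum \<kappa> \<phi>) \<subseteq> K" "sim ((2 * w + 1) ^ r - 1) K p q"
    have "sat P A \<phi> p \<mu>' = sat P A \<phi> q \<mu>'" for \<mu>'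
      by (rule ExistsNum[rule_format, OF _ _ _ _ a(5)]) (use a(1-4) in \<open>auto simp: small_width_def\<close>)
    then show "sat P A (ExistsNum \<kappa> \<phi>) p \<mu> = sat P A (ExistsNum \<kappa> \<phi>) q \<mu>" by simp
  qed
qed simp_all

end

lemma finite_widths:
  fixes \<phi> :: "'p form" and t :: "'p cterm"
  shows "finite (widths_form \<phi>)" and "finite (widths_term t)"
  by (induction \<phi> and t) auto

lemma widths_pos:
  fixes \<phi> :: "'p form" and t :: "'p cterm"
  shows "wf_form P \<sigma> \<phi> \<longrightarrow> 0 \<notin> widths_form \<phi>" and "wf_term P \<sigma> t \<longrightarrow> 0 \<notin> widths_term t"
  by (induction \<phi> and t) (auto simp: list_all_iff)

theorem (in finite_structure) locality:
  assumes "wf_form P \<sigma> \<phi>" "bw_form \<phi> \<le> w" "br_form \<phi> \<le> r" "fv_form \<phi> \<subseteq> K"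
    and "sim ((2 * w + 1) ^ r - 1) K p q"
  shows "sat P A \<phi> p \<mu> \<longleftrightarrow> sat P A \<phi> q \<mu>"
proof -
  have "n \<le> w" if "n \<in> widths_form \<phi>" for n
    using that assms(2) finite_widths(1)[of \<phi>] by (auto simp: bw_form_def split: if_splits)
  moreover have "1 \<le> n" if "n \<in> widths_form \<phi>" for n
    using that widths_pos(1) assms(1) by (metis One_nat_def Suc_leI gr0I)
  \<comment> \<open>With counting terms present \<open>bw_form\<close> takes only their widths into
    account, but a nonempty tuple of bound variables already forces
    \<open>1 \<le> w\<close>.\<close>
  moreover have "1 \<le> w" if "quant_form \<phi>"
  proof (cases "widths_form \<phi> = {}")
    case True then show ?thesis using that assms(2) by (simp add: bw_form_def)
  next
    case False
    then obtain n where "n \<in> widths_form \<phi>" by auto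
    then show ?thesis using calculation order_trans by blast
  qed
  ultimately have "small_width w (widths_form \<phi>) (quant_form \<phi>)" by (auto simp: small_width_def)
  from locality_aux(1)[rule_format, OF assms(3) this assms(1,4,5)] show ?thesis .
qed

section \<open>Sphere formulas\<close>

definition conjs :: "'p form list \<Rightarrow> 'p form" where "conjs \<phi>s = foldr Conj \<phi>s Truth"
definition disjs :: "'p form list \<Rightarrow> 'p form" where "disjs \<phi>s = foldr Disj \<phi>s (Neg Truth)"
definition exs :: "nat list \<Rightarrow> 'p form \<Rightarrow> 'p form" where "exs xs \<phi> = foldr Exists xs \<phi>"

lemma conjs_simps [simp]:
  "sat P B (conjs \<phi>s) \<beta> \<mu> \<longleftrightarrow> (\<forall>\<phi> \<in> set \<phi>s. sat P B \<phi> \<beta> \<mu>)"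
  "is_fo (conjs \<phi>s) \<longleftrightarrow> (\<forall>\<phi> \<in> set \<phi>s. is_fo \<phi>)"
  "wf_form P \<sigma> (conjs \<phi>s) \<longleftrightarrow> (\<forall>\<phi> \<in> set \<phi>s. wf_form P \<sigma> \<phi>)"
  "fv_form (conjs \<phi>s) = (\<Union>\<phi> \<in> set \<phi>s. fv_form \<phi>)"
  by (induction \<phi>s) (auto simp: conjs_def)

lemma disjs_simps [simp]:
  "sat P B (disjs \<phi>s) \<beta> \<mu> \<longleftrightarrow> (\<exists>\<phi> \<in> set \<phi>s. sat P B \<phi> \<beta> \<mu>)"
  "is_fo (disjs \<phi>s) \<longleftrightarrow> (\<forall>\<phi> \<in> set \<phi>s. is_fo \<phi>)"
  "wf_form P \<sigma> (disjs \<phi>s) \<longleftrightarrow> (\<forall>\<phi> \<in> set \<phi>s. wf_form P \<sigma> \<phi>)"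
  "fv_form (disjs \<phi>s) = (\<Union>\<phi> \<in> set \<phi>s. fv_form \<phi>)"
  by (induction \<phi>s) (auto simp: disjs_def)

lemma exs_simps [simp]:
  "is_fo (exs xs \<phi>) \<longleftrightarrow> is_fo \<phi>"
  "wf_form P \<sigma> (exs xs \<phi>) \<longleftrightarrow> wf_form P \<sigma> \<phi>"
  "fv_form (exs xs \<phi>) = fv_form \<phi> - set xs"
  by (induction xs) (auto simp: exs_def)

lemma sat_exs [simp]:
  "sat P B (exs xs \<phi>) \<beta> \<mu> \<longleftrightarrow> (\<exists>p \<in> Ext (univ B) (set xs) \<beta>. sat P B \<phi> p \<mu>)"
proof (induction xs arbitrary: \<beta>)
  case Nil
  have "Ext (univ B) {} \<beta> = {\<beta>}" by (auto simp: Ext_def fun_eq_iff)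
  then show ?case by (simp add: exs_def)
next
  case (Cons x xs)
  have "(\<Union>a \<in> univ B. Ext (univ B) (set xs) (\<beta>(x := a))) = Ext (univ B) (insert x (set xs)) \<beta>"
  proof (intro equalityI subsetI)
    fix p assume "p \<in> (\<Union>a \<in> univ B. Ext (univ B) (set xs) (\<beta>(x := a)))"
    then obtain a where a: "a \<in> univ B" "p \<in> Ext (univ B) (set xs) (\<beta>(x := a))" by blast
    have "p x \<in> univ B" using a by (cases "x \<in> set xs") (auto simp: Ext_def)
    then show "p \<in> Ext (univ B) (insert x (set xs)) \<beta>" using a by (auto simp: Ext_def)
  next
    fix p assume "p \<in> Ext (univ B) (insert x (set xs)) \<beta>"
    then have "p x \<in> univ B" "p \<in> Ext (univ B) (set xs) (\<beta>(x := p x))" by (auto simp: Ext_def)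
    then show "p \<in> (\<Union>a \<in> univ B. Ext (univ B) (set xs) (\<beta>(x := a)))" by blast
  qed
  note U = this
  have "sat P B (exs (x # xs) \<phi>) \<beta> \<mu> \<longleftrightarrow> (\<exists>a \<in> univ B. \<exists>p \<in> Ext (univ B) (set xs) (\<beta>(x := a)). sat P B \<phi> p \<mu>)"
    by (simp only: exs_def foldr.simps o_apply sat.simps Cons[unfolded exs_def])
  also have "\<dots> \<longleftrightarrow> (\<exists>p \<in> (\<Union>a \<in> univ B. Ext (univ B) (set xs) (\<beta>(x := a))). sat P B \<phi> p \<mu>)" by blast
  finally show ?case unfolding U by simp
qed

lemma is_structure_rel:
  assumes "is_structure \<sigma> A" "t \<in> rel A i"
  shows "i < length \<sigma> \<and> length t = \<sigma> ! i \<and> set t \<subseteq> univ A"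
proof -
  have "rel A i \<subseteq> (if i < length \<sigma> then tuples (\<sigma> ! i) (univ A) else {})"
    using assms(1) unfolding is_structure_def by blast
  then show ?thesis using assms(2) by (auto simp: tuples_def split: if_splits)
qed

lemma ball_comprehension:
  "(\<forall>\<phi> \<in> set (concat (map (\<lambda>i. map (F i) (g i)) [0..<a])). Q \<phi>) \<longleftrightarrow> (\<forall>i < a. \<forall>t \<in> set (g i). Q (F i t))"
  "(\<exists>\<phi> \<in> set (concat (map (\<lambda>i. map (F i) (g i)) [0..<a])). Q \<phi>) \<longleftrightarrow> (\<exists>i < a. \<exists>t \<in> set (g i). Q (F i t))"
  by auto

section \<open>First-order definability of distance and of spheres\<close>

definition edge_body :: "nat \<Rightarrow> nat list \<Rightarrow> nat \<Rightarrow> nat \<Rightarrow> 'p form" where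
  "edge_body i xs y z = Conj (Rel i xs) (Conj (disjs (map (\<lambda>x. Equal x y) xs)) (disjs (map (\<lambda>x. Equal x z) xs)))"

lemma sat_edge_body:
  "sat P B (edge_body i xs y z) p \<mu> \<longleftrightarrow> map p xs \<in> rel B i \<and> p y \<in> p ` set xs \<and> p z \<in> p ` set xs"
  by (auto simp: edge_body_def image_iff) metis+

text \<open>The indices from \<open>y + z + 1\<close> on exceed both \<open>y\<close> and
  \<open>z\<close>, so the tuple variables are fresh without any renaming; \<open>pow_form\<close>
  uses the same device.\<close>

definition edge_form :: "signature \<Rightarrow> nat \<Rightarrow> nat \<Rightarrow> 'p form" where
  "edge_form \<sigma> y z = Conj (Neg (Equal y z)) (disjs (map (\<lambda>i.
     exs [y + z + 1..<y + z + 1 + \<sigma> ! i] (edge_body i [y + z + 1..<y + z + 1 + \<sigma> ! i] y z)) [0..<length \<sigma>]))"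

lemma sat_edge_form_iff:
  "sat P B (edge_form \<sigma> y z) \<beta> \<mu> \<longleftrightarrow> \<beta> y \<noteq> \<beta> z \<and> (\<exists>i < length \<sigma>.
     sat P B (exs [y + z + 1..<y + z + 1 + \<sigma> ! i] (edge_body i [y + z + 1..<y + z + 1 + \<sigma> ! i] y z)) \<beta> \<mu>)"
  unfolding edge_form_def by (auto simp del: sat_exs upt_Suc)

fun pow_form :: "signature \<Rightarrow> nat \<Rightarrow> nat \<Rightarrow> nat \<Rightarrow> 'p form" where
  "pow_form \<sigma> 0 y z = Equal y z"
| "pow_form \<sigma> (Suc j) y z =
     Exists (y + z + 1) (Conj (pow_form \<sigma> j y (y + z + 1)) (edge_form \<sigma> (y + z + 1) z))"

lemma edge_form_syntax [simp]:
  "is_fo (edge_form \<sigma> y z :: 'p form)" "wf_form P \<sigma> (edge_form \<sigma> y z :: 'p form)"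
  "fv_form (edge_form \<sigma> y z :: 'p form) \<subseteq> {y, z}"
  by (auto simp: edge_form_def edge_body_def)

lemma pow_form_syntax [simp]:
  "is_fo (pow_form \<sigma> j y z :: 'p form)" "wf_form P \<sigma> (pow_form \<sigma> j y z :: 'p form)"
  "fv_form (pow_form \<sigma> j y z :: 'p form) \<subseteq> {y, z}"
proof (induction j arbitrary: z)
  case (Suc j)
  {
    case 1 then show ?case using Suc by simp
  next
    case 2 then show ?case using Suc by simp
  next
    case 3
    show ?case using Suc(3)[of "y + z + 1"] edge_form_syntax(3)[where 'p = 'p, of \<sigma> "y + z + 1" z]
      unfolding pow_form.simps fv_form.simps by blast
  }
qed simp_all

lemma sat_edge_form:
  assumes B: "is_structure \<sigma> B" and \<beta>: "\<beta> y \<in> univ B" "\<beta> z \<in> univ B"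
  shows "sat P B (edge_form \<sigma> y z) \<beta> \<mu> \<longleftrightarrow> (\<beta> y, \<beta> z) \<in> gaifman B"
proof
  let ?xs = "\<lambda>i. [y + z + 1..<y + z + 1 + \<sigma> ! i]"
  assume "sat P B (edge_form \<sigma> y z) \<beta> \<mu>"
  then have ne: "\<beta> y \<noteq> \<beta> z" and "\<exists>i < length \<sigma>. sat P B (exs (?xs i) (edge_body i (?xs i) y z)) \<beta> \<mu>"
    unfolding sat_edge_form_iff by blast+
  then obtain i p where p: "p \<in> Ext (univ B) (set (?xs i)) \<beta>" "sat P B (edge_body i (?xs i) y z) p \<mu>"
    unfolding sat_exs by blast
  then have r: "map p (?xs i) \<in> rel B i" "p y \<in> set (map p (?xs i))" "p z \<in> set (map p (?xs i))"
    unfolding sat_edge_body set_map by blast+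
  have yz: "p y = \<beta> y" "p z = \<beta> z" using p(1) by (auto simp: Ext_def)
  obtain t where "t \<in> rel B i" "\<beta> y \<in> set t" "\<beta> z \<in> set t" using r unfolding yz by blast
  then show "(\<beta> y, \<beta> z) \<in> gaifman B" using \<beta> ne unfolding gaifman_def by auto
next
  assume "(\<beta> y, \<beta> z) \<in> gaifman B"
  then obtain i t where it: "\<beta> y \<noteq> \<beta> z" "t \<in> rel B i" "\<beta> y \<in> set t" "\<beta> z \<in> set t"
    by (auto simp: gaifman_def)
  have i: "i < length \<sigma>" and t: "length t = \<sigma> ! i" "set t \<subseteq> univ B"
    using is_structure_rel[OF B it(2)] by auto
  let ?f = "y + z + 1"
  let ?p = "\<lambda>v. if v \<in> {?f..<?f + \<sigma> ! i} then t ! (v - ?f) else \<beta> v"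
  have m: "map ?p [?f..<?f + \<sigma> ! i] = t"
    by (rule nth_equalityI) (use t in \<open>simp_all del: upt_Suc\<close>)
  have p: "?p \<in> Ext (univ B) {?f..<?f + \<sigma> ! i} \<beta>"
    unfolding Ext_def using t(1) by (auto intro!: subsetD[OF t(2)])
  have im: "?p ` set [?f..<?f + \<sigma> ! i] = set t" by (simp only: set_map[symmetric] m)
  have yz: "?p y = \<beta> y" "?p z = \<beta> z" by auto
  have "p' \<in> ?p ` set [?f..<?f + \<sigma> ! i]" if "p' \<in> set t" for p' using that im by simp
  then have "sat P B (edge_body i [?f..<?f + \<sigma> ! i] y z) ?p \<mu>"
    unfolding sat_edge_body m yz using it(2-4) by blast
  then have "sat P B (exs [?f..<?f + \<sigma> ! i] (edge_body i [?f..<?f + \<sigma> ! i] y z)) \<beta> \<mu>"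
    unfolding sat_exs set_upt using p by blast
  with it(1) i show "sat P B (edge_form \<sigma> y z) \<beta> \<mu>" unfolding sat_edge_form_iff by blast
qed

lemma sat_pow_form:
  assumes B: "is_structure \<sigma> B" and \<beta>: "\<beta> y \<in> univ B" "\<beta> z \<in> univ B"
  shows "sat P B (pow_form \<sigma> j y z) \<beta> \<mu> \<longleftrightarrow> (\<beta> y, \<beta> z) \<in> gaifman B ^^ j"
  using \<beta>
proof (induction j arbitrary: z \<beta>)
  case (Suc j)
  let ?x = "y + z + 1"
  have "sat P B (pow_form \<sigma> (Suc j) y z) \<beta> \<mu> \<longleftrightarrow> (\<exists>a \<in> univ B. (\<beta> y, a) \<in> gaifman B ^^ j \<and> (a, \<beta> z) \<in> gaifman B)"
    unfolding pow_form.simps sat.simps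
  proof (intro bex_cong refl)
    fix a assume a: "a \<in> univ B"
    show "sat P B (pow_form \<sigma> j y ?x) (\<beta>(?x := a)) \<mu> \<and> sat P B (edge_form \<sigma> ?x z) (\<beta>(?x := a)) \<mu> \<longleftrightarrow>
        (\<beta> y, a) \<in> gaifman B ^^ j \<and> (a, \<beta> z) \<in> gaifman B"
      using a Suc.prems by (subst Suc.IH, simp, simp, subst sat_edge_form[OF B], simp_all)
  qed
  also have "\<dots> \<longleftrightarrow> (\<beta> y, \<beta> z) \<in> gaifman B ^^ Suc j" by (auto simp: gaifman_def)
  finally show ?case .
qed simp

text \<open>The atomic diagram of \<open>\<tau>\<close>, meant for a universe \<open>{..<m}\<close>:
  variable \<open>n + j\<close> stands for element \<open>j\<close>, and the variables below
  \<open>n\<close> are the centres.\<close>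

definition matrix_form :: "signature \<Rightarrow> fin_struct \<times> nat list \<Rightarrow> nat \<Rightarrow> 'p form" where
  "matrix_form \<sigma> \<tau> m = (let n = length (snd \<tau>) in conjs
     ([if i = j then Truth else Neg (Equal (n + i) (n + j)). i \<leftarrow> [0..<m], j \<leftarrow> [0..<m]] @
      [Equal i (n + snd \<tau> ! i). i \<leftarrow> [0..<n]] @
      [if t \<in> rel (fst \<tau>) i then Rel i (map ((+) n) t) else Neg (Rel i (map ((+) n) t)).
        i \<leftarrow> [0..<length \<sigma>], t \<leftarrow> List.n_lists (\<sigma> ! i) [0..<m]]))"

definition cover_form :: "nat \<Rightarrow> nat \<Rightarrow> 'p form" where
  "cover_form n m = disjs [Equal (n + m) (n + i). i \<leftarrow> [0..<m]]"

text \<open>Besides realising the diagram, the witnesses must exhaust the ball: the universal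
  conjunct equates being within distance \<open>R\<close> of a centre with being one of
  them.\<close>

definition sphere_form :: "signature \<Rightarrow> nat \<Rightarrow> fin_struct \<times> nat list \<Rightarrow> nat \<Rightarrow> 'p form" where
  "sphere_form \<sigma> R \<tau> m = (let n = length (snd \<tau>);
       near = disjs [pow_form \<sigma> j i (n + m). i \<leftarrow> [0..<n], j \<leftarrow> [0..<Suc R]]; cov = cover_form n m in
     exs [n..<n + m] (Conj (matrix_form \<sigma> \<tau> m)
       (Forall (n + m) (Conj (Disj (Neg near) cov) (Disj (Neg cov) near)))))"

lemma sat_cover_form: "sat P B (cover_form n m) p \<mu> \<longleftrightarrow> p (n + m) \<in> (\<lambda>j. p (n + j)) ` {..<m}"
  by (auto simp: cover_form_def)

lemma sat_matrix_form:
  "sat P B (matrix_form \<sigma> (A, cs) m) p \<mu> \<longleftrightarrow> inj_on (\<lambda>j. p (length cs + j)) {..<m} \<and>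
     (\<forall>i < length cs. p i = p (length cs + cs ! i)) \<and>
     (\<forall>i < length \<sigma>. \<forall>t \<in> tuples (\<sigma> ! i) {..<m}. t \<in> rel A i \<longleftrightarrow> map (\<lambda>j. p (length cs + j)) t \<in> rel B i)"
proof -
  let ?n = "length cs"
  let ?g = "\<lambda>j. p (?n + j)"
  have 1: "(\<forall>\<phi> \<in> set [if i = j then Truth else Neg (Equal (?n + i) (?n + j)). i \<leftarrow> [0..<m], j \<leftarrow> [0..<m]]. sat P B \<phi> p \<mu>) \<longleftrightarrow>
      inj_on ?g {..<m}"
    unfolding ball_comprehension by (simp add: inj_on_def Ball_def; blast)
  have 2: "(\<forall>\<phi> \<in> set [Equal i (?n + cs ! i). i \<leftarrow> [0..<?n]]. sat P B \<phi> p \<mu>) \<longleftrightarrow> (\<forall>i < ?n. p i = p (?n + cs ! i))"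
    by auto
  have "sat P B (if t \<in> rel A i then Rel i (map ((+) ?n) t) else Neg (Rel i (map ((+) ?n) t))) p \<mu> \<longleftrightarrow>
      (t \<in> rel A i \<longleftrightarrow> map ?g t \<in> rel B i)" for i t
    by (auto simp: comp_def)
  moreover have "set (List.n_lists k [0..<m]) = tuples k {..<m}" for k
    by (auto simp: set_n_lists tuples_def)
  ultimately show ?thesis
    unfolding matrix_form_def Let_def conjs_simps fst_conv snd_conv set_append ball_Un 1 2
    unfolding ball_comprehension by simp
qed

lemma iso_centred_sym:
  assumes "iso_centred (A, as) (B, bs)" "set as \<subseteq> univ A"
  shows "iso_centred (B, bs) (A, as)"
proof -
  obtain f where f: "bij_betw f (univ A) (univ B)" "map f as = bs"
    "\<forall>i. \<forall>t \<in> lists (univ A). t \<in> rel A i \<longleftrightarrow> map f t \<in> rel B i"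
    using assms(1) unfolding iso_centred_def prod.case by blast
  let ?g = "inv_into (univ A) f"
  have "t \<in> rel B i \<longleftrightarrow> map ?g t \<in> rel A i" if "t \<in> lists (univ B)" for t i
  proof -
    have "map ?g t \<in> lists (univ A)"
      using that f(1) inv_into_into[of _ f "univ A"] by (auto simp: bij_betw_def)
    moreover have "map f (map ?g t) = t"
      using that f(1) by (auto simp: bij_betw_def f_inv_into_f intro!: map_idI)
    ultimately show ?thesis using f(3)[rule_format, of "map ?g t" i] by (simp only:)
  qed
  moreover have "map ?g bs = as"
    using assms(2) f(1) unfolding f(2)[symmetric] map_map by (intro map_idI) (auto simp: bij_betw_def)
  ultimately show ?thesis using bij_betw_inv_into[OF f(1)] by (auto simp: iso_centred_def)
qed

text \<open>The set \<open>U\<close> of admissible witnesses is left open on purpose: the semantics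
  of \<open>sphere_form\<close> takes the whole universe, the evaluating program only the ball
  \<open>N\<close>.\<close>

lemma iso_centred_matrix:
  assumes B: "is_structure \<sigma> B" and A: "is_structure \<sigma> A" "univ A = {..<m}" "set cs \<subseteq> {..<m}"
    and n: "length cs = n" and \<beta>: "\<beta> ` {..<n} \<subseteq> univ B" and N: "N = nbhd R B (map \<beta> [0..<n])"
    and U: "N \<subseteq> U" "U \<subseteq> univ B"
  shows "iso_centred (nbhd_struct R B (map \<beta> [0..<n])) (A, cs) \<longleftrightarrow>
    (\<exists>p \<in> Ext U {n..<n + m} \<beta>. sat P B (matrix_form \<sigma> (A, cs) m) p \<mu> \<and> (\<lambda>j. p (n + j)) ` {..<m} = N)"
proof
  have centres: "set (map \<beta> [0..<n]) \<subseteq> N" unfolding N nbhd_eq_gball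
    by (rule gball_self) (use \<beta> in auto)
  {
    assume "iso_centred (nbhd_struct R B (map \<beta> [0..<n])) (A, cs)"
    \<comment> \<open>Reversed, so that the isomorphism itself provides a witness for each element
      of the type.\<close>
    then have "iso_centred (A, cs) (nbhd_struct R B (map \<beta> [0..<n]))"
      unfolding nbhd_struct_def by (rule iso_centred_sym) (use centres N in \<open>auto simp: induced_def\<close>)
    then obtain g where g: "bij_betw g {..<m} N" "map g cs = map \<beta> [0..<n]"
      "\<forall>i. \<forall>t \<in> lists {..<m}. t \<in> rel A i \<longleftrightarrow> map g t \<in> rel B i \<inter> lists N"
      unfolding iso_centred_def nbhd_struct_def induced_def prod.case N[symmetric] A(2) fin_struct.simps by blast
    define p where "p v = (if v \<in> {n..<n + m} then g (v - n) else \<beta> v)" for v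
    have pg: "p (n + j) = g j" if "j < m" for j using that by (simp add: p_def)
    have gN: "g j \<in> N" if "j < m" for j using g(1) that by (auto simp: bij_betw_def)
    have "p \<in> Ext U {n..<n + m} \<beta>" using gN by (auto simp: Ext_def p_def intro!: subsetD[OF U(1)])
    moreover have "(\<lambda>j. p (n + j)) ` {..<m} = N"
      using g(1) pg by (auto simp: bij_betw_def image_def)
    moreover have "sat P B (matrix_form \<sigma> (A, cs) m) p \<mu>"
      unfolding sat_matrix_form n
    proof (intro conjI allI impI ballI)
      show "inj_on (\<lambda>j. p (n + j)) {..<m}" using g(1) pg by (auto simp: bij_betw_def inj_on_def)
      fix i assume i: "i < n"
      have "g (cs ! i) = \<beta> i" using arg_cong[OF g(2), of "\<lambda>xs. xs ! i"] i n by simp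
      moreover have "cs ! i \<in> {..<m}" by (rule subsetD[OF A(3)]) (use i n in simp)
      ultimately show "p i = p (n + cs ! i)" using i pg by (simp add: p_def)
    next
      fix i t assume t: "t \<in> tuples (\<sigma> ! i) {..<m}"
      have e: "map (\<lambda>j. p (n + j)) t = map g t" using t pg by (auto simp: tuples_def)
      moreover have "map g t \<in> lists N" using t gN by (auto simp: tuples_def subset_iff)
      ultimately show "t \<in> rel A i \<longleftrightarrow> map (\<lambda>j. p (n + j)) t \<in> rel B i"
        using g(3)[rule_format, of t i] t unfolding e by (simp add: tuples_def subset_iff in_lists_conv_set)
    qed
    ultimately show "\<exists>p \<in> Ext U {n..<n + m} \<beta>. sat P B (matrix_form \<sigma> (A, cs) m) p \<mu> \<and> (\<lambda>j. p (n + j)) ` {..<m} = N"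
      by blast
  next
    assume "\<exists>p \<in> Ext U {n..<n + m} \<beta>. sat P B (matrix_form \<sigma> (A, cs) m) p \<mu> \<and> (\<lambda>j. p (n + j)) ` {..<m} = N"
    then obtain p where p: "p \<in> Ext U {n..<n + m} \<beta>" "(\<lambda>j. p (n + j)) ` {..<m} = N"
      "inj_on (\<lambda>j. p (n + j)) {..<m}" "\<And>i. i < n \<Longrightarrow> p i = p (n + cs ! i)"
      "\<And>i t. i < length \<sigma> \<Longrightarrow> t \<in> tuples (\<sigma> ! i) {..<m} \<Longrightarrow> t \<in> rel A i \<longleftrightarrow> map (\<lambda>j. p (n + j)) t \<in> rel B i"
      unfolding sat_matrix_form n by auto
    let ?g = "\<lambda>j. p (n + j)"
    have "iso_centred (A, cs) (nbhd_struct R B (map \<beta> [0..<n]))"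
      unfolding iso_centred_def nbhd_struct_def induced_def prod.case
    proof (intro exI[of _ ?g] conjI allI ballI)
      show "bij_betw ?g (univ A) (univ \<lparr>univ = nbhd R B (map \<beta> [0..<n]), rel = \<lambda>i. rel B i \<inter> lists (nbhd R B (map \<beta> [0..<n]))\<rparr>)"
        using p(2,3) A(2) N by (simp add: bij_betw_def)
      have "p i = \<beta> i" if "i < n" for i using p(1) that by (auto simp: Ext_def)
      then show "map ?g cs = map \<beta> [0..<n]"
        using p(4) n by (intro nth_equalityI) auto
      fix i t assume "t \<in> lists (univ A)"
      then have t: "set t \<subseteq> {..<m}" using A(2) by auto
      then have l: "map ?g t \<in> lists N" using p(2) by (auto simp: subset_iff)
      show "t \<in> rel A i \<longleftrightarrow> map ?g t \<in> rel \<lparr>univ = nbhd R B (map \<beta> [0..<n]), rel = \<lambda>i. rel B i \<inter> lists (nbhd R B (map \<beta> [0..<n]))\<rparr> i"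
      proof (cases "i < length \<sigma> \<and> length t = \<sigma> ! i")
        case True
        then show ?thesis using p(5)[of i t] t l N by (simp add: tuples_def)
      next
        \<comment> \<open>The diagram is silent outside the signature and for wrong lengths, but no
          tuple belongs to either relation there.\<close>
        case False
        then have "t \<notin> rel A i" "map ?g t \<notin> rel B i"
          using is_structure_rel[OF A(1), of t i] is_structure_rel[OF B, of "map ?g t" i] by auto
        then show ?thesis by simp
      qed
    qed
    then show "iso_centred (nbhd_struct R B (map \<beta> [0..<n])) (A, cs)"
      unfolding nbhd_struct_def by (rule iso_centred_sym) (use A in simp)
  }
qed

section \<open>Finitely many types in bounded degree\<close>

text \<open>Types on initial segments of the naturals, of bounded size: enough representatives up to
  isomorphism, yet finitely many. Elements that are numbers also let \<open>matrix_form\<close> use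
  them as variable indices.\<close>

definition normal_types :: "signature \<Rightarrow> nat \<Rightarrow> nat \<Rightarrow> nat \<Rightarrow> (fin_struct \<times> nat list) set" where
  "normal_types \<sigma> R n M = {\<tau>. is_type \<sigma> R \<tau> \<and> length (snd \<tau>) = n \<and> (\<exists>m \<le> M. univ (fst \<tau>) = {..<m})}"

lemma is_typeD:
  assumes "is_type \<sigma> R (A, cs)"
  shows "is_structure \<sigma> A" "set cs \<subseteq> univ A" "univ A = nbhd R A cs"
  using assms unfolding is_type_def prod.case by blast+

lemma matrix_form_fv:
  assumes "is_type \<sigma> R (A, cs)" "length cs = n" "univ A = {..<m}"
  shows "fv_form (matrix_form \<sigma> (A, cs) m :: 'p form) \<subseteq> {..<n + m}"
proof -
  have cs: "cs ! i < m" if "i < n" for i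
  proof -
    have "cs ! i \<in> univ A" by (rule subsetD[OF is_typeD(2)[OF assms(1)]]) (use assms(2) that in simp)
    then show ?thesis using assms(3) by simp
  qed
  show ?thesis
    unfolding matrix_form_def Let_def conjs_simps snd_conv fst_conv assms(2) set_append UN_Un
  proof (intro Un_least UN_least)
    fix \<phi> :: "'p form" assume "\<phi> \<in> set [if i = j then Truth else Neg (Equal (n + i) (n + j)). i \<leftarrow> [0..<m], j \<leftarrow> [0..<m]]"
    then show "fv_form \<phi> \<subseteq> {..<n + m}" by (auto split: if_splits)
  next
    fix \<phi> :: "'p form" assume "\<phi> \<in> set [Equal i (n + cs ! i). i \<leftarrow> [0..<n]]"
    then show "fv_form \<phi> \<subseteq> {..<n + m}" using cs by auto
  next
    fix \<phi> :: "'p form" assume "\<phi> \<in> set [if t \<in> rel A i then Rel i (map ((+) n) t) else Neg (Rel i (map ((+) n) t)).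
        i \<leftarrow> [0..<length \<sigma>], t \<leftarrow> List.n_lists (\<sigma> ! i) [0..<m]]"
    then obtain i t where "set t \<subseteq> {..<m}" "\<phi> = Rel i (map ((+) n) t) \<or> \<phi> = Neg (Rel i (map ((+) n) t))"
      by (auto simp: set_n_lists atLeast0LessThan split: if_splits)
    then show "fv_form \<phi> \<subseteq> {..<n + m}" by (auto simp: subset_iff)
  qed
qed

lemma sphere_form_syntax:
  assumes "is_type \<sigma> R (A, cs)" "length cs = n" "univ A = {..<m}"
  shows "is_fo (sphere_form \<sigma> R (A, cs) m :: 'p form)" "wf_form P \<sigma> (sphere_form \<sigma> R (A, cs) m :: 'p form)"
    "fv_form (sphere_form \<sigma> R (A, cs) m :: 'p form) \<subseteq> {..<n}"
proof -
  have m: "is_fo (matrix_form \<sigma> (A, cs) m :: 'p form)" "wf_form P \<sigma> (matrix_form \<sigma> (A, cs) m :: 'p form)"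
    unfolding matrix_form_def Let_def conjs_simps fst_conv snd_conv set_append ball_Un ball_comprehension
    by (auto simp: set_n_lists split: if_splits)
  note m3 = matrix_form_fv[OF assms]
  have b: "is_fo (disjs [pow_form \<sigma> j i (n + m). i \<leftarrow> [0..<n], j \<leftarrow> [0..<Suc R]] :: 'p form)"
    "wf_form P \<sigma> (disjs [pow_form \<sigma> j i (n + m). i \<leftarrow> [0..<n], j \<leftarrow> [0..<Suc R]] :: 'p form)"
    by (simp_all del: upt_Suc)
  have b3: "fv_form (disjs [pow_form \<sigma> j i (n + m). i \<leftarrow> [0..<n], j \<leftarrow> [0..<Suc R]] :: 'p form) \<subseteq> {..<n} \<union> {n + m}"
    by (auto simp del: upt_Suc dest!: subsetD[OF pow_form_syntax(3)])
  have c: "is_fo (cover_form n m :: 'p form)" "wf_form P \<sigma> (cover_form n m :: 'p form)"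
    "fv_form (cover_form n m :: 'p form) \<subseteq> {..n + m}"
    by (auto simp: cover_form_def)
  show "is_fo (sphere_form \<sigma> R (A, cs) m :: 'p form)" "wf_form P \<sigma> (sphere_form \<sigma> R (A, cs) m :: 'p form)"
    using m b c assms(2) unfolding sphere_form_def Let_def snd_conv exs_simps is_fo.simps wf_form.simps by simp_all
  show "fv_form (sphere_form \<sigma> R (A, cs) m :: 'p form) \<subseteq> {..<n}"
  proof
    fix v assume "v \<in> fv_form (sphere_form \<sigma> R (A, cs) m :: 'p form)"
    then have "v \<notin> {n..<n + m}" "v \<in> fv_form (matrix_form \<sigma> (A, cs) m :: 'p form) \<or>
      v \<noteq> n + m \<and> (v \<in> fv_form (disjs [pow_form \<sigma> j i (n + m). i \<leftarrow> [0..<n], j \<leftarrow> [0..<Suc R]] :: 'p form) \<or>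
      v \<in> fv_form (cover_form n m :: 'p form))"
      unfolding sphere_form_def Let_def snd_conv exs_simps fv_form.simps set_upt assms(2) by blast+
    moreover have "v < n + m" if "v \<in> fv_form (matrix_form \<sigma> (A, cs) m :: 'p form)" using that m3 by auto
    moreover have "v < n \<or> v = n + m" if "v \<in> fv_form (disjs [pow_form \<sigma> j i (n + m). i \<leftarrow> [0..<n], j \<leftarrow> [0..<Suc R]] :: 'p form)"
      using that b3 by blast
    moreover have "v \<le> n + m" if "v \<in> fv_form (cover_form n m :: 'p form)" using that c(3) by auto
    ultimately show "v \<in> {..<n}" by fastforce
  qed
qed

lemma sat_sphere_form:
  assumes \<tau>: "is_type \<sigma> R (A, cs)" "length cs = n" "univ A = {..<m}"
    and B: "is_structure \<sigma> B" "\<beta> ` {..<n} \<subseteq> univ B"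
  shows "sat P B (sphere_form \<sigma> R (A, cs) m) \<beta> \<mu> \<longleftrightarrow> iso_centred (nbhd_struct R B (map \<beta> [0..<n])) (A, cs)"
proof -
  define N where "N = nbhd R B (map \<beta> [0..<n])"
  have NU: "N \<subseteq> univ B" by (auto simp: N_def nbhd_def)
  have ball: "sat P B (disjs [pow_form \<sigma> j i (n + m). i \<leftarrow> [0..<n], j \<leftarrow> [0..<Suc R]]) (p(n + m := y)) \<mu> \<longleftrightarrow> y \<in> N"
    if p: "p \<in> Ext (univ B) {n..<n + m} \<beta>" and y: "y \<in> univ B" for p y
  proof -
    have pb: "(p(n + m := y)) i = \<beta> i" "(p(n + m := y)) i \<in> univ B" if "i < n" for i
      using p that B(2) by (auto simp: Ext_def)
    have "sat P B (pow_form \<sigma> j i (n + m)) (p(n + m := y)) \<mu> \<longleftrightarrow> (\<beta> i, y) \<in> gaifman B ^^ j" if "i < n" for i j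
      using sat_pow_form[OF B(1), of "p(n + m := y)" i "n + m" P j \<mu>] pb[OF that] y by simp
    moreover have "sat P B (disjs [pow_form \<sigma> j i (n + m). i \<leftarrow> [0..<n], j \<leftarrow> [0..<Suc R]]) q \<mu> \<longleftrightarrow>
        (\<exists>i < n. \<exists>j \<le> R. sat P B (pow_form \<sigma> j i (n + m)) q \<mu>)" for q
      unfolding disjs_simps ball_comprehension by (simp add: less_Suc_eq_le Bex_def del: upt_Suc)
    moreover have "y \<in> N \<longleftrightarrow> (\<exists>i < n. \<exists>j \<le> R. (\<beta> i, y) \<in> gaifman B ^^ j)"
      using y by (auto simp: N_def nbhd_def)
    ultimately show ?thesis by blast
  qed
  have cov: "(\<forall>y \<in> univ B. y \<in> N \<longleftrightarrow> sat P B (cover_form n m) (p(n + m := y)) \<mu>) \<longleftrightarrow> (\<lambda>j. p (n + j)) ` {..<m} = N"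
    if p: "p \<in> Ext (univ B) {n..<n + m} \<beta>" for p
  proof -
    have "(\<lambda>j. (p(n + m := y)) (n + j)) ` {..<m} = (\<lambda>j. p (n + j)) ` {..<m}" for y
      by (rule image_cong) auto
    moreover have "(\<lambda>j. p (n + j)) ` {..<m} \<subseteq> univ B" using p by (auto simp: Ext_def)
    ultimately show ?thesis using NU unfolding sat_cover_form by auto
  qed
  have "sat P B (sphere_form \<sigma> R (A, cs) m) \<beta> \<mu> \<longleftrightarrow> (\<exists>p \<in> Ext (univ B) {n..<n + m} \<beta>.
      sat P B (matrix_form \<sigma> (A, cs) m) p \<mu> \<and> (\<forall>y \<in> univ B. y \<in> N \<longleftrightarrow> sat P B (cover_form n m) (p(n + m := y)) \<mu>))"
    unfolding sphere_form_def Let_def snd_conv \<tau>(2) sat_exs set_upt sat.simps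
    using ball by (intro bex_cong[OF refl]) blast
  also have "\<dots> \<longleftrightarrow> (\<exists>p \<in> Ext (univ B) {n..<n + m} \<beta>. sat P B (matrix_form \<sigma> (A, cs) m) p \<mu> \<and> (\<lambda>j. p (n + j)) ` {..<m} = N)"
    using cov by blast
  also have "\<dots> \<longleftrightarrow> iso_centred (nbhd_struct R B (map \<beta> [0..<n])) (A, cs)"
    by (rule iso_centred_matrix[OF B(1) is_typeD(1)[OF \<tau>(1)] \<tau>(3) _ \<tau>(2) B(2) N_def NU order_refl, symmetric])
      (use is_typeD(2)[OF \<tau>(1)] \<tau>(3) in simp)
  finally show ?thesis .
qed

lemma sphere_form_is_sphere_formula:
  assumes "is_type \<sigma> R (A, cs)" "length cs = n" "univ A = {..<m}"
  shows "is_sphere_formula P \<sigma> R [0..<n] (sphere_form \<sigma> R (A, cs) m)"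
proof -
  have "sat P B (sphere_form \<sigma> R (A, cs) m) \<beta> \<mu> \<longleftrightarrow> iso_centred (nbhd_struct R B (map \<beta> [0..<n])) (A, cs)"
    if "is_structure \<sigma> B" "\<beta> ` set [0..<n] \<subseteq> univ B" for B \<beta> \<mu>
    by (rule sat_sphere_form[OF assms that(1)]) (use that(2) in \<open>simp add: atLeast0LessThan\<close>)
  then show ?thesis unfolding is_sphere_formula_def
    using sphere_form_syntax[OF assms] assms by (intro conjI exI[of _ "(A, cs)"]) (simp_all add: atLeast0LessThan)
qed

lemma finite_tuples: "finite X \<Longrightarrow> finite (tuples k X)"
  using finite_lists_length_eq[of X k] by (simp add: tuples_def conj_commute)

lemma finite_normal_types: "finite (normal_types \<sigma> R n M)"
proof -
  let ?F = "\<lambda>\<tau>. (univ (fst \<tau>), restrict (rel (fst \<tau>)) {..<length \<sigma>}, snd \<tau>)"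
  let ?S = "Pow {..<M} \<times> (PiE {..<length \<sigma>} (\<lambda>i. Pow (tuples (\<sigma> ! i) {..<M}))) \<times> tuples n {..<M}"
  have sub: "?F ` normal_types \<sigma> R n M \<subseteq> ?S"
  proof
    fix x assume "x \<in> ?F ` normal_types \<sigma> R n M"
    then obtain A cs m where x: "x = ?F (A, cs)" "is_type \<sigma> R (A, cs)" "length cs = n" "m \<le> M" "univ A = {..<m}"
      by (auto simp: normal_types_def)
    have U: "univ A \<subseteq> {..<M}" "set cs \<subseteq> {..<M}" using x(4,5) is_typeD(2)[OF x(2)] by auto
    moreover have "rel A i \<subseteq> tuples (\<sigma> ! i) {..<M}" if "i < length \<sigma>" for i
    proof -
      have "rel A i \<subseteq> tuples (\<sigma> ! i) (univ A)" using is_structure_rel[OF is_typeD(1)[OF x(2)]] by (auto simp: tuples_def)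
      then show ?thesis using U(1) by (auto simp: tuples_def)
    qed
    ultimately show "x \<in> ?S" using x by (auto simp: tuples_def)
  qed
  \<comment> \<open>Restricting \<open>rel\<close> to the symbols of the signature loses nothing,
    because a structure has empty relations elsewhere.\<close>
  have "inj_on ?F (normal_types \<sigma> R n M)"
  proof (rule inj_onI)
    fix \<tau> \<tau>' assume t: "\<tau> \<in> normal_types \<sigma> R n M" "\<tau>' \<in> normal_types \<sigma> R n M" "?F \<tau> = ?F \<tau>'"
    have "rel (fst \<tau>) i = rel (fst \<tau>') i" for i
    proof (cases "i < length \<sigma>")
      case True
      then show ?thesis using t(3) by (metis (no_types, lifting) lessThan_iff prod.inject restrict_apply)
    next
      case False
      have "rel (fst \<tau>) i = {}" if "\<tau> \<in> normal_types \<sigma> R n M" for \<tau>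
        using that False is_typeD(1)[of \<sigma> R "fst \<tau>" "snd \<tau>"] is_structure_rel[of \<sigma> "fst \<tau>" _ i] by (auto simp: normal_types_def)
      then show ?thesis using t(1,2) by simp
    qed
    then have "rel (fst \<tau>) = rel (fst \<tau>')" by auto
    then show "\<tau> = \<tau>'" using t(3) by (auto intro!: prod_eqI fin_struct.equality)
  qed
  moreover have "finite ?S"
    by (intro finite_cartesian_product finite_PiE finite_tuples) (auto intro: finite_tuples)
  ultimately show ?thesis using finite_imageD[OF finite_subset[OF sub]] by simp
qed

lemma card_gball_le:
  assumes B: "finite (univ B)" and d: "\<And>a. a \<in> univ B \<Longrightarrow> card (neighbours B a) \<le> d" and X: "finite X"
  shows "card (gball B s X) \<le> card X * (1 + d) ^ s"
proof (induction s)
  case 0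
  show ?case using card_mono[OF X, of "X \<inter> univ B"] by (simp add: gball_0)
next
  case (Suc s)
  have fin: "finite (gball B s X)" using finite_subset[OF gball_subset B] .
  have "gball B (Suc s) X = (\<Union>a \<in> gball B s X. insert a (neighbours B a))"
    by (auto simp: gball_Suc neighbours_def)
  then have "card (gball B (Suc s) X) \<le> (\<Sum>a \<in> gball B s X. card (insert a (neighbours B a)))"
    using card_UN_le[OF fin] by simp
  also have "\<dots> \<le> (\<Sum>a \<in> gball B s X. 1 + d)"
  proof (rule sum_mono)
    fix a assume "a \<in> gball B s X"
    then have "card (neighbours B a) \<le> d" using d gball_subset by blast
    then show "card (insert a (neighbours B a)) \<le> 1 + d" using card_insert_le_m1
      by (metis Suc_eq_plus1_left add_diff_cancel_left' le_add1 plus_1_eq_Suc zero_less_Suc)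
  qed
  also have "\<dots> \<le> card X * (1 + d) ^ s * (1 + d)" using mult_right_mono[OF Suc, of "1 + d"] by simp
  finally show ?case by (simp add: mult_ac)
qed

text \<open>The ball is renumbered by \<open>g\<close>. That the copy is again a type needs an
  argument: inside the induced substructure every element must still be within \<open>R\<close>
  steps of a centre.\<close>

lemma normal_type_exists:
  assumes B: "is_structure \<sigma> B" and d: "\<And>a. a \<in> univ B \<Longrightarrow> card (neighbours B a) \<le> d"
    and as: "as \<in> tuples n (univ B)"
  shows "\<exists>\<tau> \<in> normal_types \<sigma> R n (n * (1 + d) ^ R). iso_centred (nbhd_struct R B as) \<tau>"
proof -
  interpret finite_structure B using B by (rule is_structure_finite_structure)
  define N where "N = nbhd R B as"
  have N: "N = gball B R (set as)" by (simp add: N_def nbhd_eq_gball)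
  have asU: "set as \<subseteq> univ B" "length as = n" using as by (auto simp: tuples_def)
  have asN: "set as \<subseteq> N" unfolding N by (rule gball_self[OF asU(1)])
  have finN: "finite N" unfolding N using finite_subset[OF gball_subset finite_univ] .
  define m where "m = card N"
  obtain g where g: "bij_betw g N {..<m}"
    using ex_bij_betw_finite_nat[OF finN] by (auto simp: m_def atLeast0LessThan)
  have injg: "inj_on g N" and gm: "\<And>x. x \<in> N \<Longrightarrow> g x < m" using g by (auto simp: bij_betw_def)
  define A where "A = \<lparr>univ = {..<m}, rel = (\<lambda>i. map g ` (rel B i \<inter> lists N))\<rparr>"
  define cs where "cs = map g as"
  have relA: "t \<in> rel B i \<longleftrightarrow> map g t \<in> rel A i" if "t \<in> lists N" for t i
  proof
    assume "t \<in> rel B i" then show "map g t \<in> rel A i" using that by (auto simp: A_def)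
  next
    assume "map g t \<in> rel A i"
    then obtain t' where t': "t' \<in> rel B i" "t' \<in> lists N" "map g t = map g t'" by (auto simp: A_def)
    have "t = t'" using t'(3) that t'(2) injg by (subst inj_on_map_eq_map[symmetric, of g]) (auto intro: inj_on_subset)
    then show "t \<in> rel B i" using t' by simp
  qed
  have iso: "iso_centred (nbhd_struct R B as) (A, cs)"
    unfolding iso_centred_def nbhd_struct_def prod.case induced_def N_def[symmetric]
    using g relA by (intro exI[of _ g]) (auto simp: A_def[THEN arg_cong[of _ _ univ]] cs_def)
  have "is_structure \<sigma> A"
    unfolding is_structure_def
  proof (intro conjI allI)
    show "finite (univ A)" by (simp add: A_def)
    fix i show "rel A i \<subseteq> (if i < length \<sigma> then tuples (\<sigma> ! i) (univ A) else {})"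
    proof
      fix t assume "t \<in> rel A i"
      then obtain t' where t': "t = map g t'" "t' \<in> rel B i" "set t' \<subseteq> N" by (auto simp: A_def)
      have "rel B i \<subseteq> (if i < length \<sigma> then tuples (\<sigma> ! i) (univ B) else {})"
        using B by (simp add: is_structure_def)
      then show "t \<in> (if i < length \<sigma> then tuples (\<sigma> ! i) (univ A) else {})"
        using t' gm by (auto simp: tuples_def A_def split: if_splits)
    qed
  qed
  moreover have csA: "set cs \<subseteq> univ A" using asN gm by (auto simp: cs_def A_def)
  moreover have "univ A = nbhd R A cs"
  proof
    show "nbhd R A cs \<subseteq> univ A" by (auto simp: nbhd_def)
    \<comment> \<open>A path of length at most \<open>R\<close> from a centre survives, since the
      tuple that witnesses each edge stays inside the ball.\<close>
    have path: "(g a, g b) \<in> gaifman A ^^ j" if "a \<in> set as" "(a, b) \<in> gaifman B ^^ j" "j \<le> R" for a b j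
      using that(2,3)
    proof (induction j arbitrary: b)
      case (Suc j)
      then obtain c where c: "(a, c) \<in> gaifman B ^^ j" "(c, b) \<in> gaifman B" by auto
      obtain i t where t: "t \<in> rel B i" "c \<in> set t" "b \<in> set t" "c \<noteq> b" using c(2) by (auto simp: gaifman_def)
      have "c \<in> gball B j (set as)" using c that(1) by (auto simp: gball_def gaifman_def)
      from gball_tuple[OF t(1,2) this] have sub: "set t \<subseteq> N"
        unfolding N using gball_mono[of "set as" "set as" "Suc j" R B] Suc.prems(2) by auto
      then have "map g t \<in> rel A i" using relA[of t i] t(1) by auto
      moreover have "g c \<noteq> g b" using t sub injg by (auto simp: inj_on_def)
      moreover have "g c < m" "g b < m" using t sub gm by auto
      ultimately have "(g c, g b) \<in> gaifman A"
        using t(2,3) by (auto simp: gaifman_def A_def[THEN arg_cong[of _ _ univ]] intro!: exI[of _ i] bexI[of _ "map g t"])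
      with Suc.IH[OF c(1)] Suc.prems(2) show ?case by auto
    qed auto
    show "univ A \<subseteq> nbhd R A cs"
    proof
      fix y assume y: "y \<in> univ A"
      then obtain b where b: "b \<in> N" "y = g b" using g by (auto simp: A_def bij_betw_def)
      then obtain a j where "a \<in> set as" "j \<le> R" "(a, b) \<in> gaifman B ^^ j" by (auto simp: N_def nbhd_def)
      then show "y \<in> nbhd R A cs" using path[of a b j] y b(2)
        by (auto simp: nbhd_def cs_def intro!: bexI[of _ a] exI[of _ j])
    qed
  qed
  moreover have "card N \<le> n * (1 + d) ^ R"
  proof -
    have "card N \<le> card (set as) * (1 + d) ^ R" unfolding N by (rule card_gball_le) (use finite_univ d in auto)
    also have "\<dots> \<le> n * (1 + d) ^ R" using card_length[of as] asU by (intro mult_right_mono) auto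
    finally show ?thesis .
  qed
  ultimately have "(A, cs) \<in> normal_types \<sigma> R n (n * (1 + d) ^ R)"
    using asU by (auto simp: normal_types_def is_type_def cs_def A_def[THEN arg_cong[of _ _ univ]] m_def)
  with iso show ?thesis by blast
qed

section \<open>Polynomial-time functions\<close>

type_synonym world = "fin_struct \<times> (nat \<Rightarrow> nat list)"

text \<open>What one entry of a list of element names can cost: a node, the unit of the atom and its
  bit length. Being at least 2, it lets powers absorb constant factors.\<close>

definition bits :: "world \<Rightarrow> nat" where
  "bits W = 2 + floorlog 2 (card (univ (fst W)))"

text \<open>The answer to a query may be longer than the input, so polynomial bounds also refer to
  the length of names.\<close>

definition sz :: "world \<Rightarrow> data \<Rightarrow> nat" where
  "sz W x = bits W + dsize x"

fun dlist :: "data \<Rightarrow> data list" where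
  "dlist (Node x y) = x # dlist y"
| "dlist _ = []"

lemma dsize_left: "dsize (left x) \<le> dsize x" and dsize_right: "dsize (right x) \<le> dsize x"
  by (cases x; simp)+

lemma length_dlist: "length (dlist x) \<le> dsize x"
  by (induction x rule: dlist.induct) auto

lemma dsize_dlist: "e \<in> set (dlist x) \<Longrightarrow> dsize e \<le> dsize x"
  by (induction x rule: dlist.induct) auto

lemma dlist_right: "dlist (right x) = tl (dlist x)"
  by (cases x) auto

lemma bits_ge: "bits W \<ge> 2"
  by (simp add: bits_def)

lemma sz_ge: "sz W x \<ge> 2"
  using bits_ge[of W] by (simp add: sz_def)

lemma exec_Assign: "t = 1 + cost e m \<Longrightarrow> m' = m(x := evl e m) \<Longrightarrow> exec B nb (Assign x e) m t m'"
  using exec.Assign by simp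

locale worlds =
  fixes OK :: "world set" and d :: nat
  assumes nb_length: "(B, nb) \<in> OK \<Longrightarrow> a \<in> univ B \<Longrightarrow> length (nb a) \<le> d"
    and nb_set: "(B, nb) \<in> OK \<Longrightarrow> a \<in> univ B \<Longrightarrow> set (nb a) \<subseteq> {..<card (univ B)}"
begin

text \<open>Polynomially bounded, uniformly in the structure.  As \<open>sz W x \<ge> 2\<close>, no coefficient is needed.\<close>

definition pb :: "(world \<Rightarrow> data \<Rightarrow> nat) \<Rightarrow> bool" where
  "pb g \<longleftrightarrow> (\<exists>c. \<forall>W \<in> OK. \<forall>x. g W x \<le> sz W x ^ c)"

lemma pb_mono: "pb g \<Longrightarrow> (\<And>W x. W \<in> OK \<Longrightarrow> f W x \<le> g W x) \<Longrightarrow> pb f"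
proof -
  assume "pb g" and le: "\<And>W x. W \<in> OK \<Longrightarrow> f W x \<le> g W x"
  then obtain c where "\<forall>W \<in> OK. \<forall>x. g W x \<le> sz W x ^ c" unfolding pb_def by blast
  then have "\<forall>W \<in> OK. \<forall>x. f W x \<le> sz W x ^ c" using le order_trans by blast
  then show ?thesis unfolding pb_def by blast
qed

lemma pb_const: "pb (\<lambda>W x. k)"
  unfolding pb_def
proof (intro exI[of _ k] ballI allI)
  fix W x
  have "k \<le> 2 ^ k" by simp
  also have "\<dots> \<le> sz W x ^ k" by (rule power_mono[OF sz_ge]) simp
  finally show "k \<le> sz W x ^ k" .
qed

lemma pb_add:
  assumes "pb f" "pb g" shows "pb (\<lambda>W x. f W x + g W x)"
proof -
  obtain a where a: "\<And>W x. W \<in> OK \<Longrightarrow> f W x \<le> sz W x ^ a" using assms(1) unfolding pb_def by blast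
  obtain b where b: "\<And>W x. W \<in> OK \<Longrightarrow> g W x \<le> sz W x ^ b" using assms(2) unfolding pb_def by blast
  note ab = a b
  have "f W x + g W x \<le> sz W x ^ Suc (max a b)" if "W \<in> OK" for W x
  proof -
    have "sz W x ^ a \<le> sz W x ^ max a b" "sz W x ^ b \<le> sz W x ^ max a b"
      using sz_ge[of W x] by (auto intro!: power_increasing)
    then have "f W x + g W x \<le> 2 * sz W x ^ max a b" using ab[OF that, of x] by linarith
    also have "\<dots> \<le> sz W x ^ Suc (max a b)" using sz_ge[of W x] by simp
    finally show ?thesis .
  qed
  then show ?thesis unfolding pb_def by blast
qed

lemma pb_mult:
  assumes "pb f" "pb g" shows "pb (\<lambda>W x. f W x * g W x)"
proof -
  obtain a where a: "\<And>W x. W \<in> OK \<Longrightarrow> f W x \<le> sz W x ^ a" using assms(1) unfolding pb_def by blast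
  obtain b where b: "\<And>W x. W \<in> OK \<Longrightarrow> g W x \<le> sz W x ^ b" using assms(2) unfolding pb_def by blast
  note ab = a b
  have "f W x * g W x \<le> sz W x ^ (a + b)" if "W \<in> OK" for W x
    unfolding power_add using ab[OF that, of x] by (intro mult_mono) auto
  then show ?thesis unfolding pb_def by blast
qed

lemma pb_power: "pb f \<Longrightarrow> pb (\<lambda>W x. f W x ^ c)"
proof (induction c)
  case 0
  then show ?case using pb_const[of 1] by simp
next
  case (Suc c)
  then show ?case using pb_mult[of f "\<lambda>W x. f W x ^ c"] by simp
qed

lemma pb_dsize: "pb (\<lambda>W x. dsize x)" and pb_bits: "pb (\<lambda>W x. bits W)"
  unfolding pb_def by (rule exI[of _ 1], simp add: sz_def)+

text \<open>A function bounded by a polynomial need not be monotone, and inside a loop its argument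
  \<open>z\<close> varies. The majorant depends only on a size bound, so it covers all such calls at
  once.\<close>

lemma pb_bound:
  assumes "pb T" "pb Z"
  obtains T' where "pb T'" "\<And>W x z. W \<in> OK \<Longrightarrow> dsize z \<le> Z W x \<Longrightarrow> T W z \<le> T' W x"
proof -
  obtain c where c: "\<And>W x. W \<in> OK \<Longrightarrow> T W x \<le> sz W x ^ c" using assms(1) unfolding pb_def by blast
  show ?thesis
  proof
    show "pb (\<lambda>W x. (bits W + Z W x) ^ c)" by (intro pb_power pb_add pb_bits assms)
    fix W x z assume "W \<in> OK" "dsize z \<le> Z W x"
    then have "T W z \<le> sz W z ^ c" "sz W z ^ c \<le> (bits W + Z W x) ^ c"
      using c by (auto simp: sz_def intro!: power_mono)
    then show "T W z \<le> (bits W + Z W x) ^ c" by linarith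
  qed
qed

lemma pb_comp:
  assumes "pb T" "pb (\<lambda>W x. dsize (f W x))" shows "pb (\<lambda>W x. T W (f W x))"
proof -
  obtain T' where "pb T'" "\<And>W x z. W \<in> OK \<Longrightarrow> dsize z \<le> dsize (f W x) \<Longrightarrow> T W z \<le> T' W x"
    by (rule pb_bound[OF assms], rule that)
  then show ?thesis using pb_mono[of T'] by simp
qed

text \<open>
  The frame condition on the registers from \<open>n\<close> on lets programs be composed with saved values.  The
  bound on the size of the result makes such functions closed under composition.
\<close>

definition computed_by :: "com \<Rightarrow> nat \<Rightarrow> (world \<Rightarrow> data \<Rightarrow> nat) \<Rightarrow> (world \<Rightarrow> data \<Rightarrow> data) \<Rightarrow> bool" where
  "computed_by p n T f \<longleftrightarrow> (\<forall>W \<in> OK. \<forall>m. \<exists>t m'. exec (fst W) (snd W) p m t m' \<and> m' 0 = f W (m 0) \<and>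
     (\<forall>i \<ge> n. m' i = m i) \<and> t \<le> T W (m 0) \<and> dsize (f W (m 0)) \<le> T W (m 0))"

text \<open>One program and one exponent serve all worlds; the function may depend on the world
  through queries.\<close>

definition PF :: "(world \<Rightarrow> data \<Rightarrow> data) \<Rightarrow> bool" where
  "PF f \<longleftrightarrow> (\<exists>p n T. pb T \<and> computed_by p n T f)"

lemma computed_byE:
  assumes "computed_by p n T f" "W \<in> OK" "m 0 = x"
  obtains t m' where "exec (fst W) (snd W) p m t m'" "m' 0 = f W x" "\<forall>i\<ge>n. m' i = m i"
    "t \<le> T W x" "dsize (f W x) \<le> T W x"
proof -
  from assms(1)[unfolded computed_by_def, THEN bspec, OF assms(2), THEN spec, of m]
  obtain t m' where "exec (fst W) (snd W) p m t m'" "m' 0 = f W (m 0)" "\<forall>i\<ge>n. m' i = m i"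
    "t \<le> T W (m 0)" "dsize (f W (m 0)) \<le> T W (m 0)" by (elim exE conjE)
  then show thesis unfolding assms(3) by (rule that)
qed

lemma PF_dsize: "PF f \<Longrightarrow> pb (\<lambda>W x. dsize (f W x))"
proof -
  assume "PF f"
  then obtain p n T where "pb T" "computed_by p n T f" by (auto simp: PF_def)
  moreover have "dsize (f W x) \<le> T W x" if "W \<in> OK" for W x
    by (rule computed_byE[OF \<open>computed_by p n T f\<close> that, of "\<lambda>_. x"]) auto
  ultimately show ?thesis using pb_mono[of T] by simp
qed

lemma PF_comp:
  assumes "PF g" "PF f"
  shows "PF (\<lambda>W x. g W (f W x))"
proof -
  obtain p1 n1 T1 where 1: "pb T1" "computed_by p1 n1 T1 f" using assms by (auto simp: PF_def)
  obtain p2 n2 T2 where 2: "pb T2" "computed_by p2 n2 T2 g" using assms by (auto simp: PF_def)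
  let ?T = "\<lambda>W x. T1 W x + T2 W (f W x)"
  have "computed_by (Seq p1 p2) (max n1 n2) ?T (\<lambda>W x. g W (f W x))"
    unfolding computed_by_def
  proof (intro ballI allI)
    fix W and m :: "nat \<Rightarrow> data" assume W: "W \<in> OK"
    obtain t1 m1 where e1: "exec (fst W) (snd W) p1 m t1 m1" "m1 0 = f W (m 0)" "\<forall>i\<ge>n1. m1 i = m i"
      "t1 \<le> T1 W (m 0)" "dsize (f W (m 0)) \<le> T1 W (m 0)" by (rule computed_byE[OF 1(2) W refl, of m], rule that)
    obtain t2 m2 where e2: "exec (fst W) (snd W) p2 m1 t2 m2" "m2 0 = g W (m1 0)" "\<forall>i\<ge>n2. m2 i = m1 i"
      "t2 \<le> T2 W (m1 0)" "dsize (g W (m1 0)) \<le> T2 W (m1 0)" by (rule computed_byE[OF 2(2) W refl, of m1], rule that)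
    show "\<exists>t m'. exec (fst W) (snd W) (Seq p1 p2) m t m' \<and> m' 0 = g W (f W (m 0)) \<and>
       (\<forall>i\<ge>max n1 n2. m' i = m i) \<and> t \<le> ?T W (m 0) \<and> dsize (g W (f W (m 0))) \<le> ?T W (m 0)"
      by (rule exI, rule exI, rule conjI, rule exec.Seq[OF e1(1) e2(1)]) (use e1 e2 in auto)
  qed
  moreover have "pb ?T" by (intro pb_add 1 pb_comp[OF 2(1)] PF_dsize assms)
  ultimately show ?thesis unfolding PF_def by blast
qed

text \<open>The numbers 10 and 4 are merely generous enough for the one-assignment programs that
  follow.\<close>

lemma PF_exp:
  assumes "\<And>m. evl e m = F (m 0)" "\<And>m. cost e m \<le> 10 + 4 * dsize (m 0)" "\<And>x. dsize (F x) \<le> k + 4 * dsize x"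
  shows "PF (\<lambda>W. F)"
proof -
  let ?T = "\<lambda>(W::world) x. 11 + k + 4 * dsize x"
  have "computed_by (Assign 0 e) 1 ?T (\<lambda>W. F)"
    unfolding computed_by_def
  proof (intro ballI allI)
    fix W and m :: "nat \<Rightarrow> data"
    show "\<exists>t m'. exec (fst W) (snd W) (Assign 0 e) m t m' \<and> m' 0 = F (m 0) \<and>
       (\<forall>i\<ge>1. m' i = m i) \<and> t \<le> ?T W (m 0) \<and> dsize (F (m 0)) \<le> ?T W (m 0)"
      by (rule exI, rule exI, rule conjI, rule exec.Assign)
        (use assms(1) assms(2)[of m] assms(3)[of "m 0"] in auto)
  qed
  moreover have "pb ?T" by (intro pb_add pb_mult pb_const pb_dsize)
  ultimately show ?thesis unfolding PF_def by blast
qed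

lemma PF_id: "PF (\<lambda>W x. x)"
  by (rule PF_exp[of "Var 0" _ 0]) auto

lemma PF_const: "PF (\<lambda>W x. c)"
  by (rule PF_exp[of "Const c" _ "dsize c"]) auto

lemma PF_left': "PF (\<lambda>W x. left x)"
  by (rule PF_exp[of "Left (Var 0)" _ 0]) (auto intro: order_trans[OF dsize_left])

lemma PF_right': "PF (\<lambda>W x. right x)"
  by (rule PF_exp[of "Right (Var 0)" _ 0]) (auto intro: order_trans[OF dsize_right])

lemmas PF_left = PF_comp[OF PF_left'] and PF_right = PF_comp[OF PF_right']

lemma dsize_enc_bool: "dsize (enc_bool b) \<le> 3"
  by (simp add: enc_bool_def)

lemma PF_same': "PF (\<lambda>W x. enc_bool (left x = right x))"
proof (rule PF_exp[of "Same (Left (Var 0)) (Right (Var 0))" _ 3])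
  fix m show "cost (Same (Left (Var 0)) (Right (Var 0))) m \<le> 10 + 4 * dsize (m 0)"
    using dsize_left[of "m 0"] dsize_right[of "m 0"] by simp
qed (use dsize_enc_bool in \<open>auto intro: trans_le_add1\<close>)

lemma PF_pair:
  assumes "PF f" "PF g"
  shows "PF (\<lambda>W x. Node (f W x) (g W x))"
proof -
  obtain p1 n1 T1 where 1: "pb T1" "computed_by p1 n1 T1 f" using assms by (auto simp: PF_def)
  obtain p2 n2 T2 where 2: "pb T2" "computed_by p2 n2 T2 g" using assms by (auto simp: PF_def)
  \<comment> \<open>Registers from \<open>N\<close> on are preserved by both programs, so they can
    hold the saved input and the first result. Adding 1 keeps \<open>N\<close> apart from register
    0, which carries input and output.\<close>
  define N where "N = max n1 n2 + 1"
  let ?p = "Seq (Assign N (Var 0)) (Seq p1 (Seq (Assign (N + 1) (Var 0)) (Seq (Assign 0 (Var N))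
    (Seq p2 (Assign 0 (Pair (Var (N + 1)) (Var 0)))))))"
  let ?T = "\<lambda>W x. 20 + T1 W x + T2 W x"
  have "computed_by ?p (N + 2) ?T (\<lambda>W x. Node (f W x) (g W x))"
    unfolding computed_by_def
  proof (intro ballI allI)
    fix W and m :: "nat \<Rightarrow> data" assume W: "W \<in> OK"
    let ?m = "m(N := m 0)"
    obtain t1 m1 where e1: "exec (fst W) (snd W) p1 ?m t1 m1" "m1 0 = f W (m 0)" "\<forall>i\<ge>n1. m1 i = ?m i"
      "t1 \<le> T1 W (m 0)" "dsize (f W (m 0)) \<le> T1 W (m 0)"
      by (rule computed_byE[OF 1(2) W, of ?m "m 0"], simp add: N_def, rule that)
    let ?m1 = "m1(N + 1 := m1 0)"
    let ?m2 = "?m1(0 := ?m1 N)"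
    have mN: "?m1 N = m 0" using e1(3)[rule_format, of N] by (simp add: N_def)
    obtain t2 m2 where e2: "exec (fst W) (snd W) p2 ?m2 t2 m2" "m2 0 = g W (m 0)" "\<forall>i\<ge>n2. m2 i = ?m2 i"
      "t2 \<le> T2 W (m 0)" "dsize (g W (m 0)) \<le> T2 W (m 0)"
      by (rule computed_byE[OF 2(2) W, of ?m2 "m 0"], use mN in simp, rule that)
    have A: "exec (fst W) (snd W) (Assign N (Var 0)) m 2 ?m"
      "exec (fst W) (snd W) (Assign (N + 1) (Var 0)) m1 2 ?m1"
      "exec (fst W) (snd W) (Assign 0 (Var N)) ?m1 2 ?m2"
      by (rule exec_Assign; simp)+
    have ex: "exec (fst W) (snd W) ?p m (2 + (t1 + (2 + (2 + (t2 + (1 + cost (Pair (Var (N + 1)) (Var 0)) m2))))))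
      (m2(0 := evl (Pair (Var (N + 1)) (Var 0)) m2))"
      using A exec.Assign[of "fst W" "snd W" 0 "Pair (Var (N + 1)) (Var 0)" m2] e1(1) e2(1) by (intro exec.Seq)
    have v: "m2 (N + 1) = f W (m 0)" using e2(3)[rule_format, of "N + 1"] e1(2) by (simp add: N_def)
    have fr: "\<forall>i\<ge>N + 2. (m2(0 := evl (Pair (Var (N + 1)) (Var 0)) m2)) i = m i"
      using e1(3) e2(3) by (auto simp: N_def)
    show "\<exists>t m'. exec (fst W) (snd W) ?p m t m' \<and> m' 0 = Node (f W (m 0)) (g W (m 0)) \<and>
       (\<forall>i\<ge>N + 2. m' i = m i) \<and> t \<le> ?T W (m 0) \<and> dsize (Node (f W (m 0)) (g W (m 0))) \<le> ?T W (m 0)"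
      by (rule exI, rule exI, rule conjI, rule ex) (use e1 e2 v fr in auto)
  qed
  moreover have "pb ?T" by (intro pb_add 1 2 pb_const)
  ultimately show ?thesis unfolding PF_def by blast
qed

lemma PF_same:
  assumes "PF f" "PF g" shows "PF (\<lambda>W x. enc_bool (f W x = g W x))"
  using PF_comp[OF PF_same' PF_pair[OF assms]] by simp

lemma PF_if:
  assumes "PF b" "PF f" "PF g"
  shows "PF (\<lambda>W x. if b W x \<noteq> Empty then f W x else g W x)"
proof -
  obtain p0 n0 T0 where 0: "pb T0" "computed_by p0 n0 T0 b" using assms by (auto simp: PF_def)
  obtain p1 n1 T1 where 1: "pb T1" "computed_by p1 n1 T1 f" using assms by (auto simp: PF_def)
  obtain p2 n2 T2 where 2: "pb T2" "computed_by p2 n2 T2 g" using assms by (auto simp: PF_def)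
  define N where "N = max n0 (max n1 n2) + 1"
  let ?p = "Seq (Assign N (Var 0)) (Seq p0 (Seq (Assign (N + 1) (Var 0)) (Seq (Assign 0 (Var N))
    (If (Var (N + 1)) p1 p2))))"
  let ?T = "\<lambda>W x. 20 + T0 W x + T1 W x + T2 W x"
  let ?f = "\<lambda>W x. if b W x \<noteq> Empty then f W x else g W x"
  have "computed_by ?p (N + 2) ?T ?f"
    unfolding computed_by_def
  proof (intro ballI allI)
    fix W and m :: "nat \<Rightarrow> data" assume W: "W \<in> OK"
    let ?m = "m(N := m 0)"
    obtain t0 m0 where e0: "exec (fst W) (snd W) p0 ?m t0 m0" "m0 0 = b W (m 0)" "\<forall>i\<ge>n0. m0 i = ?m i"
      "t0 \<le> T0 W (m 0)" "dsize (b W (m 0)) \<le> T0 W (m 0)"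
      by (rule computed_byE[OF 0(2) W, of ?m "m 0"], simp add: N_def, rule that)
    let ?m1 = "m0(N + 1 := m0 0)"
    let ?m2 = "?m1(0 := ?m1 N)"
    have mN: "?m1 N = m 0" using e0(3)[rule_format, of N] by (simp add: N_def)
    obtain t1 m1 where e1: "exec (fst W) (snd W) p1 ?m2 t1 m1" "m1 0 = f W (m 0)" "\<forall>i\<ge>n1. m1 i = ?m2 i"
      "t1 \<le> T1 W (m 0)" "dsize (f W (m 0)) \<le> T1 W (m 0)"
      by (rule computed_byE[OF 1(2) W, of ?m2 "m 0"], use mN in simp, rule that)
    obtain t2 m2 where e2: "exec (fst W) (snd W) p2 ?m2 t2 m2" "m2 0 = g W (m 0)" "\<forall>i\<ge>n2. m2 i = ?m2 i"
      "t2 \<le> T2 W (m 0)" "dsize (g W (m 0)) \<le> T2 W (m 0)"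
      by (rule computed_byE[OF 2(2) W, of ?m2 "m 0"], use mN in simp, rule that)
    have test: "evl (Var (N + 1)) ?m2 = b W (m 0)" using e0(2) by simp
    define t3 m3 where "t3 = (if b W (m 0) \<noteq> Empty then t1 else t2)" and "m3 = (if b W (m 0) \<noteq> Empty then m1 else m2)"
    have If: "exec (fst W) (snd W) (If (Var (N + 1)) p1 p2) ?m2 (1 + cost (Var (N + 1)) ?m2 + t3) m3"
      using exec.IfTrue[OF _ e1(1), of "Var (N + 1)" p2] exec.IfFalse[OF _ e2(1), of "Var (N + 1)" p1] test
      unfolding t3_def m3_def by (cases "b W (m 0) = Empty") simp_all
    have A: "exec (fst W) (snd W) (Assign N (Var 0)) m 2 ?m"
      "exec (fst W) (snd W) (Assign (N + 1) (Var 0)) m0 2 ?m1"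
      "exec (fst W) (snd W) (Assign 0 (Var N)) ?m1 2 ?m2"
      by (rule exec_Assign; simp)+
    have ex: "exec (fst W) (snd W) ?p m (2 + (t0 + (2 + (2 + (1 + cost (Var (N + 1)) ?m2 + t3))))) m3"
      using A e0(1) If by (intro exec.Seq)
    have fr: "\<forall>i\<ge>N + 2. m3 i = m i"
      using e0(3) e1(3) e2(3) by (auto simp: N_def m3_def)
    show "\<exists>t m'. exec (fst W) (snd W) ?p m t m' \<and> m' 0 = ?f W (m 0) \<and>
       (\<forall>i\<ge>N + 2. m' i = m i) \<and> t \<le> ?T W (m 0) \<and> dsize (?f W (m 0)) \<le> ?T W (m 0)"
      by (rule exI, rule exI, rule conjI, rule ex) (use e0 e1 e2 fr in \<open>auto simp: t3_def m3_def\<close>)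
  qed
  moreover have "pb ?T" by (intro pb_add 0 1 2 pb_const)
  ultimately show ?thesis unfolding PF_def by blast
qed

lemma PF_rel:
  assumes "PF f" shows "PF (\<lambda>W x. rel_answer (fst W) i (f W x))"
proof (rule PF_comp[OF _ assms])
  let ?T = "\<lambda>(W::world) x. 3 + dsize x"
  have "computed_by (AskRel 0 i (Var 0)) 1 ?T (\<lambda>W. rel_answer (fst W) i)"
    unfolding computed_by_def
  proof (intro ballI allI)
    fix W and m :: "nat \<Rightarrow> data"
    show "\<exists>t m'. exec (fst W) (snd W) (AskRel 0 i (Var 0)) m t m' \<and> m' 0 = rel_answer (fst W) i (m 0) \<and>
       (\<forall>i\<ge>1. m' i = m i) \<and> t \<le> ?T W (m 0) \<and> dsize (rel_answer (fst W) i (m 0)) \<le> ?T W (m 0)"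
      by (rule exI, rule exI, rule conjI, rule exec.AskRel) (auto simp: rel_answer_def intro: order_trans[OF dsize_enc_bool])
  qed
  moreover have "pb ?T" by (intro pb_add pb_const pb_dsize)
  ultimately show "PF (\<lambda>W. rel_answer (fst W) i)" unfolding PF_def by blast
qed

lemma dsize_enc_tuple: "(\<And>a. a \<in> set as \<Longrightarrow> a < n) \<Longrightarrow> dsize (enc_tuple as) \<le> 1 + length as * (2 + floorlog 2 n)"
proof (induction as)
  case (Cons a as)
  have "floorlog 2 a \<le> floorlog 2 n" using Cons.prems[of a] by (intro floorlog_mono) simp
  with Cons show ?case by (auto simp: enc_list_def)
qed (simp add: enc_list_def)

lemma PF_nbs:
  assumes "PF f" shows "PF (\<lambda>W x. nbs_answer (fst W) (snd W) (f W x))"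
proof (rule PF_comp[OF _ assms])
  let ?T = "\<lambda>W x. 2 + dsize x + (1 + d * bits W)"
  have sizes: "dsize (nbs_answer (fst W) (snd W) x) \<le> 1 + d * bits W" if "W \<in> OK" for W x
  proof (cases "\<exists>a. x = Atom a \<and> a \<in> univ (fst W)")
    case True
    then obtain a where a: "x = Atom a" "a \<in> univ (fst W)" by auto
    have "dsize (enc_tuple (snd W a)) \<le> 1 + length (snd W a) * bits W"
      unfolding bits_def by (rule dsize_enc_tuple) (use nb_set[of "fst W" "snd W" a] that a in auto)
    also have "\<dots> \<le> 1 + d * bits W" using nb_length[of "fst W" "snd W" a] that a by simp
    finally show ?thesis using a by (simp add: nbs_answer_def)
  qed (auto simp: nbs_answer_def split: data.split)
  have "computed_by (AskNbs 0 (Var 0)) 1 ?T (\<lambda>W. nbs_answer (fst W) (snd W))"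
    unfolding computed_by_def
  proof (intro ballI allI)
    fix W and m :: "nat \<Rightarrow> data" assume W: "W \<in> OK"
    show "\<exists>t m'. exec (fst W) (snd W) (AskNbs 0 (Var 0)) m t m' \<and> m' 0 = nbs_answer (fst W) (snd W) (m 0) \<and>
       (\<forall>i\<ge>1. m' i = m i) \<and> t \<le> ?T W (m 0) \<and> dsize (nbs_answer (fst W) (snd W) (m 0)) \<le> ?T W (m 0)"
      by (rule exI, rule exI, rule conjI, rule exec.AskNbs) (use sizes[OF W, of "m 0"] in auto)
  qed
  moreover have "pb ?T" by (intro pb_add pb_mult pb_const pb_dsize pb_bits)
  ultimately show "PF (\<lambda>W. nbs_answer (fst W) (snd W))" unfolding PF_def by blast
qed

text \<open>The step function sees the whole input next to the current entry and the accumulator, so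
  a loop body can refer to enclosing data.\<close>

definition fold_data where
  "fold_data s W x acc es = foldl (\<lambda>acc e. s W (Node x (Node e acc))) acc es"

text \<open>A polynomial-time step may square the size of the accumulator in every round, hence the
  separate bound \<open>Q\<close> on all intermediate values. With it, the time is the number of
  entries times a polynomial.\<close>

lemma PF_fold:
  assumes s: "PF s" and a: "PF a" and g: "PF g" and Q: "pb Q"
    and bound: "\<And>W x n. W \<in> OK \<Longrightarrow> dsize (fold_data s W x (a W x) (take n (dlist (g W x)))) \<le> Q W x"
  shows "PF (\<lambda>W x. fold_data s W x (a W x) (dlist (g W x)))"
proof -
  obtain p0 n0 T0 where 0: "pb T0" "computed_by p0 n0 T0 g" using g by (auto simp: PF_def)
  obtain p1 n1 T1 where 1: "pb T1" "computed_by p1 n1 T1 a" using a by (auto simp: PF_def)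
  obtain p2 n2 T2 where 2: "pb T2" "computed_by p2 n2 T2 s" using s by (auto simp: PF_def)
  define N where "N = max n0 (max n1 n2) + 1"
  define Z where "Z = (\<lambda>W x. 2 + dsize x + dsize (g W x) + Q W x)"
  have pbZ: "pb Z" unfolding Z_def by (intro pb_add pb_const pb_dsize PF_dsize g Q)
  obtain T3 where T3: "pb T3" "\<And>W x z. W \<in> OK \<Longrightarrow> dsize z \<le> Z W x \<Longrightarrow> T2 W z \<le> T3 W x"
    using pb_bound[OF 2(1) pbZ] by metis
  \<comment> \<open>The language has no direct test for nodes. Rebuilding a tree from its two halves
    gives it back exactly if it is a node.\<close>
  define test where "test = Same (Pair (Left (Var (N + 1))) (Right (Var (N + 1)))) (Var (N + 1))"
  define body where "body = Seq (Assign 0 (Pair (Var N) (Pair (Left (Var (N + 1))) (Var (N + 2)))))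
    (Seq p2 (Seq (Assign (N + 2) (Var 0)) (Assign (N + 1) (Right (Var (N + 1))))))"
  define K where "K = (\<lambda>W x. 40 + 2 * dsize (g W x) + T3 W x)"
  have test: "evl test m \<noteq> Empty \<longleftrightarrow> dlist (m (N + 1)) \<noteq> []" "cost test m \<le> 10 + 2 * dsize (m (N + 1))" for m
    by (cases "m (N + 1)"; simp add: test_def enc_bool_def)+
  have loop: "\<exists>t m'. exec (fst W) (snd W) (While test body) m t m' \<and> m' (N + 2) = fold_data s W x acc (dlist y) \<and>
      (\<forall>i \<ge> N + 3. m' i = m i) \<and> t \<le> (length (dlist y) + 1) * K W x"
    if "W \<in> OK" "m N = x" "m (N + 1) = y" "m (N + 2) = acc" "dsize y \<le> dsize (g W x)"
      "\<And>n. dsize (fold_data s W x acc (take n (dlist y))) \<le> Q W x" for W x y acc m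
    using that
  proof (induction y arbitrary: acc m rule: dlist.induct)
    case (1 e y)
    let ?m = "m(0 := Node x (Node e acc))"
    have accQ: "dsize acc \<le> Q W x" using "1.prems"(6)[of 0] by (simp add: fold_data_def)
    have sizes: "T2 W (Node x (Node e acc)) \<le> T3 W x"
      by (rule T3(2)) (use "1.prems" accQ in \<open>auto simp: Z_def\<close>)
    obtain t1 m1 where e1: "exec (fst W) (snd W) p2 ?m t1 m1" "m1 0 = s W (Node x (Node e acc))"
      "\<forall>i\<ge>n2. m1 i = ?m i" "t1 \<le> T2 W (Node x (Node e acc))"
      "dsize (s W (Node x (Node e acc))) \<le> T2 W (Node x (Node e acc))"
      by (rule computed_byE[OF 2(2) "1.prems"(1), of ?m "Node x (Node e acc)"], simp, rule that)
    let ?m1 = "m1(N + 2 := m1 0)"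
    let ?m2 = "?m1(N + 1 := y)"
    have m1: "m1 N = x" "m1 (N + 1) = Node e y" "\<And>i. i \<ge> N \<Longrightarrow> m1 i = m i"
      using e1(3) "1.prems" by (auto simp: N_def)
    have bd: "exec (fst W) (snd W) body m (7 + (t1 + (2 + 3))) ?m2"
      unfolding body_def
    proof (intro exec.Seq)
      show "exec (fst W) (snd W) (Assign 0 (Pair (Var N) (Pair (Left (Var (N + 1))) (Var (N + 2))))) m 7 ?m"
        by (rule exec_Assign) (use "1.prems" in simp_all)
      show "exec (fst W) (snd W) p2 ?m t1 m1" by fact
      show "exec (fst W) (snd W) (Assign (N + 2) (Var 0)) m1 2 ?m1"
        by (rule exec_Assign) simp_all
      show "exec (fst W) (snd W) (Assign (N + 1) (Right (Var (N + 1)))) ?m1 3 ?m2"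
        by (rule exec_Assign) (use m1(2) in simp_all)
    qed
    have "\<exists>t m'. exec (fst W) (snd W) (While test body) ?m2 t m' \<and>
        m' (N + 2) = fold_data s W x (s W (Node x (Node e acc))) (dlist y) \<and>
        (\<forall>i \<ge> N + 3. m' i = ?m2 i) \<and> t \<le> (length (dlist y) + 1) * K W x"
    proof (rule "1.IH")
      fix n show "dsize (fold_data s W x (s W (Node x (Node e acc))) (take n (dlist y))) \<le> Q W x"
        using "1.prems"(6)[of "Suc n"] by (simp add: fold_data_def)
    qed (use "1.prems" m1 e1 in auto)
    then obtain t m' where IH: "exec (fst W) (snd W) (While test body) ?m2 t m'"
        "m' (N + 2) = fold_data s W x (s W (Node x (Node e acc))) (dlist y)"
        "\<forall>i \<ge> N + 3. m' i = ?m2 i" "t \<le> (length (dlist y) + 1) * K W x" by blast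
    have "exec (fst W) (snd W) (While test body) m (1 + cost test m + (7 + (t1 + (2 + 3))) + t) m'"
      by (rule exec.WhileTrue[OF _ bd IH(1)]) (use test(1)[of m] "1.prems" in simp)
    moreover have "1 + cost test m + (7 + (t1 + (2 + 3))) + t \<le> (length (dlist (Node e y)) + 1) * K W x"
      using IH(4) test(2)[of m] e1(4) sizes "1.prems"(3,5) by (auto simp: K_def)
    moreover have "\<forall>i \<ge> N + 3. m' i = m i" using IH(3) m1(3) by auto
    ultimately show ?case using IH(2)
      by (intro exI[of _ "1 + cost test m + (7 + (t1 + (2 + 3))) + t"] exI[of _ m']) (simp add: fold_data_def)
  next
    case "2_1"
    have "exec (fst W) (snd W) (While test body) m (1 + cost test m) m"
      by (rule exec.WhileFalse) (use test(1)[of m] "2_1.prems" in auto)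
    moreover have "1 + cost test m \<le> (length (dlist Empty) + 1) * K W x"
      using test(2)[of m] "2_1.prems"(3,5) by (auto simp: K_def)
    ultimately show ?case
      by (intro exI[of _ "1 + cost test m"] exI[of _ m]) (use "2_1.prems" in \<open>simp add: fold_data_def\<close>)
  next
    case ("2_2" v)
    have "exec (fst W) (snd W) (While test body) m (1 + cost test m) m"
      by (rule exec.WhileFalse) (use test(1)[of m] "2_2.prems" in auto)
    moreover have "1 + cost test m \<le> (length (dlist (Atom v)) + 1) * K W x"
      using test(2)[of m] "2_2.prems"(3,5) by (auto simp: K_def)
    ultimately show ?case
      by (intro exI[of _ "1 + cost test m"] exI[of _ m]) (use "2_2.prems" in \<open>simp add: fold_data_def\<close>)
  qed
  let ?p = "Seq (Assign N (Var 0)) (Seq p0 (Seq (Assign (N + 1) (Var 0)) (Seq (Assign 0 (Var N))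
    (Seq p1 (Seq (Assign (N + 2) (Var 0)) (Seq (While test body) (Assign 0 (Var (N + 2)))))))))"
  let ?T = "\<lambda>W x. 20 + T0 W x + T1 W x + (dsize (g W x) + 1) * K W x + Q W x"
  have "computed_by ?p (N + 3) ?T (\<lambda>W x. fold_data s W x (a W x) (dlist (g W x)))"
    unfolding computed_by_def
  proof (intro ballI allI)
    fix W and m :: "nat \<Rightarrow> data" assume W: "W \<in> OK"
    let ?x = "m 0"
    let ?m = "m(N := ?x)"
    obtain t0 m0 where e0: "exec (fst W) (snd W) p0 ?m t0 m0" "m0 0 = g W ?x" "\<forall>i\<ge>n0. m0 i = ?m i"
      "t0 \<le> T0 W ?x" "dsize (g W ?x) \<le> T0 W ?x"
      by (rule computed_byE[OF 0(2) W, of ?m "m 0"], simp add: N_def, rule that)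
    let ?m1 = "m0(N + 1 := m0 0)"
    let ?m2 = "?m1(0 := ?m1 N)"
    have mN: "?m1 N = ?x" using e0(3)[rule_format, of N] by (simp add: N_def)
    obtain t1 m1 where e1: "exec (fst W) (snd W) p1 ?m2 t1 m1" "m1 0 = a W ?x" "\<forall>i\<ge>n1. m1 i = ?m2 i"
      "t1 \<le> T1 W ?x" "dsize (a W ?x) \<le> T1 W ?x"
      by (rule computed_byE[OF 1(2) W, of ?m2 "m 0"], use mN in simp, rule that)
    let ?m3 = "m1(N + 2 := m1 0)"
    have m3: "?m3 N = ?x" "?m3 (N + 1) = g W ?x" "?m3 (N + 2) = a W ?x" "\<And>i. i \<ge> N + 3 \<Longrightarrow> ?m3 i = m i"
      using e0(2,3) e1(2,3) mN by (auto simp: N_def)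
    obtain t2 m2 where e2: "exec (fst W) (snd W) (While test body) ?m3 t2 m2"
      "m2 (N + 2) = fold_data s W ?x (a W ?x) (dlist (g W ?x))"
      "\<forall>i \<ge> N + 3. m2 i = ?m3 i" "t2 \<le> (length (dlist (g W ?x)) + 1) * K W ?x"
      using loop[OF W m3(1,2,3) order_refl bound[OF W]] by blast
    have A: "exec (fst W) (snd W) (Assign N (Var 0)) m 2 ?m"
      "exec (fst W) (snd W) (Assign (N + 1) (Var 0)) m0 2 ?m1"
      "exec (fst W) (snd W) (Assign 0 (Var N)) ?m1 2 ?m2"
      "exec (fst W) (snd W) (Assign (N + 2) (Var 0)) m1 2 ?m3"
      "exec (fst W) (snd W) (Assign 0 (Var (N + 2))) m2 2 (m2(0 := m2 (N + 2)))"
      by (rule exec_Assign; simp)+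
    have ex: "exec (fst W) (snd W) ?p m (2 + (t0 + (2 + (2 + (t1 + (2 + (t2 + 2))))))) (m2(0 := m2 (N + 2)))"
      using A e0(1) e1(1) e2(1) by (intro exec.Seq)
    have b: "dsize (fold_data s W ?x (a W ?x) (dlist (g W ?x))) \<le> Q W ?x"
      using bound[OF W, of ?x "length (dlist (g W ?x))"] by simp
    have t2: "t2 \<le> (dsize (g W ?x) + 1) * K W ?x"
      using e2(4) length_dlist[of "g W ?x"] by (meson add_le_mono1 le_trans mult_le_mono1)
    show "\<exists>t m'. exec (fst W) (snd W) ?p m t m' \<and> m' 0 = fold_data s W ?x (a W ?x) (dlist (g W ?x)) \<and>
       (\<forall>i\<ge>N + 3. m' i = m i) \<and> t \<le> ?T W ?x \<and> dsize (fold_data s W ?x (a W ?x) (dlist (g W ?x))) \<le> ?T W ?x"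
      by (rule exI, rule exI, rule conjI, rule ex) (use e0(4) e1(4) e2(2,3) m3(4) b t2 in \<open>auto simp: N_def\<close>)
  qed
  moreover have "pb ?T" unfolding K_def by (intro pb_add pb_mult 0 1 T3 pb_const PF_dsize g Q)
  ultimately show ?thesis unfolding PF_def by blast
qed

end

section \<open>Searching, counting and minimising over lists\<close>

lemma enc_bool_Empty [simp]: "enc_bool b = Empty \<longleftrightarrow> \<not> b"
  by (simp add: enc_bool_def)

definition revapp :: "data \<Rightarrow> data \<Rightarrow> data" where
  "revapp a b = foldl (\<lambda>acc e. Node e acc) b (dlist a)"

lemma dlist_foldl_Node: "dlist (foldl (\<lambda>acc e. Node e acc) b es) = rev es @ dlist b"
  by (induction es arbitrary: b) auto

lemma dlist_revapp: "dlist (revapp a b) = rev (dlist a) @ dlist b"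
  by (simp add: revapp_def dlist_foldl_Node)

lemma dsize_foldl_Node:
  "dsize (foldl (\<lambda>acc e. Node e acc) b es) = dsize b + sum_list (map (\<lambda>e. 1 + dsize e) es)"
  by (induction es arbitrary: b) auto

lemma sum_dlist_le: "sum_list (map (\<lambda>e. 1 + dsize e) (dlist a)) \<le> dsize a"
  by (induction a rule: dlist.induct) auto

lemma sum_list_take_le: "sum_list (map f (take n es)) \<le> sum_list (map f es)" for f :: "'a \<Rightarrow> nat"
proof -
  have "sum_list (map f es) = sum_list (map f (take n es @ drop n es))" by simp
  then show ?thesis unfolding map_append sum_list_append by linarith
qed

lemma dsize_revapp: "dsize (revapp a b) \<le> dsize a + dsize b"
  unfolding revapp_def dsize_foldl_Node using sum_dlist_le[of a] by simp

lemma foldl_if_const: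
  "foldl (\<lambda>acc e. if P e then c else acc) acc es = (if \<exists>e \<in> set es. P e then c else acc)"
  by (induction es arbitrary: acc) auto

lemma foldl_if_elem:
  "foldl (\<lambda>acc e. if P e acc then e else acc) a es \<in> insert a (set es)"
  by (induction es arbitrary: a) auto

lemma foldl_if_best:
  fixes sc :: "'a \<Rightarrow> nat"
  assumes "e \<in> insert a (set es)"
  shows "sc (foldl (\<lambda>acc e. if sc e < sc acc then e else acc) a es) \<le> sc e"
  using assms
proof (induction es arbitrary: a e)
  case (Cons b es)
  let ?a = "if sc b < sc a then b else a"
  have "sc (foldl (\<lambda>acc e. if sc e < sc acc then e else acc) ?a es) \<le> sc ?a" by (rule Cons.IH) simp
  moreover have "sc (foldl (\<lambda>acc e. if sc e < sc acc then e else acc) ?a es) \<le> sc e" if "e \<in> set es"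
    by (rule Cons.IH) (use that in simp)
  ultimately show ?case using Cons.prems by (auto split: if_splits)
qed simp

lemma length_foldl_count:
  "length (dlist (foldl (\<lambda>acc e. if P e then Node Empty acc else acc) a es)) = length (filter P es) + length (dlist a)"
  by (induction es arbitrary: a) auto

lemma dsize_foldl_count:
  "dsize (foldl (\<lambda>acc e. if P e then Node Empty acc else acc) a es) \<le> 2 * length es + dsize a"
proof (induction es arbitrary: a)
  case (Cons e es)
  show ?case using Cons[of a] Cons[of "Node Empty a"] by auto
qed simp

lemma dlist_foldl_right: "dlist (foldl (\<lambda>acc e. right acc) b es) = drop (length es) (dlist b)"
  by (induction es arbitrary: b) (auto simp: dlist_right drop_Suc)

lemma dsize_foldl_right: "dsize (foldl (\<lambda>acc e. right acc) b es) \<le> dsize b"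
  by (induction es arbitrary: b) (auto intro: order_trans[OF _ dsize_right])

lemma is_Node_iff: "Node (left y) (right y) = y \<longleftrightarrow> dlist y \<noteq> []"
  by (cases y) auto

context worlds begin

abbreviation PP :: "(world \<Rightarrow> data \<Rightarrow> bool) \<Rightarrow> bool" where
  "PP A \<equiv> PF (\<lambda>W x. enc_bool (A W x))"

lemma PF_If: "PP A \<Longrightarrow> PF f \<Longrightarrow> PF g \<Longrightarrow> PF (\<lambda>W x. if A W x then f W x else g W x)"
  using PF_if[of "\<lambda>W x. enc_bool (A W x)" f g] by simp

lemma PP_const: "PP (\<lambda>W x. b)"
  by (rule PF_const)

lemma PP_not: "PP A \<Longrightarrow> PP (\<lambda>W x. \<not> A W x)"
proof -
  assume "PP A"
  then have "PF (\<lambda>W x. if A W x then enc_bool False else enc_bool True)" by (intro PF_If PF_const)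
  moreover have "(\<lambda>W x. if A W x then enc_bool False else enc_bool True) = (\<lambda>W x. enc_bool (\<not> A W x))"
    by (auto simp: fun_eq_iff)
  ultimately show ?thesis by simp
qed

lemma PP_conj: "PP A \<Longrightarrow> PP B \<Longrightarrow> PP (\<lambda>W x. A W x \<and> B W x)"
proof -
  assume "PP A" "PP B"
  then have "PF (\<lambda>W x. if A W x then enc_bool (B W x) else enc_bool False)" by (intro PF_If PF_const)
  moreover have "(\<lambda>W x. if A W x then enc_bool (B W x) else enc_bool False) = (\<lambda>W x. enc_bool (A W x \<and> B W x))"
    by (auto simp: fun_eq_iff)
  ultimately show ?thesis by simp
qed

lemma PP_disj: "PP A \<Longrightarrow> PP B \<Longrightarrow> PP (\<lambda>W x. A W x \<or> B W x)"
  using PP_not[OF PP_conj[OF PP_not PP_not]] by simp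

lemma PP_comp: "PP A \<Longrightarrow> PF f \<Longrightarrow> PP (\<lambda>W x. A W (f W x))"
  by (rule PF_comp)

lemma PP_rel: "PF f \<Longrightarrow> PP (\<lambda>W x. \<exists>t \<in> rel (fst W) i. f W x = enc_tuple t)"
  using PF_rel[of f i] by (simp add: rel_answer_def)

lemma PP_ex:
  assumes A: "PP A" and g: "PF g"
  shows "PP (\<lambda>W x. \<exists>e \<in> set (dlist (g W x)). A W (Node x e))"
proof -
  let ?s = "\<lambda>W z. if A W (Node (left z) (left (right z))) then enc_bool True else right (right z)"
  have s: "PF ?s" by (intro PF_If PP_comp[OF A] PF_pair PF_left PF_right PF_id PF_const)
  have eq: "fold_data ?s W x acc es = (if \<exists>e \<in> set es. A W (Node x e) then enc_bool True else acc)" for W x acc es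
    by (simp add: fold_data_def foldl_if_const cong: if_cong)
  have "PF (\<lambda>W x. fold_data ?s W x (enc_bool False) (dlist (g W x)))"
  proof (rule PF_fold[OF s PF_const g])
    show "pb (\<lambda>W x. 3)" by (rule pb_const)
  qed (unfold eq, simp add: enc_bool_def)
  moreover have "(if Q then enc_bool True else enc_bool False) = enc_bool Q" for Q by simp
  ultimately show ?thesis unfolding eq by simp
qed

lemma PP_all:
  assumes "PP A" "PF g"
  shows "PP (\<lambda>W x. \<forall>e \<in> set (dlist (g W x)). A W (Node x e))"
  using PP_not[OF PP_ex[OF PP_not[OF assms(1)] assms(2)]] by simp

lemma PF_revapp:
  assumes f: "PF f" and g: "PF g" shows "PF (\<lambda>W x. revapp (f W x) (g W x))"
proof -
  let ?s = "\<lambda>W z. right z"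
  have eq: "fold_data ?s W x acc es = foldl (\<lambda>acc e. Node e acc) acc es" for W x acc es
    by (simp add: fold_data_def cong: if_cong)
  have "PF (\<lambda>W x. fold_data ?s W x (g W x) (dlist (f W x)))"
  proof (rule PF_fold[OF _ g f])
    show "pb (\<lambda>W x. dsize (g W x) + dsize (f W x))" by (intro pb_add PF_dsize f g)
    show "PF ?s" by (intro PF_right PF_id)
    fix W x n
    show "dsize (fold_data ?s W x (g W x) (take n (dlist (f W x)))) \<le> dsize (g W x) + dsize (f W x)"
      unfolding eq dsize_foldl_Node
      using sum_dlist_le[of "f W x"] sum_list_take_le[of "\<lambda>e. 1 + dsize e" n "dlist (f W x)"] by linarith
  qed
  then show ?thesis unfolding eq revapp_def .
qed

text \<open>A concat-map. The order in which \<open>revapp\<close> leaves the entries is irrelevant,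
  as later only their set is considered.\<close>

definition cmap :: "(world \<Rightarrow> data \<Rightarrow> data) \<Rightarrow> world \<Rightarrow> data \<Rightarrow> data list \<Rightarrow> data" where
  "cmap F W x es = foldl (\<lambda>acc e. revapp (F W (Node x e)) acc) Empty es"

lemma set_foldl_revapp:
  "set (dlist (foldl (\<lambda>acc e. revapp (h e) acc) a es)) = (\<Union>e \<in> set es. set (dlist (h e))) \<union> set (dlist a)"
  by (induction es arbitrary: a) (auto simp: dlist_revapp)

lemma set_cmap: "set (dlist (cmap F W x es)) = (\<Union>e \<in> set es. set (dlist (F W (Node x e))))"
  by (simp add: cmap_def set_foldl_revapp)

lemma dsize_foldl_revapp:
  "(\<And>e. e \<in> set es \<Longrightarrow> dsize (h e) \<le> k) \<Longrightarrow> dsize (foldl (\<lambda>acc e. revapp (h e) acc) a es) \<le> length es * k + dsize a"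
proof (induction es arbitrary: a)
  case (Cons e es)
  have "dsize (revapp (h e) a) \<le> k + dsize a" using dsize_revapp[of "h e" a] Cons.prems[of e] by simp
  moreover have "dsize (foldl (\<lambda>acc e. revapp (h e) acc) (revapp (h e) a) es) \<le> length es * k + dsize (revapp (h e) a)"
    by (rule Cons.IH) (use Cons.prems in auto)
  ultimately show ?case by simp
qed simp

lemma PF_cmap:
  assumes F: "PF F" and g: "PF g" shows "PF (\<lambda>W x. cmap F W x (dlist (g W x)))"
proof -
  let ?s = "\<lambda>W z. revapp (F W (Node (left z) (left (right z)))) (right (right z))"
  have eq: "fold_data ?s W x Empty es = cmap F W x es" for W x es
    by (simp add: fold_data_def cmap_def)
  have "pb (\<lambda>W x. 1 + dsize x + dsize (g W x))" by (intro pb_add pb_const pb_dsize PF_dsize g)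
  from pb_bound[OF PF_dsize[OF F] this]
  obtain T where T: "pb T" "\<And>W x z. W \<in> OK \<Longrightarrow> dsize z \<le> 1 + dsize x + dsize (g W x) \<Longrightarrow> dsize (F W z) \<le> T W x"
    by metis
  have "PF (\<lambda>W x. fold_data ?s W x Empty (dlist (g W x)))"
  proof (rule PF_fold[OF _ PF_const g])
    show "pb (\<lambda>W x. dsize (g W x) * T W x + 1)" by (intro pb_add pb_mult pb_const PF_dsize g T)
    show "PF ?s" by (intro PF_revapp PF_comp[OF F] PF_pair PF_left PF_right PF_id)
    fix W x n assume W: "W \<in> OK"
    have "dsize (F W (Node x e)) \<le> T W x" if "e \<in> set (take n (dlist (g W x)))" for e
      by (rule T(2)[OF W]) (use dsize_dlist[of e "g W x"] set_take_subset[of n "dlist (g W x)"] that in auto)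
    then have "dsize (fold_data ?s W x Empty (take n (dlist (g W x)))) \<le> length (take n (dlist (g W x))) * T W x + 1"
      unfolding eq cmap_def using dsize_foldl_revapp[of "take n (dlist (g W x))" "\<lambda>e. F W (Node x e)" "T W x" Empty] by simp
    also have "\<dots> \<le> dsize (g W x) * T W x + 1" using length_dlist[of "g W x"] by (intro add_right_mono mult_right_mono) auto
    finally show "dsize (fold_data ?s W x Empty (take n (dlist (g W x)))) \<le> dsize (g W x) * T W x + 1" .
  qed
  then show ?thesis unfolding eq .
qed

text \<open>The condition sees both the candidate and the current choice, which makes an argmin
  possible. The accumulator is always the start value or a list entry, so its size stays
  bounded.\<close>

lemma PF_select:
  assumes A: "PP A" and a: "PF a" and g: "PF g"
  shows "PF (\<lambda>W x. foldl (\<lambda>acc e. if A W (Node x (Node e acc)) then e else acc) (a W x) (dlist (g W x)))"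
proof -
  let ?s = "\<lambda>W z. if A W (Node (left z) (Node (left (right z)) (right (right z)))) then left (right z) else right (right z)"
  have eq: "fold_data ?s W x c es = foldl (\<lambda>acc e. if A W (Node x (Node e acc)) then e else acc) c es" for W x c es
    by (simp add: fold_data_def cong: if_cong)
  have "PF (\<lambda>W x. fold_data ?s W x (a W x) (dlist (g W x)))"
  proof (rule PF_fold[OF _ a g])
    show "pb (\<lambda>W x. dsize (a W x) + dsize (g W x))" by (intro pb_add PF_dsize g a)
    show "PF ?s" by (intro PF_If PP_comp[OF A] PF_pair PF_left PF_right PF_id)
    fix W x n
    have "fold_data ?s W x (a W x) (take n (dlist (g W x))) \<in> insert (a W x) (set (take n (dlist (g W x))))"
      unfolding eq by (rule foldl_if_elem)
    then show "dsize (fold_data ?s W x (a W x) (take n (dlist (g W x)))) \<le> dsize (a W x) + dsize (g W x)"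
      using dsize_dlist[of _ "g W x"] set_take_subset[of n "dlist (g W x)"] by (auto intro: trans_le_add1 trans_le_add2)
  qed
  then show ?thesis unfolding eq .
qed

text \<open>Atoms cannot be added, so numbers are kept in unary, as lengths of lists.\<close>

lemma PF_count:
  assumes A: "PP A" and g: "PF g"
  shows "PF (\<lambda>W x. foldl (\<lambda>acc e. if A W (Node x e) then Node Empty acc else acc) Empty (dlist (g W x)))"
proof -
  let ?s = "\<lambda>W z. if A W (Node (left z) (left (right z))) then Node Empty (right (right z)) else right (right z)"
  have eq: "fold_data ?s W x c es = foldl (\<lambda>acc e. if A W (Node x e) then Node Empty acc else acc) c es" for W x c es
    by (simp add: fold_data_def cong: if_cong)
  have "PF (\<lambda>W x. fold_data ?s W x Empty (dlist (g W x)))"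
  proof (rule PF_fold[OF _ PF_const g])
    show "pb (\<lambda>W x. 2 * dsize (g W x) + 1)" by (intro pb_add pb_mult pb_const PF_dsize g)
    show "PF ?s" by (intro PF_If PP_comp[OF A] PF_pair PF_left PF_right PF_id PF_const)
    fix W x n
    show "dsize (fold_data ?s W x Empty (take n (dlist (g W x)))) \<le> 2 * dsize (g W x) + 1"
      unfolding eq using dsize_foldl_count[of "\<lambda>e. A W (Node x e)" Empty "take n (dlist (g W x))"] length_dlist[of "g W x"]
      by simp
  qed
  then show ?thesis unfolding eq .
qed

text \<open>Unary comparison: one cell of the second list is removed for each entry of the first,
  and the test is whether a cell remains.\<close>

lemma PP_shorter:
  assumes f: "PF f" and g: "PF g"
  shows "PP (\<lambda>W x. length (dlist (f W x)) < length (dlist (g W x)))"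
proof -
  let ?s = "\<lambda>W z. right (right (right z))"
  have eq: "fold_data ?s W x c es = foldl (\<lambda>acc e. right acc) c es" for W x c es
    by (simp add: fold_data_def cong: if_cong)
  have "PF (\<lambda>W x. fold_data ?s W x (g W x) (dlist (f W x)))"
  proof (rule PF_fold[OF _ g f])
    show "pb (\<lambda>W x. dsize (g W x))" by (intro PF_dsize g)
    show "PF ?s" by (intro PF_right PF_id)
  qed (unfold eq, rule dsize_foldl_right)
  then have F: "PF (\<lambda>W x. foldl (\<lambda>acc e. right acc) (g W x) (dlist (f W x)))" unfolding eq .
  have "PP (\<lambda>W y. Node (left y) (right y) = y)" by (intro PF_same PF_pair PF_left PF_right PF_id)
  from PP_comp[OF this F] show ?thesis unfolding is_Node_iff dlist_foldl_right by (simp add: not_le)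
qed

end

section \<open>Uniform convergence\<close>

definition mistakes :: "('a \<Rightarrow> bool) \<Rightarrow> ('a \<times> bool) list \<Rightarrow> nat" where
  "mistakes H T = length (filter (\<lambda>(u, c). H u \<noteq> c) T)"

lemma map_replicate_pmf: "map_pmf (map f) (replicate_pmf n D) = replicate_pmf n (map_pmf f D)"
proof (induction n)
  case (Suc n)
  have "map_pmf (map f) (replicate_pmf (Suc n) D) =
      bind_pmf D (\<lambda>x. map_pmf (Cons (f x)) (map_pmf (map f) (replicate_pmf n D)))"
    by (simp add: map_pmf_def bind_assoc_pmf bind_return_pmf)
  also have "\<dots> = replicate_pmf (Suc n) (map_pmf f D)"
    unfolding Suc by (simp add: map_pmf_def bind_assoc_pmf bind_return_pmf)
  finally show ?case .
qed simp

lemma map_pmf_bernoulli: "map_pmf b D = bernoulli_pmf (measure_pmf.prob D {x. b x})"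
proof (rule pmf_eqI)
  fix i
  have "measure_pmf.prob D {x. \<not> b x} = 1 - measure_pmf.prob D {x. b x}"
    using measure_pmf.prob_compl[of "{x. b x}" D] by (simp add: Compl_eq_Diff_UNIV[symmetric] Collect_neg_eq)
  then show "pmf (map_pmf b D) i = pmf (bernoulli_pmf (measure_pmf.prob D {x. b x})) i"
    by (cases i) (simp_all add: pmf_map vimage_def)
qed

text \<open>Makes Hoeffding's inequality for binomial distributions applicable to a single
  hypothesis.\<close>

lemma map_mistakes: "map_pmf (mistakes H) (replicate_pmf n D) = binomial_pmf n (err D H)"
proof -
  let ?b = "\<lambda>(u, c). H u \<noteq> c"
  have "mistakes H = (length \<circ> filter id) \<circ> map ?b"
    by (auto simp: mistakes_def fun_eq_iff filter_map o_def)
  then have "map_pmf (mistakes H) (replicate_pmf n D) = map_pmf (length \<circ> filter id) (replicate_pmf n (map_pmf ?b D))"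
    by (simp only: map_replicate_pmf[symmetric] pmf.map_comp)
  also have "map_pmf ?b D = bernoulli_pmf (err D H)"
    unfolding map_pmf_bernoulli err_def by (simp add: case_prod_unfold)
  finally show ?thesis by (subst binomial_pmf_altdef) (simp_all add: err_def id_def comp_def)
qed

text \<open>If every empirical error is within \<epsilon>/2 of the true one, a comparison on the
  sample is a comparison of true errors up to \<epsilon>. Deviation \<epsilon>/2 in Hoeffding's
  inequality explains the exponent.\<close>

lemma uniform_convergence:
  assumes fin: "finite Hs" and pos: "0 < \<epsilon>" "0 < t"
    and t: "2 * real (card Hs) * exp (- real t * \<epsilon>\<^sup>2 / 2) \<le> \<delta>"
  shows "measure_pmf.prob (replicate_pmf t D)
    {T. \<forall>h \<in> Hs. \<forall>h' \<in> Hs. mistakes h T \<le> mistakes h' T \<longrightarrow> err D h \<le> err D h' + \<epsilon>} \<ge> 1 - \<delta>"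
proof -
  let ?M = "replicate_pmf t D"
  let ?dev = "\<lambda>h. {T. \<bar>real (mistakes h T) / real t - err D h\<bar> \<ge> \<epsilon> / 2}"
  let ?G = "{T. \<forall>h \<in> Hs. \<forall>h' \<in> Hs. mistakes h T \<le> mistakes h' T \<longrightarrow> err D h \<le> err D h' + \<epsilon>}"
  have dev: "measure_pmf.prob ?M (?dev h) \<le> 2 * exp (- real t * \<epsilon>\<^sup>2 / 2)" for h
  proof -
    interpret binomial_distribution t "err D h" by unfold_locales (simp add: err_def)
    have "measure_pmf.prob ?M (?dev h) = measure_pmf.prob (map_pmf (mistakes h) ?M) {x. \<bar>real x / real t - err D h\<bar> \<ge> \<epsilon> / 2}"
      by (simp add: vimage_def)
    also have "\<dots> \<le> 2 * exp (- 2 * real t * (\<epsilon> / 2)\<^sup>2)"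
      unfolding map_mistakes using prob_abs_ge'[of "\<epsilon> / 2"] pos by simp
    also have "- 2 * real t * (\<epsilon> / 2)\<^sup>2 = - real t * \<epsilon>\<^sup>2 / 2" by (simp add: power2_eq_square)
    finally show ?thesis .
  qed
  have "- ?G \<subseteq> (\<Union>h \<in> Hs. ?dev h)"
  proof
    fix T assume "T \<in> - ?G"
    then obtain h h' where h: "h \<in> Hs" "h' \<in> Hs" "mistakes h T \<le> mistakes h' T" "err D h > err D h' + \<epsilon>" by auto
    show "T \<in> (\<Union>h \<in> Hs. ?dev h)"
    proof (rule ccontr)
      assume "T \<notin> (\<Union>h \<in> Hs. ?dev h)"
      then have "\<bar>real (mistakes h T) / real t - err D h\<bar> < \<epsilon> / 2" "\<bar>real (mistakes h' T) / real t - err D h'\<bar> < \<epsilon> / 2"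
        using h by auto
      moreover have "real (mistakes h T) / real t \<le> real (mistakes h' T) / real t"
        using h(3) by (simp add: divide_right_mono)
      ultimately show False using h(4) by linarith
    qed
  qed
  then have "measure_pmf.prob ?M (- ?G) \<le> measure_pmf.prob ?M (\<Union>h \<in> Hs. ?dev h)"
    by (intro measure_pmf.finite_measure_mono) auto
  also have "\<dots> \<le> (\<Sum>h \<in> Hs. measure_pmf.prob ?M (?dev h))"
    by (intro measure_pmf.finite_measure_subadditive_finite fin) auto
  also have "\<dots> \<le> (\<Sum>h \<in> Hs. 2 * exp (- real t * \<epsilon>\<^sup>2 / 2))" by (intro sum_mono dev)
  also have "\<dots> \<le> \<delta>" using t by (simp add: mult_ac)
  finally show ?thesis
    using measure_pmf.prob_compl[of ?G ?M] by (simp add: Compl_eq_Diff_UNIV)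
qed

section \<open>Majority votes as random walks\<close>

definition walk :: "bool list \<Rightarrow> int" where
  "walk bs = sum_list (map (\<lambda>b. if b then 1 else -1) bs)"

lemma prob_bind_bernoulli:
  assumes "p \<in> {0..1}"
  shows "measure_pmf.prob (bind_pmf (bernoulli_pmf p) f) A =
    p * measure_pmf.prob (f True) A + (1 - p) * measure_pmf.prob (f False) A"
  unfolding measure_pmf_bind
  using assms by (subst measure_pmf.measure_bind[where N = "count_space UNIV"])
    (auto simp: measure_subprob mult.commute)

lemma prob_walk_Suc:
  assumes "p \<in> {0..1}"
  shows "measure_pmf.prob (replicate_pmf (Suc n) (bernoulli_pmf p)) {bs. Q (walk bs)} =
    p * measure_pmf.prob (replicate_pmf n (bernoulli_pmf p)) {bs. Q (walk bs + 1)} +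
    (1 - p) * measure_pmf.prob (replicate_pmf n (bernoulli_pmf p)) {bs. Q (walk bs - 1)}"
proof -
  have "replicate_pmf (Suc n) (bernoulli_pmf p) =
      bind_pmf (bernoulli_pmf p) (\<lambda>b. map_pmf (\<lambda>bs. b # bs) (replicate_pmf n (bernoulli_pmf p)))"
    by (simp add: map_pmf_def)
  then show ?thesis
    by (simp add: prob_bind_bernoulli[OF assms] vimage_def walk_def add.commute)
qed

text \<open>Conditioning on one vote, the induction hypothesis leads to the upper tails at a + 1 and
  a - 1, but with their weights exchanged. Since \<open>1 / 2 \<le> p\<close> and the tail at a - 1
  is the larger one, exchanging the weights back can only increase the sum.\<close>

lemma walk_symmetry:
  assumes p: "1 / 2 \<le> p" "p \<le> 1"
  shows "measure_pmf.prob (replicate_pmf n (bernoulli_pmf p)) {bs. walk bs \<le> - a} \<le>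
    measure_pmf.prob (replicate_pmf n (bernoulli_pmf p)) {bs. walk bs \<ge> a}"
proof (induction n arbitrary: a)
  case 0
  then show ?case by (simp add: walk_def indicator_def)
next
  case (Suc n)
  let ?P = "\<lambda>A. measure_pmf.prob (replicate_pmf n (bernoulli_pmf p)) A"
  have p01: "p \<in> {0..1}" using p by auto
  have eqs: "{bs. walk bs + 1 \<le> - a} = {bs. walk bs \<le> - (a + 1)}" "{bs. walk bs - 1 \<le> - a} = {bs. walk bs \<le> - (a - 1)}"
    "{bs. walk bs + 1 \<ge> a} = {bs. walk bs \<ge> a - 1}" "{bs. walk bs - 1 \<ge> a} = {bs. walk bs \<ge> a + 1}" by auto
  have le: "?P {bs. walk bs \<ge> a + 1} \<le> ?P {bs. walk bs \<ge> a - 1}"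
    by (intro measure_pmf.finite_measure_mono) auto
  have "p * ?P {bs. walk bs \<le> - (a + 1)} + (1 - p) * ?P {bs. walk bs \<le> - (a - 1)} \<le>
      p * ?P {bs. walk bs \<ge> a + 1} + (1 - p) * ?P {bs. walk bs \<ge> a - 1}"
    using p Suc[of "a + 1"] Suc[of "a - 1"] by (intro add_mono mult_left_mono) auto
  also have "\<dots> \<le> p * ?P {bs. walk bs \<ge> a - 1} + (1 - p) * ?P {bs. walk bs \<ge> a + 1}"
  proof -
    have "0 \<le> (2 * p - 1) * (?P {bs. walk bs \<ge> a - 1} - ?P {bs. walk bs \<ge> a + 1})" using p le by simp
    then show ?thesis by (simp add: algebra_simps)
  qed
  finally show ?case
    using prob_walk_Suc[OF p01, of n "\<lambda>x. x \<le> - a"] prob_walk_Suc[OF p01, of n "\<lambda>x. x \<ge> a"] unfolding eqs by simp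
qed

text \<open>By symmetry, n votes balance to at least 0 with probability at least 1/2, and one more
  favourable vote makes the majority strict. Because of ties 1/2 cannot be expected: two fair votes
  give exactly 1/4.\<close>

lemma walk_majority:
  assumes p: "1 / 2 \<le> p" "p \<le> 1"
  shows "1 / 4 \<le> measure_pmf.prob (replicate_pmf (Suc n) (bernoulli_pmf p)) {bs. walk bs > 0}"
proof -
  let ?M = "replicate_pmf n (bernoulli_pmf p)"
  have p01: "p \<in> {0..1}" using p by auto
  have "1 = measure_pmf.prob ?M ({bs. walk bs \<le> 0} \<union> {bs. walk bs \<ge> 0})"
  proof -
    have "{bs. walk bs \<le> 0} \<union> {bs. walk bs \<ge> 0} = UNIV" by auto
    then show ?thesis by simp
  qed
  also have "\<dots> \<le> measure_pmf.prob ?M {bs. walk bs \<le> 0} + measure_pmf.prob ?M {bs. walk bs \<ge> 0}"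
    by (rule measure_subadditive) (auto simp: measure_pmf.emeasure_eq_measure)
  finally have half: "1 / 2 \<le> measure_pmf.prob ?M {bs. walk bs \<ge> 0}"
    using walk_symmetry[OF p, of n 0] by simp
  have "1 / 4 \<le> p * measure_pmf.prob ?M {bs. walk bs \<ge> 0}"
    using mult_mono[OF p(1) half] p by simp
  also have "\<dots> \<le> p * measure_pmf.prob ?M {bs. walk bs + 1 > 0} + (1 - p) * measure_pmf.prob ?M {bs. walk bs - 1 > 0}"
  proof -
    have "{bs. walk bs \<ge> 0} = {bs. walk bs + 1 > 0}" by auto
    then show ?thesis using p by simp
  qed
  finally show ?thesis using prob_walk_Suc[OF p01, of n "\<lambda>x. x > 0"] by simp
qed

lemma walk_map: "walk (map b T) = int (length (filter b T)) - int (length (filter (\<lambda>x. \<not> b x) T))"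
  by (induction T) (auto simp: walk_def)

lemma majority:
  assumes "1 / 2 \<le> measure_pmf.prob D {x. b x}" "0 < t"
  shows "1 / 4 \<le> measure_pmf.prob (replicate_pmf t D) {T. length (filter (\<lambda>x. \<not> b x) T) < length (filter b T)}"
proof -
  obtain n where t: "t = Suc n" using assms(2) by (cases t) auto
  let ?p = "measure_pmf.prob D {x. b x}"
  have "1 / 4 \<le> measure_pmf.prob (replicate_pmf t (bernoulli_pmf ?p)) {bs. walk bs > 0}"
    unfolding t by (rule walk_majority) (use assms in auto)
  also have "replicate_pmf t (bernoulli_pmf ?p) = map_pmf (map b) (replicate_pmf t D)"
    by (simp add: map_replicate_pmf map_pmf_bernoulli)
  also have "measure_pmf.prob (map_pmf (map b) (replicate_pmf t D)) {bs. walk bs > 0} =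
      measure_pmf.prob (replicate_pmf t D) {T. length (filter (\<lambda>x. \<not> b x) T) < length (filter b T)}"
    by (simp add: vimage_def walk_map)
  finally show ?thesis .
qed

section \<open>Sample size for the union bound\<close>

text \<open>With x = n/\<delta>, the sample bound makes the exponential at most a power of 1/x.
  Absorbing a constant factor this way needs x bounded away from 1: it is at least 2 for two
  elements, and at least 4/3 if \<open>\<delta> \<le> 3 / 4\<close>. In the remaining case
  \<open>1 - \<delta> < 1 / 4\<close>, which the majority vote covers.\<close>

lemma sample_size:
  fixes K l :: nat
  shows "\<exists>s>0. \<forall>(B :: fin_struct) \<epsilon> \<delta> t N. 0 < \<epsilon> \<longrightarrow> \<epsilon> < 1 \<longrightarrow> 0 < \<delta> \<longrightarrow> \<delta> < 1 \<longrightarrow> sample_bound s B \<epsilon> \<delta> \<le> t \<longrightarrow>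
    1 \<le> card (univ B) \<longrightarrow> 2 \<le> card (univ B) \<or> \<delta> \<le> 3 / 4 \<longrightarrow> real N \<le> real K * real (card (univ B)) ^ l \<longrightarrow>
    2 * real N * exp (- real t * \<epsilon>\<^sup>2 / 2) \<le> \<delta>"
proof -
  obtain e where e: "2 * real K < (4 / 3) ^ e" using real_arch_pow[of "4 / 3" "2 * real K"] by auto
  \<comment> \<open>In the exponent, \<open>l\<close> pays for the parameters, 1 for the target
    \<open>\<delta>\<close> and \<open>e\<close> for the factor 2K; the doubling cancels the half in
    the Hoeffding bound.\<close>
  define s where "s = 2 * (l + 1 + e)"
  show ?thesis
  proof (intro exI[of _ s] conjI allI impI)
    show "0 < s" by (simp add: s_def)
    fix B :: fin_struct and \<epsilon> \<delta> :: real and t N :: nat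
    assume eps: "0 < \<epsilon>" "\<epsilon> < 1" and del: "0 < \<delta>" "\<delta> < 1" and t: "sample_bound s B \<epsilon> \<delta> \<le> t"
      and n1: "1 \<le> card (univ B)" and n: "2 \<le> card (univ B) \<or> \<delta> \<le> 3 / 4" and N: "real N \<le> real K * real (card (univ B)) ^ l"
    define n where "n = real (card (univ B))"
    define x where "x = n / \<delta>"
    have n1: "1 \<le> n" using n1 by (simp add: n_def)
    have x43: "4 / 3 \<le> x"
    proof (cases "2 \<le> card (univ B)")
      case True
      then have "2 \<le> n" by (simp add: n_def)
      moreover have "n \<le> x" using del n1 by (simp add: x_def field_simps)
      ultimately show ?thesis by simp
    next
      case False
      then have "\<delta> \<le> 3 / 4" using \<open>2 \<le> card (univ B) \<or> \<delta> \<le> 3 / 4\<close> by simp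
      then show ?thesis using del n1 by (simp add: x_def field_simps)
    qed
    have xpos: "0 < x" "0 \<le> ln x" using x43 by auto
    have "ln x \<le> log 2 x"
    proof -
      have "ln x * ln 2 \<le> ln x * 1" using xpos ln_2_less_1 by (intro mult_left_mono) auto
      then show ?thesis by (simp add: log_def field_simps)
    qed
    also have "log 2 x / \<epsilon>\<^sup>2 \<le> real (nat \<lceil>log 2 x / \<epsilon>\<^sup>2\<rceil>)" by linarith
    then have "log 2 x \<le> real (nat \<lceil>log 2 x / \<epsilon>\<^sup>2\<rceil>) * \<epsilon>\<^sup>2" using eps by (simp add: field_simps)
    finally have 1: "real s * ln x \<le> real s * (real (nat \<lceil>log 2 x / \<epsilon>\<^sup>2\<rceil>) * \<epsilon>\<^sup>2)" by (intro mult_left_mono) auto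
    also have "\<dots> = real (sample_bound s B \<epsilon> \<delta>) * \<epsilon>\<^sup>2" by (simp add: sample_bound_def x_def n_def)
    also have "\<dots> \<le> real t * \<epsilon>\<^sup>2" using t by (intro mult_right_mono) auto
    finally have "exp (- real t * \<epsilon>\<^sup>2 / 2) \<le> exp (- (real (l + 1 + e) * ln x))"
      by (simp add: s_def algebra_simps)
    also have "\<dots> = 1 / x ^ (l + 1 + e)"
      unfolding exp_minus exp_of_nat_mult using xpos by (simp only: exp_ln inverse_eq_divide)
    finally have E: "exp (- real t * \<epsilon>\<^sup>2 / 2) \<le> 1 / x ^ (l + 1 + e)" .
    have "2 * real N * exp (- real t * \<epsilon>\<^sup>2 / 2) \<le> (2 * real K * n ^ l) * (1 / x ^ (l + 1 + e))"
    proof (rule mult_mono)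
      show "2 * real N \<le> 2 * real K * n ^ l" using N by (simp add: n_def)
      show "exp (- real t * \<epsilon>\<^sup>2 / 2) \<le> 1 / x ^ (l + 1 + e)" by (rule E)
    qed (use n1 in auto)
    also have "\<dots> = (n / x) ^ l * (1 / x) * (2 * real K / x ^ e)" using xpos by (simp add: power_add power_divide field_simps)
    also have "\<dots> \<le> 1 * \<delta> * 1"
    proof (intro mult_mono)
      have "n / x = \<delta>" using n1 del by (simp add: x_def)
      then show "(n / x) ^ l \<le> 1" using del by (simp add: power_le_one)
      show "1 / x \<le> \<delta>" using n1 del by (simp add: x_def field_simps)
      have "(4 / 3) ^ e \<le> x ^ e" using x43 by (intro power_mono) auto
      then have "2 * real K \<le> x ^ e" using e by linarith
      then show "2 * real K / x ^ e \<le> 1" using xpos by (simp add: divide_le_eq)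
    qed (use xpos del n1 in auto)
    finally show "2 * real N * exp (- real t * \<epsilon>\<^sup>2 / 2) \<le> \<delta>" by simp
  qed
qed

section \<open>Evaluating sphere formulas with local access\<close>

definition worlds_of :: "signature \<Rightarrow> nat \<Rightarrow> world set" where
  "worlds_of \<sigma> d = {(B, nb). is_structure \<sigma> B \<and> univ B \<noteq> {} \<and> univ B = {..<card (univ B)} \<and>
     gaifman_degree B \<le> d \<and> neighbour_listing B nb}"

lemma card_neighbours_le:
  assumes "finite (univ B)" "gaifman_degree B \<le> d" "a \<in> univ B"
  shows "card (neighbours B a) \<le> d"
proof -
  have "card (neighbours B a) \<le> gaifman_degree B"
    unfolding gaifman_degree_def by (rule Max_ge) (use assms in auto)
  then show ?thesis using assms(2) by simp
qed

lemma worlds_worlds_of: "worlds (worlds_of \<sigma> d) d"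
proof
  fix B nb a assume W: "(B, nb) \<in> worlds_of \<sigma> d" and a: "a \<in> univ B"
  then have nb: "distinct (nb a)" "set (nb a) = neighbours B a"
    by (auto simp: worlds_of_def neighbour_listing_def)
  have B: "finite (univ B)" "gaifman_degree B \<le> d" "univ B = {..<card (univ B)}"
    using W by (auto simp: worlds_of_def is_structure_def)
  show "length (nb a) \<le> d" using card_neighbours_le[OF B(1,2) a] nb by (metis distinct_card)
  have "neighbours B a \<subseteq> univ B" by (auto simp: neighbours_def gaifman_def)
  then show "set (nb a) \<subseteq> {..<card (univ B)}" using nb(2) B(3) by simp
qed

locale learner =
  fixes P :: "'p numpred" and \<sigma> :: signature and d k l r w :: nat
begin

sublocale worlds "worlds_of \<sigma> d" d
  by (rule worlds_worlds_of)

abbreviation OK :: "world set" where "OK \<equiv> worlds_of \<sigma> d"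

lemma OKD:
  assumes "W \<in> OK"
  shows "is_structure \<sigma> (fst W)" "univ (fst W) \<noteq> {}" "univ (fst W) = {..<card (univ (fst W))}"
    "neighbour_listing (fst W) (snd W)" "finite (univ (fst W))"
    "a \<in> univ (fst W) \<Longrightarrow> card (neighbours (fst W) a) \<le> d" "0 \<in> univ (fst W)"
proof -
  show *: "is_structure \<sigma> (fst W)" "univ (fst W) \<noteq> {}" "univ (fst W) = {..<card (univ (fst W))}"
    "neighbour_listing (fst W) (snd W)"
    using assms unfolding worlds_of_def mem_Collect_eq case_prod_unfold by blast+
  show f: "finite (univ (fst W))" using *(1) by (simp add: is_structure_def)
  show "a \<in> univ (fst W) \<Longrightarrow> card (neighbours (fst W) a) \<le> d"
    by (rule card_neighbours_le[OF f]) (use assms[unfolded worlds_of_def mem_Collect_eq case_prod_unfold] in blast)+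
  have "0 < card (univ (fst W))" using *(2) f by (simp add: card_gt_0_iff)
  then show "0 \<in> univ (fst W)" by (subst *(3)) simp
qed

end

lemma enc_tuple_simps [simp]: "enc_tuple [] = Empty" "enc_tuple (a # as) = Node (Atom a) (enc_tuple as)"
  by (simp_all add: enc_list_def)

lemma dlist_enc_tuple [simp]: "dlist (enc_tuple as) = map Atom as"
  by (induction as) auto

lemma revapp_enc_tuple: "revapp (enc_tuple as) (enc_tuple bs) = enc_tuple (rev as @ bs)"
proof -
  have "foldl (\<lambda>acc e. Node e acc) (enc_tuple bs) (map Atom as) = enc_tuple (rev as @ bs)"
    by (induction as arbitrary: bs) (simp_all flip: enc_tuple_simps(2))
  then show ?thesis by (simp add: revapp_def)
qed

lemma foldl_enc_tuple:
  "foldl (\<lambda>env e. Node e env) (enc_tuple (rev as)) (map Atom bs) = enc_tuple (rev (as @ bs))"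
proof (induction bs arbitrary: as)
  case (Cons b bs)
  show ?case using Cons[of "as @ [b]"] by simp
qed simp

lemma funpow_right_enc_tuple: "(right ^^ j) (enc_tuple as) = enc_tuple (drop j as)"
proof (induction j arbitrary: as)
  case (Suc j)
  show ?case unfolding funpow_Suc_right o_apply by (cases as) (simp_all add: Suc Suc[of "[]", simplified])
qed simp

text \<open>Environments are stacks with the newest variable on top, so variable \<open>v\<close>
  among \<open>n\<close> sits at position \<open>n - 1 - v\<close>.\<close>

lemma get_enc_tuple:
  assumes "v < length as"
  shows "left ((right ^^ (length as - 1 - v)) (enc_tuple (rev as))) = Atom (as ! v)"
proof -
  have "drop (length as - 1 - v) (rev as) \<noteq> []" using assms by simp
  then have "left (enc_tuple (drop (length as - 1 - v) (rev as))) = Atom (hd (drop (length as - 1 - v) (rev as)))"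
    by (cases "drop (length as - 1 - v) (rev as)") simp_all
  also have "hd (drop (length as - 1 - v) (rev as)) = as ! v"
    using assms by (simp add: hd_drop_conv_nth rev_nth)
  finally show ?thesis unfolding funpow_right_enc_tuple .
qed

primrec quantifier_free :: "'p form \<Rightarrow> bool" where
  "quantifier_free Truth \<longleftrightarrow> True"
| "quantifier_free (Equal x y) \<longleftrightarrow> True"
| "quantifier_free (Rel i xs) \<longleftrightarrow> True"
| "quantifier_free (Neg \<phi>) \<longleftrightarrow> quantifier_free \<phi>"
| "quantifier_free (Conj \<phi> \<psi>) \<longleftrightarrow> quantifier_free \<phi> \<and> quantifier_free \<psi>"
| "quantifier_free (Disj \<phi> \<psi>) \<longleftrightarrow> quantifier_free \<phi> \<and> quantifier_free \<psi>"
| "quantifier_free (Exists x \<phi>) \<longleftrightarrow> False"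
| "quantifier_free (Forall x \<phi>) \<longleftrightarrow> False"
| "quantifier_free (Pred p ts) \<longleftrightarrow> False"
| "quantifier_free (ExistsNum \<kappa> \<phi>) \<longleftrightarrow> False"

lemma quantifier_free_conjs: "quantifier_free (conjs \<phi>s) \<longleftrightarrow> (\<forall>\<phi> \<in> set \<phi>s. quantifier_free \<phi>)"
  and quantifier_free_disjs: "quantifier_free (disjs \<phi>s) \<longleftrightarrow> (\<forall>\<phi> \<in> set \<phi>s. quantifier_free \<phi>)"
  by (induction \<phi>s) (auto simp: conjs_def disjs_def)

lemma quantifier_free_matrix: "quantifier_free (matrix_form \<sigma> \<tau> m)"
  and quantifier_free_cover: "quantifier_free (cover_form n m)"
  unfolding matrix_form_def cover_form_def Let_def quantifier_free_conjs quantifier_free_disjs set_append ball_Un ball_comprehension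
  by auto

context worlds begin

lemma PF_get: "PF (\<lambda>W x. left ((right ^^ i) x))"
proof (rule PF_left)
  show "PF (\<lambda>W x. (right ^^ i) x)" by (induction i) (auto intro: PF_id PF_right)
qed

text \<open>The value of variable \<open>v\<close> sits at position \<open>g v\<close> of the list that the program holds.\<close>

lemma PP_quantifier_free:
  fixes \<psi> :: "'p form"
  assumes "quantifier_free \<psi>"
  shows "\<exists>A. PP A \<and> (\<forall>W p x. (\<forall>v \<in> fv_form \<psi>. left ((right ^^ g v) x) = Atom (p v)) \<longrightarrow>
    (A W x \<longleftrightarrow> sat P (fst W) \<psi> p \<mu>))"
proof -
  define good where "good \<psi> A \<longleftrightarrow> (\<forall>(W :: world) p x. (\<forall>v \<in> fv_form \<psi>. left ((right ^^ g v) x) = Atom (p v)) \<longrightarrow>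
    (A W x \<longleftrightarrow> sat P (fst W) \<psi> p \<mu>))" for \<psi> :: "'p form" and A
  have "\<exists>A. PP A \<and> good \<psi> A"
    using assms
  proof (induction \<psi> rule: form.induct[where ?P2.0 = "\<lambda>_. True"])
    case Truth
    show ?case by (intro exI[of _ "\<lambda>W x. True"] conjI PP_const) (simp add: good_def)
  next
    case (Equal a b)
    show ?case
      by (intro exI[of _ "\<lambda>W x. left ((right ^^ g a) x) = left ((right ^^ g b) x)"] conjI PF_same PF_get)
        (simp add: good_def)
  next
    case (Rel i xs)
    have "\<exists>f. PF f \<and> (\<forall>W p x. (\<forall>v \<in> set xs. left ((right ^^ g v) x) = Atom (p v)) \<longrightarrow> f W x = enc_tuple (map p xs))"
    proof (induction xs)
      case Nil
      show ?case by (intro exI[of _ "\<lambda>W x. Empty"] conjI PF_const) simp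
    next
      case (Cons a xs)
      then obtain f where f: "PF f" "\<forall>W p x. (\<forall>v \<in> set xs. left ((right ^^ g v) x) = Atom (p v)) \<longrightarrow> f W x = enc_tuple (map p xs)"
        by blast
      show ?case
        by (intro exI[of _ "\<lambda>W x. Node (left ((right ^^ g a) x)) (f W x)"] conjI PF_pair PF_get f(1)) (use f(2) in simp)
    qed
    then obtain f where f: "PF f" "\<And>W p x. (\<forall>v \<in> set xs. left ((right ^^ g v) x) = Atom (p v)) \<Longrightarrow> f W x = enc_tuple (map p xs)"
      by blast
    have g: "good (Rel i xs) (\<lambda>W x. \<exists>t \<in> rel (fst W) i. f W x = enc_tuple t)"
      unfolding good_def fv_form.simps
    proof (intro allI impI)
      fix W p x assume "\<forall>v \<in> set xs. left ((right ^^ g v) x) = Atom (p v)"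
      from f(2)[OF this, of W]
      show "(\<exists>t \<in> rel (fst W) i. f W x = enc_tuple t) \<longleftrightarrow> sat P (fst W) (Rel i xs) p \<mu>" by simp
    qed
    show ?case by (intro exI[of _ "\<lambda>W x. \<exists>t \<in> rel (fst W) i. f W x = enc_tuple t"] conjI PP_rel f(1) g)
  next
    case (Neg \<psi>)
    then obtain A where A: "PP A" "good \<psi> A" by auto
    then have "good (Neg \<psi>) (\<lambda>W x. \<not> A W x)" by (simp add: good_def)
    then show ?case by (intro exI[of _ "\<lambda>W x. \<not> A W x"] conjI PP_not A(1))
  next
    case (Conj \<psi>1 \<psi>2)
    then obtain A B where A: "PP A" "good \<psi>1 A" "PP B" "good \<psi>2 B" by auto
    then have "good (Conj \<psi>1 \<psi>2) (\<lambda>W x. A W x \<and> B W x)"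
      unfolding good_def fv_form.simps sat.simps ball_Un by blast
    then show ?case by (intro exI[of _ "\<lambda>W x. A W x \<and> B W x"] conjI PP_conj A(1,3))
  next
    case (Disj \<psi>1 \<psi>2)
    then obtain A B where A: "PP A" "good \<psi>1 A" "PP B" "good \<psi>2 B" by auto
    then have "good (Disj \<psi>1 \<psi>2) (\<lambda>W x. A W x \<or> B W x)"
      unfolding good_def fv_form.simps sat.simps ball_Un by blast
    then show ?case by (intro exI[of _ "\<lambda>W x. A W x \<or> B W x"] conjI PP_disj A(1,3))
  qed simp_all
  then show ?thesis unfolding good_def .
qed

text \<open>Nested loops over the same list, one per chosen element; polynomial because
  \<open>m\<close> is fixed.\<close>

lemma PP_exists_list:
  assumes "PP A"
  shows "\<exists>A'. PP A' \<and> (\<forall>W xs env. A' W (Node xs env) \<longleftrightarrow>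
    (\<exists>es. length es = m \<and> set es \<subseteq> set (dlist xs) \<and> A W (Node xs (foldl (\<lambda>env e. Node e env) env es))))"
proof (induction m)
  case 0
  show ?case by (intro exI[of _ A]) (use assms in auto)
next
  case (Suc m)
  then obtain A' where A': "PP A'" "\<And>W xs env. A' W (Node xs env) \<longleftrightarrow>
    (\<exists>es. length es = m \<and> set es \<subseteq> set (dlist xs) \<and> A W (Node xs (foldl (\<lambda>env e. Node e env) env es)))"
    by blast
  let ?B = "\<lambda>W y. A' W (Node (left (left y)) (Node (right y) (right (left y))))"
  have "PP (\<lambda>W z. \<exists>e \<in> set (dlist (left z)). ?B W (Node z e))"
    by (intro PP_ex PP_comp[OF A'(1)] PF_pair PF_left PF_right PF_id)
  moreover have "(\<exists>e \<in> set (dlist (left (Node xs env))). ?B W (Node (Node xs env) e)) \<longleftrightarrow>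
    (\<exists>es. length es = Suc m \<and> set es \<subseteq> set (dlist xs) \<and> A W (Node xs (foldl (\<lambda>env e. Node e env) env es)))"
    for W xs env
    unfolding left.simps right.simps A'(2)
  proof safe
    fix e es assume "e \<in> set (dlist xs)" "m = length es" "set es \<subseteq> set (dlist xs)"
      "A W (Node xs (foldl (\<lambda>env e. Node e env) (Node e env) es))"
    then show "\<exists>es'. length es' = Suc (length es) \<and> set es' \<subseteq> set (dlist xs) \<and>
        A W (Node xs (foldl (\<lambda>env e. Node e env) env es'))"
      by (intro exI[of _ "e # es"]) simp
  next
    fix es' assume *: "length es' = Suc m" "set es' \<subseteq> set (dlist xs)"
      "A W (Node xs (foldl (\<lambda>env e. Node e env) env es'))"
    then obtain e es where "es' = e # es" by (cases es') auto
    with * show "\<exists>e \<in> set (dlist xs). \<exists>es. length es = m \<and> set es \<subseteq> set (dlist xs) \<and>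
        A W (Node xs (foldl (\<lambda>env e. Node e env) (Node e env) es))"
      by (intro bexI[of _ e] exI[of _ es]) simp_all
  qed
  ultimately show ?case
    by (intro exI[of _ "\<lambda>W z. \<exists>e \<in> set (dlist (left z)). ?B W (Node z e)"] conjI allI)
qed

text \<open>Breadth-first search for a fixed number of rounds. Duplicates may stay, as each round
  lengthens the list by at most a constant factor in bounded degree.\<close>

fun nlist :: "nat \<Rightarrow> world \<Rightarrow> data \<Rightarrow> data" where
  "nlist 0 W x = x"
| "nlist (Suc s) W x = cmap (\<lambda>W z. Node (right z) (nbs_answer (fst W) (snd W) (right z))) W x (dlist (nlist s W x))"

lemma PF_nlist: "PF (nlist s)"
proof (induction s)
  case 0
  then show ?case using PF_id by (simp add: fun_eq_iff[symmetric])
next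
  case (Suc s)
  have "PF (\<lambda>W x. nlist (Suc s) W x)"
    unfolding nlist.simps by (intro PF_cmap Suc PF_pair PF_right PF_id PF_nbs)
  then show ?case by simp
qed

end

context learner begin

lemma set_nlist:
  assumes W: "W \<in> OK" and x: "set (dlist x) = Atom ` X" "X \<subseteq> univ (fst W)"
  shows "set (dlist (nlist s W x)) = Atom ` gball (fst W) s X"
proof (induction s)
  case 0
  then show ?case using x by (simp add: gball_0 Int_absorb2)
next
  case (Suc s)
  have nb: "set (dlist (nbs_answer (fst W) (snd W) (Atom a))) = Atom ` neighbours (fst W) a"
    if "a \<in> gball (fst W) s X" for a
    using that gball_subset[of "fst W" s X] OKD(4)[OF W] by (auto simp: nbs_answer_def neighbour_listing_def)
  have "set (dlist (nlist (Suc s) W x)) = (\<Union>a \<in> gball (fst W) s X. insert (Atom a) (Atom ` neighbours (fst W) a))"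
    using nb by (simp add: set_cmap Suc)
  also have "\<dots> = Atom ` gball (fst W) (Suc s) X"
    by (auto simp: gball_Suc neighbours_def)
  finally show ?case .
qed

text \<open>The sphere formula quantifies over the whole structure, which local access cannot
  afford. By \<open>iso_centred_matrix\<close> with the ball itself as \<open>U\<close>, it is
  enough to list the ball and try all sequences of \<open>m\<close> of its elements.\<close>

lemma PP_sphere:
  assumes \<tau>: "is_type \<sigma> R (A, cs)" "length cs = n" "univ A = {..<m}"
  shows "\<exists>S. PP S \<and> (\<forall>W \<in> OK. \<forall>as \<in> tuples n (univ (fst W)).
    S W (enc_tuple (rev as)) \<longleftrightarrow> iso_centred (nbhd_struct R (fst W) as) (A, cs))"
proof -
  obtain M where M: "PP M" "\<forall>W p x. (\<forall>v \<in> fv_form (matrix_form \<sigma> (A, cs) m :: 'p form). left ((right ^^ (n + m - 1 - v)) x) = Atom (p v)) \<longrightarrow>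
      (M W x \<longleftrightarrow> sat P (fst W) (matrix_form \<sigma> (A, cs) m) p (\<lambda>_. 0))"
    using PP_quantifier_free[OF quantifier_free_matrix[of \<sigma> "(A, cs)" m], where g = "\<lambda>v. n + m - 1 - v" and P = P and \<mu> = "\<lambda>_. 0"]
    by (elim exE conjE) (rule that)
  \<comment> \<open>One more value, the element being tested, lies on top of the stack here, which
    shifts all positions by one.\<close>
  obtain C where C: "PP C" "\<forall>W p x. (\<forall>v \<in> fv_form (cover_form n m :: 'p form). left ((right ^^ (n + m - v)) x) = Atom (p v)) \<longrightarrow>
      (C W x \<longleftrightarrow> sat P (fst W) (cover_form n m) p (\<lambda>_. 0))"
    using PP_quantifier_free[OF quantifier_free_cover[of n m], where g = "\<lambda>v. n + m - v" and P = P and \<mu> = "\<lambda>_. 0"]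
    by (elim exE conjE) (rule that)
  define AA where "AA = (\<lambda>W z. M W (right z) \<and> (\<forall>e \<in> set (dlist (left z)). C W (Node (right (Node z e)) (right (left (Node z e))))))"
  have "PP (\<lambda>W z. AA W z)" unfolding AA_def
    by (intro PP_conj PP_comp[OF M(1)] PP_all[where A = "\<lambda>W y. C W (Node (right y) (right (left y)))"]
        PP_comp[OF C(1)] PF_pair PF_left PF_right PF_id)
  from PP_exists_list[OF this, of m] obtain A' where A': "PP A'" "\<And>W xs env. A' W (Node xs env) \<longleftrightarrow>
    (\<exists>es. length es = m \<and> set es \<subseteq> set (dlist xs) \<and> AA W (Node xs (foldl (\<lambda>env e. Node e env) env es)))"
    by (elim exE conjE) (rule that, assumption, blast)
  have "PP (\<lambda>W x. A' W (Node (nlist R W x) x))" by (intro PP_comp[OF A'(1)] PF_pair PF_nlist PF_id)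
  moreover have "A' W (Node (nlist R W (enc_tuple (rev as))) (enc_tuple (rev as))) \<longleftrightarrow>
      iso_centred (nbhd_struct R (fst W) as) (A, cs)"
    if W: "W \<in> OK" and as: "as \<in> tuples n (univ (fst W))" for W as
  proof -
    define \<beta> where "\<beta> i = (if i < n then as ! i else 0)" for i
    define N where "N = nbhd R (fst W) as"
    define L where "L = nlist R W (enc_tuple (rev as))"
    have len: "length as = n" and asU: "set as \<subseteq> univ (fst W)" using as by (auto simp: tuples_def)
    have m\<beta>: "map \<beta> [0..<n] = as" using len by (intro nth_equalityI) (auto simp: \<beta>_def)
    have L: "set (dlist L) = Atom ` N"
      unfolding L_def N_def nbhd_eq_gball by (rule set_nlist[OF W]) (use asU in auto)
    have key: "AA W (Node L (enc_tuple (rev (as @ bs)))) \<longleftrightarrow>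
        sat P (fst W) (matrix_form \<sigma> (A, cs) m) p (\<lambda>_. 0) \<and> (\<lambda>j. p (n + j)) ` {..<m} = N"
      if p: "p \<in> Ext N {n..<n + m} \<beta>" and bs: "bs = map (\<lambda>j. p (n + j)) [0..<m]" for p bs
    proof -
      have abs: "length (as @ bs) = n + m" using len bs by simp
      have val: "(as @ bs) ! v = p v" if "v < n + m" for v
        using that p len by (auto simp: bs nth_append Ext_def \<beta>_def)
      have "left ((right ^^ (n + m - 1 - v)) (enc_tuple (rev (as @ bs)))) = Atom (p v)"
        if "v \<in> fv_form (matrix_form \<sigma> (A, cs) m :: 'p form)" for v
      proof -
        have "v < n + m" using that matrix_form_fv[OF \<tau>] by blast
        then show ?thesis using get_enc_tuple[of v "as @ bs"] val abs by simp
      qed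
      then have 1: "M W (enc_tuple (rev (as @ bs))) \<longleftrightarrow> sat P (fst W) (matrix_form \<sigma> (A, cs) m) p (\<lambda>_. 0)"
        using M(2) by blast
      have 2: "C W (Node (Atom y) (enc_tuple (rev (as @ bs)))) \<longleftrightarrow> y \<in> (\<lambda>j. p (n + j)) ` {..<m}" for y
      proof -
        let ?p = "p(n + m := y)"
        have "left ((right ^^ (n + m - v)) (enc_tuple (rev (as @ bs @ [y])))) = Atom (?p v)" if "v \<le> n + m" for v
        proof -
          have "(as @ bs @ [y]) ! v = ?p v"
            using that val[of v] abs by (cases "v = n + m") (auto simp: nth_append simp flip: append_assoc)
          then show ?thesis using get_enc_tuple[of v "as @ bs @ [y]"] that abs by simp
        qed
        moreover have "v \<le> n + m" if "v \<in> fv_form (cover_form n m :: 'p form)" for v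
          using that by (auto simp: cover_form_def split: if_splits)
        ultimately have "\<forall>v \<in> fv_form (cover_form n m :: 'p form). left ((right ^^ (n + m - v)) (enc_tuple (rev (as @ bs @ [y])))) = Atom (?p v)"
          by blast
        then have "C W (enc_tuple (rev (as @ bs @ [y]))) \<longleftrightarrow> sat P (fst W) (cover_form n m) ?p (\<lambda>_. 0)"
          using C(2) by blast
        also have "\<dots> \<longleftrightarrow> y \<in> (\<lambda>j. p (n + j)) ` {..<m}" unfolding sat_cover_form by auto
        finally show ?thesis by simp
      qed
      \<comment> \<open>The guesses come from the ball, so only the inclusion of the ball in the
        guesses has to be tested.\<close>
      have sub: "(\<lambda>j. p (n + j)) ` {..<m} \<subseteq> N" using p by (auto simp: Ext_def)
      have "AA W (Node L (enc_tuple (rev (as @ bs)))) \<longleftrightarrow> M W (enc_tuple (rev (as @ bs))) \<and>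
        (\<forall>y \<in> N. C W (Node (Atom y) (enc_tuple (rev (as @ bs)))))"
        by (simp add: L AA_def)
      then show ?thesis unfolding 1 2 using sub by blast
    qed
    have "A' W (Node L (enc_tuple (rev as))) \<longleftrightarrow> (\<exists>p \<in> Ext N {n..<n + m} \<beta>.
        sat P (fst W) (matrix_form \<sigma> (A, cs) m) p (\<lambda>_. 0) \<and> (\<lambda>j. p (n + j)) ` {..<m} = N)"
    proof
      assume "A' W (Node L (enc_tuple (rev as)))"
      then obtain es where es: "length es = m" "set es \<subseteq> Atom ` N"
        "AA W (Node L (foldl (\<lambda>env e. Node e env) (enc_tuple (rev as)) es))"
        unfolding A'(2) L by blast
      from es(2) have "\<exists>bs. es = map Atom bs" unfolding ex_map_conv by auto
      then obtain bs where es_bs: "es = map Atom bs" by blast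
      have "set bs \<subseteq> N" using es(2) unfolding es_bs by auto
      note bs = es_bs this
      define p where "p v = (if v \<in> {n..<n + m} then bs ! (v - n) else \<beta> v)" for v
      have "length bs = m" using es(1) bs(1) by simp
      then have "p \<in> Ext N {n..<n + m} \<beta>" "bs = map (\<lambda>j. p (n + j)) [0..<m]"
        using bs(2) by (auto simp: Ext_def p_def intro!: nth_equalityI subsetD[OF bs(2)])
      from key[OF this] this(1) es(3) show "\<exists>p \<in> Ext N {n..<n + m} \<beta>.
        sat P (fst W) (matrix_form \<sigma> (A, cs) m) p (\<lambda>_. 0) \<and> (\<lambda>j. p (n + j)) ` {..<m} = N"
        unfolding bs(1) foldl_enc_tuple by blast
    next
      assume "\<exists>p \<in> Ext N {n..<n + m} \<beta>. sat P (fst W) (matrix_form \<sigma> (A, cs) m) p (\<lambda>_. 0) \<and> (\<lambda>j. p (n + j)) ` {..<m} = N"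
      then obtain p where p: "p \<in> Ext N {n..<n + m} \<beta>"
        "sat P (fst W) (matrix_form \<sigma> (A, cs) m) p (\<lambda>_. 0) \<and> (\<lambda>j. p (n + j)) ` {..<m} = N" by blast
      let ?bs = "map (\<lambda>j. p (n + j)) [0..<m]"
      have "AA W (Node L (foldl (\<lambda>env e. Node e env) (enc_tuple (rev as)) (map Atom ?bs)))"
        unfolding foldl_enc_tuple using key[OF p(1) refl] p(2) by blast
      moreover have "length (map Atom ?bs) = m" "set (map Atom ?bs) \<subseteq> Atom ` N"
        using p(1) by (auto simp: Ext_def)
      ultimately show "A' W (Node L (enc_tuple (rev as)))" unfolding A'(2) L by blast
    qed
    also have "\<dots> \<longleftrightarrow> iso_centred (nbhd_struct R (fst W) (map \<beta> [0..<n])) (A, cs)"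
    proof (rule iso_centred_matrix[OF OKD(1)[OF W] is_typeD(1)[OF \<tau>(1)] \<tau>(3) _ \<tau>(2), symmetric])
      show "set cs \<subseteq> {..<m}" using is_typeD(2)[OF \<tau>(1)] \<tau>(3) by simp
      show "\<beta> ` {..<n} \<subseteq> univ (fst W)" using len asU by (auto simp: \<beta>_def)
      show "N = nbhd R (fst W) (map \<beta> [0..<n])" unfolding m\<beta> N_def ..
      show "N \<subseteq> univ (fst W)" by (auto simp: N_def nbhd_def)
    qed simp
    finally show ?thesis unfolding m\<beta> L_def .
  qed
  ultimately show ?thesis
    by (intro exI[of _ "\<lambda>W x. A' W (Node (nlist R W x) x)"] conjI ballI)
qed

end

section \<open>The hypothesis class\<close>

definition assign :: "nat list \<Rightarrow> nat \<Rightarrow> nat" where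
  "assign as i = (if i < length as then as ! i else 0)"

lemma hyp_eq_sat: "hyp P B \<phi> v \<mu> u \<longleftrightarrow> sat P B \<phi> (assign (u @ v)) \<mu>"
proof -
  have "upd_list (\<lambda>_. 0) [0..<length (u @ v)] (u @ v) i = assign (u @ v) i" for i
  proof (cases "i < length (u @ v)")
    case True
    then show ?thesis using upd_list_nth[of "[0..<length (u @ v)]" "u @ v" i] by (simp add: assign_def)
  next
    case False
    then show ?thesis using upd_list_notin[of i "[0..<length (u @ v)]"] by (simp add: assign_def)
  qed
  then show ?thesis unfolding hyp_def by presburger
qed

lemma map_assign: "length as = n \<Longrightarrow> map (assign as) [0..<n] = as"
  by (rule nth_equalityI) (auto simp: assign_def)

lemma assign_image: "length as = n \<Longrightarrow> assign as ` {..<n} = set as"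
  by (auto simp: assign_def in_set_conv_nth image_iff)

lemma iso_centred_trans:
  assumes "iso_centred (A, as) (B, bs)" "iso_centred (B, bs) (C, cs)"
  shows "iso_centred (A, as) (C, cs)"
proof -
  obtain f where f: "bij_betw f (univ A) (univ B)" "\<forall>i. \<forall>t \<in> lists (univ A). t \<in> rel A i \<longleftrightarrow> map f t \<in> rel B i" "map f as = bs"
    using assms(1) unfolding iso_centred_def prod.case by blast
  obtain g where g: "bij_betw g (univ B) (univ C)" "\<forall>i. \<forall>t \<in> lists (univ B). t \<in> rel B i \<longleftrightarrow> map g t \<in> rel C i" "map g bs = cs"
    using assms(2) unfolding iso_centred_def prod.case by blast
  have "t \<in> rel A i \<longleftrightarrow> map (g \<circ> f) t \<in> rel C i" if "t \<in> lists (univ A)" for t i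
  proof -
    have "map f t \<in> lists (univ B)" using that bij_betwE[OF f(1)] by auto
    then show ?thesis using f(2) g(2) that by simp
  qed
  then show ?thesis
    using f(3) g(3) bij_betw_trans[OF f(1) g(1)] unfolding iso_centred_def prod.case
    by (intro exI[of _ "g \<circ> f"]) auto
qed

text \<open>Composing through \<open>\<tau>\<close> turns having the same type into the relation
  that locality is about.\<close>

lemma (in finite_structure) sim_of_iso:
  assumes "iso_centred (nbhd_struct R A as) \<tau>" "iso_centred (nbhd_struct R A bs) \<tau>"
    and "as \<in> tuples n (univ A)" "bs \<in> tuples n (univ A)"
  shows "sim R {..<n} (assign as) (assign bs)"
proof -
  obtain T ts where \<tau>: "\<tau> = (T, ts)" by (cases \<tau>)
  have len: "length as = n" "length bs = n" "set as \<subseteq> univ A" "set bs \<subseteq> univ A" using assms by (auto simp: tuples_def)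
  define NA where "NA = gball A R (set as)"
  define NB where "NB = gball A R (set bs)"
  have "set bs \<subseteq> NB" unfolding NB_def by (rule gball_self[OF len(4)])
  then have "iso_centred (T, ts) (induced A NB, bs)"
    using iso_centred_sym[of "induced A NB" bs T ts] assms(2)
    by (simp add: \<tau> nbhd_struct_def nbhd_eq_gball NB_def induced_def)
  moreover have "iso_centred (induced A NA, as) (T, ts)"
    using assms(1) by (simp add: \<tau> nbhd_struct_def nbhd_eq_gball NA_def)
  ultimately have "iso_centred (induced A NA, as) (induced A NB, bs)" using iso_centred_trans by blast
  then obtain f where f: "bij_betw f NA NB" "map f as = bs"
    "\<forall>i. \<forall>t \<in> lists NA. t \<in> rel A i \<inter> lists NA \<longleftrightarrow> map f t \<in> rel A i \<inter> lists NB"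
    unfolding iso_centred_def prod.case induced_def fin_struct.simps by blast
  have "t \<in> rel A i \<longleftrightarrow> map f t \<in> rel A i" if "t \<in> lists NA" for t i
  proof -
    have "map f t \<in> lists NB" using that bij_betwE[OF f(1)] by auto
    then show ?thesis using f(3) that by blast
  qed
  then have "piso f NA NB" using f(1) by (simp add: piso_def)
  moreover have "f (assign as i) = assign bs i" if "i < n" for i
    using arg_cong[OF f(2), of "\<lambda>xs. xs ! i"] that len by (simp add: assign_def)
  ultimately show ?thesis
    using len unfolding sim_def assign_image[OF len(1)] assign_image[OF len(2)] NA_def NB_def by auto
qed

text \<open>
  Parameters that are far from all examples can be replaced by a fixed element: they contribute
  the same component to the type of every example.
\<close>

lemma (in finite_structure) far_parameters:
  assumes X: "X \<subseteq> univ A" and v: "v \<in> tuples l (univ A)" and 0: "0 \<in> univ A"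
  obtains v' where "v' \<in> tuples l (insert 0 (gball A (l * (2 * R + 1)) X))"
    "\<And>u u'. u \<in> tuples k X \<Longrightarrow> u' \<in> tuples k X \<Longrightarrow>
      sim R {..<k + l} (assign (u @ v')) (assign (u' @ v')) \<Longrightarrow> sim R {..<k + l} (assign (u @ v)) (assign (u' @ v))"
proof -
  define m where "m = 2 * R + 1"
  have vl: "length v = l" "set v \<subseteq> univ A" using v by (auto simp: tuples_def)
  \<comment> \<open>\<open>I\<close> will be a largest set of parameters that all lie within
    \<open>card I * m\<close> of the sample. Any further parameter within \<open>m\<close> of that
    ball could be added, so all others are far; \<open>card I \<le> l\<close> gives the radius in
    the statement.\<close>
  let ?Q = "\<lambda>I. I \<subseteq> {..<l} \<and> (\<forall>i \<in> I. v ! i \<in> gball A (card I * m) X)"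
  define I where "I = arg_max card ?Q"
  have "?Q I \<and> (\<forall>I'. ?Q I' \<longrightarrow> card I' \<le> card I)"
    unfolding I_def by (rule arg_max_nat_lemma[of _ "{}" _ "Suc l"]) (use card_mono[of "{..<l}"] in \<open>auto simp: less_Suc_eq_le\<close>)
  then have I: "I \<subseteq> {..<l}" "\<And>i. i \<in> I \<Longrightarrow> v ! i \<in> gball A (card I * m) X" and max: "\<And>I'. ?Q I' \<Longrightarrow> card I' \<le> card I"
    by blast+
  have finI: "finite I" using I(1) finite_subset by auto
  have cardI: "card I \<le> l" using card_mono[OF _ I(1)] by simp
  have far: "v ! j \<notin> gball A m (gball A (card I * m) X)" if j: "j < l" "j \<notin> I" for j
  proof
    assume "v ! j \<in> gball A m (gball A (card I * m) X)"
    then have vj: "v ! j \<in> gball A (card (insert j I) * m) X"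
      using finI j by (simp add: gball_add[symmetric] add.commute)
    have "v ! i \<in> gball A (card (insert j I) * m) X" if "i \<in> I" for i
      using I(2)[OF that] gball_mono[of X X "card I * m" "card (insert j I) * m" A] finI j by auto
    with vj I(1) j have "?Q (insert j I)" by auto
    from max[OF this] show False using finI j by simp
  qed
  define v' where "v' = map (\<lambda>i. if i \<in> I then v ! i else 0) [0..<l]"
  have "v ! i \<in> gball A (l * m) X" if "i \<in> I" for i
    using I(2)[OF that] gball_mono[of X X "card I * m" "l * m" A] cardI by auto
  then have v': "v' \<in> tuples l (insert 0 (gball A (l * (2 * R + 1)) X))"
    by (auto simp: v'_def tuples_def m_def)
  show ?thesis
  proof (rule that[OF v'])
    fix u u' assume u: "u \<in> tuples k X" "u' \<in> tuples k X" and s: "sim R {..<k + l} (assign (u @ v')) (assign (u' @ v'))"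
    define K where "K = {..<k} \<union> (\<lambda>i. k + i) ` I"
    define J where "J = (\<lambda>i. k + i) ` ({..<l} - I)"
    have len: "length u = k" "length u' = k" "length v' = l" using u by (auto simp: tuples_def v'_def)
    have KJ: "{..<k + l} = K \<union> J"
    proof (intro equalityI subsetI)
      fix i assume "i \<in> {..<k + l}"
      then have "i < k \<or> (i - k < l \<and> i = k + (i - k))" by auto
      then show "i \<in> K \<union> J" unfolding K_def J_def by blast
    qed (use I(1) in \<open>auto simp: K_def J_def\<close>)
    have agree: "assign (x @ v') i = assign (x @ v) i" if "length x = k" "i \<in> K" for x i
      using that I(1) len vl by (auto simp: assign_def nth_append K_def v'_def)
    \<comment> \<open>The positions in \<open>J\<close>, which carry the default value in
      \<open>v'\<close>, are dropped, so the default element may lie anywhere.\<close>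
    have "sim R K (assign (u @ v')) (assign (u' @ v'))" by (rule sim_mono[OF s]) (auto simp: KJ)
    then have simK: "sim R K (assign (u @ v)) (assign (u' @ v))"
      by (rule sim_cong) (use agree len in auto)
    have onJ: "assign (x @ v) i = v ! (i - k) \<and> i - k < l \<and> i - k \<notin> I" if "length x = k" "i \<in> J" for x i
      using that vl by (auto simp: assign_def nth_append J_def)
    have "v ! j \<in> univ A" if "j < l" for j using that vl nth_mem[of j v] by auto
    \<comment> \<open>On \<open>J\<close> both assignments take the same values, the original far
      parameters, so the identity is an isomorphism there.\<close>
    then have "sim R J (assign (u @ v)) (assign (u @ v))"
      using onJ[OF len(1)] by (intro sim_refl) auto
    then have simJ: "sim R J (assign (u @ v)) (assign (u' @ v))"
      by (rule sim_cong) (use onJ[OF len(1)] onJ[OF len(2)] in auto)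
    have farJ: "assign (x @ v) ` J \<inter> gball A (2 * R + 1) (assign (x @ v) ` K) = {}" if x: "x \<in> tuples k X" for x
    proof -
      have lx: "length x = k" "set x \<subseteq> X" using x by (auto simp: tuples_def)
      have "assign (x @ v) ` K \<subseteq> gball A (card I * m) X"
      proof
        fix y assume "y \<in> assign (x @ v) ` K"
        then consider i where "i < k" "y = x ! i" | i where "i \<in> I" "y = v ! i"
          using I(1) lx vl by (auto simp: K_def assign_def nth_append)
        then show "y \<in> gball A (card I * m) X"
        proof cases
          case 1
          then have "y \<in> X" using lx nth_mem[of i x] by auto
          then show ?thesis using gball_self[OF X] by blast
        qed (use I(2) in simp)
      qed
      then have "gball A m (assign (x @ v) ` K) \<subseteq> gball A m (gball A (card I * m) X)" by (rule gball_mono) simp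
      moreover have "assign (x @ v) j \<notin> gball A m (gball A (card I * m) X)" if "j \<in> J" for j
        using onJ[OF lx(1) that] far by simp
      ultimately show ?thesis unfolding m_def by blast
    qed
    show "sim R {..<k + l} (assign (u @ v)) (assign (u' @ v))"
      unfolding KJ by (rule sim_union[OF simK simJ farJ[OF u(1)] farJ[OF u(2)]])
  qed
qed

context learner begin

definition rad :: nat where "rad = (2 * w + 1) ^ r - 1"

definition types :: "(fin_struct \<times> nat list) set" where
  "types = normal_types \<sigma> rad (k + l) ((k + l) * (1 + d) ^ rad)"

definition sphere_of :: "fin_struct \<times> nat list \<Rightarrow> 'p form" where
  "sphere_of \<tau> = sphere_form \<sigma> rad \<tau> (card (univ (fst \<tau>)))"

text \<open>
  The empty disjunction has to be a Boolean combination of sphere formulas; any sphere formula does.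
\<close>

definition empty_type :: "fin_struct \<times> nat list" where
  "empty_type = (\<lparr>univ = {}, rel = \<lambda>_. {}\<rparr>, [])"

definition type_form :: "(fin_struct \<times> nat list) list \<Rightarrow> 'p form" where
  "type_form \<tau>s = foldr Disj (map sphere_of \<tau>s) (Conj (sphere_of empty_type) (Neg (sphere_of empty_type)))"

lemma sat_type_form: "sat P B (type_form \<tau>s) \<beta> \<mu> \<longleftrightarrow> (\<exists>\<tau> \<in> set \<tau>s. sat P B (sphere_of \<tau>) \<beta> \<mu>)"
  by (induction \<tau>s) (auto simp: type_form_def)

lemma empty_type: "is_type \<sigma> rad empty_type"
  by (auto simp: is_type_def empty_type_def is_structure_def nbhd_def)

lemma typesD:
  assumes "\<tau> \<in> types"
  shows "is_type \<sigma> rad (fst \<tau>, snd \<tau>)" "length (snd \<tau>) = k + l" "univ (fst \<tau>) = {..<card (univ (fst \<tau>))}"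
proof -
  have "is_type \<sigma> rad \<tau>" "length (snd \<tau>) = k + l" and "\<exists>m. univ (fst \<tau>) = {..<m}"
    using assms unfolding types_def normal_types_def by blast+
  then show "is_type \<sigma> rad (fst \<tau>, snd \<tau>)" "length (snd \<tau>) = k + l" "univ (fst \<tau>) = {..<card (univ (fst \<tau>))}"
    by (simp, simp, metis card_lessThan)
qed

lemma sphere_of_types:
  assumes "\<tau> \<in> types"
  shows "is_sphere_formula P \<sigma> rad [0..<k + l] (sphere_of \<tau>)"
  using sphere_form_is_sphere_formula[OF typesD[OF assms], of P] unfolding sphere_of_def prod.collapse .

lemma sphere_of_empty_type: "is_sphere_formula P \<sigma> rad [0..<0] (sphere_of empty_type)"
proof -
  have "is_sphere_formula P \<sigma> rad [0..<0] (sphere_form \<sigma> rad (\<lparr>univ = {}, rel = \<lambda>_. {}\<rparr>, []) 0)"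
    by (rule sphere_form_is_sphere_formula) (use empty_type in \<open>simp_all add: empty_type_def\<close>)
  then show ?thesis by (simp add: sphere_of_def empty_type_def)
qed

lemma rad_less: "rad < (2 * w + 1) ^ r"
  by (simp add: rad_def)

lemma sphere_comb_type_form:
  assumes "set \<tau>s \<subseteq> types"
  shows "sphere_comb P \<sigma> ((2 * w + 1) ^ r) {..<k + l} (type_form \<tau>s)"
  using assms
proof (induction \<tau>s)
  case Nil
  have "sphere_comb P \<sigma> ((2 * w + 1) ^ r) {..<k + l} (sphere_of empty_type)"
    by (rule sphere_comb.sphere[OF sphere_of_empty_type rad_less]) simp
  then show ?case by (auto simp: type_form_def intro: sphere_comb.conj sphere_comb.neg)
next
  case (Cons \<tau> \<tau>s)
  have "sphere_comb P \<sigma> ((2 * w + 1) ^ r) {..<k + l} (sphere_of \<tau>)"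
    by (rule sphere_comb.sphere[OF sphere_of_types rad_less]) (use Cons.prems in auto)
  then show ?case using Cons by (auto simp: type_form_def intro: sphere_comb.disj)
qed

lemma is_fo_type_form:
  assumes "set \<tau>s \<subseteq> types"
  shows "is_fo (type_form \<tau>s)"
  using assms
proof (induction \<tau>s)
  case Nil
  then show ?case using sphere_of_empty_type by (simp add: type_form_def is_sphere_formula_def)
next
  case (Cons \<tau> \<tau>s)
  then show ?case using sphere_of_types[of \<tau>] by (simp add: type_form_def is_sphere_formula_def)
qed

lemma finite_types: "finite types"
  by (simp add: types_def finite_normal_types)

text \<open>One disjunction for every set of types. The list depends only on the fixed parameters,
  not on the input structure, so programs may contain it as constant data.\<close>

definition \<Phi> :: "'p form list" where
  "\<Phi> = map type_form (List.subseqs (SOME \<tau>s. set \<tau>s = types))"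

lemma \<Phi>_mem: "\<phi> \<in> set \<Phi> \<Longrightarrow> \<exists>\<tau>s. set \<tau>s \<subseteq> types \<and> \<phi> = type_form \<tau>s"
  and \<Phi>_ex: "S \<subseteq> types \<Longrightarrow> \<exists>\<tau>s. set \<tau>s = S \<and> type_form \<tau>s \<in> set \<Phi>"
proof -
  have *: "set (SOME \<tau>s. set \<tau>s = types) = types"
    by (rule someI_ex) (rule finite_list[OF finite_types])
  have sub: "set ` set (List.subseqs (SOME \<tau>s. set \<tau>s = types)) = Pow types"
    using subseqs_powset[of "SOME \<tau>s. set \<tau>s = types"] * by simp
  show "\<phi> \<in> set \<Phi> \<Longrightarrow> \<exists>\<tau>s. set \<tau>s \<subseteq> types \<and> \<phi> = type_form \<tau>s"
    using sub unfolding \<Phi>_def by auto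
  assume "S \<subseteq> types"
  then have "S \<in> set ` set (List.subseqs (SOME \<tau>s. set \<tau>s = types))" unfolding sub by simp
  then show "\<exists>\<tau>s. set \<tau>s = S \<and> type_form \<tau>s \<in> set \<Phi>" unfolding \<Phi>_def by auto
qed

lemma \<Phi>_not_Nil: "\<Phi> \<noteq> []"
proof -
  obtain \<tau>s where "type_form \<tau>s \<in> set \<Phi>" using \<Phi>_ex[OF empty_subsetI] by blast
  then show ?thesis by (cases \<Phi>) simp_all
qed

lemma hyp_type_form:
  assumes W: "W \<in> OK" and \<tau>s: "set \<tau>s \<subseteq> types" and uv: "u \<in> tuples k (univ (fst W))" "v \<in> tuples l (univ (fst W))"
  shows "hyp P (fst W) (type_form \<tau>s) v \<mu> u \<longleftrightarrow> (\<exists>\<tau> \<in> set \<tau>s. iso_centred (nbhd_struct rad (fst W) (u @ v)) \<tau>)"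
proof -
  have len: "length (u @ v) = k + l" "set (u @ v) \<subseteq> univ (fst W)" using uv by (auto simp: tuples_def)
  have "sat P (fst W) (sphere_of \<tau>) (assign (u @ v)) \<mu> \<longleftrightarrow> iso_centred (nbhd_struct rad (fst W) (u @ v)) \<tau>"
    if "\<tau> \<in> types" for \<tau>
    using sat_sphere_form[OF typesD[OF that] OKD(1)[OF W], of "assign (u @ v)" P \<mu>] len(2)
    by (simp add: sphere_of_def map_assign[OF len(1)] assign_image[OF len(1)])
  then show ?thesis using \<tau>s unfolding hyp_eq_sat sat_type_form by blast
qed

text \<open>\<open>h\<close> is an arbitrary function that respects types, and the set of types
  where it is true may depend on the world. This is how number parameters and numerical predicates
  disappear from the hypothesis.\<close>

lemma realise:
  assumes W: "W \<in> OK" and v: "v \<in> tuples l (univ (fst W))" and X: "X \<subseteq> tuples k (univ (fst W))"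
    and h: "\<And>u u'. u \<in> X \<Longrightarrow> u' \<in> X \<Longrightarrow>
      finite_structure.sim (fst W) rad {..<k + l} (assign (u @ v)) (assign (u' @ v)) \<Longrightarrow> h u = h u'"
  shows "\<exists>\<phi> \<in> set \<Phi>. \<forall>u \<in> X. hyp P (fst W) \<phi> v \<mu> u = h u"
proof -
  interpret finite_structure "fst W" using is_structure_finite_structure[OF OKD(1)[OF W]] .
  define S where "S = {\<tau> \<in> types. \<exists>u \<in> X. h u \<and> iso_centred (nbhd_struct rad (fst W) (u @ v)) \<tau>}"
  obtain \<tau>s where \<tau>s: "set \<tau>s = S" "type_form \<tau>s \<in> set \<Phi>" using \<Phi>_ex[of S] by (auto simp: S_def)
  have "hyp P (fst W) (type_form \<tau>s) v \<mu> u = h u" if u: "u \<in> X" for u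
  proof -
    have uv: "u \<in> tuples k (univ (fst W))" "u @ v \<in> tuples (k + l) (univ (fst W))"
      using u X v by (auto simp: tuples_def)
    have "hyp P (fst W) (type_form \<tau>s) v \<mu> u \<longleftrightarrow> (\<exists>\<tau> \<in> S. iso_centred (nbhd_struct rad (fst W) (u @ v)) \<tau>)"
      using hyp_type_form[OF W _ uv(1) v, of \<tau>s \<mu>] \<tau>s(1) by (auto simp: S_def)
    also have "\<dots> \<longleftrightarrow> h u"
    proof
      assume "\<exists>\<tau> \<in> S. iso_centred (nbhd_struct rad (fst W) (u @ v)) \<tau>"
      then obtain \<tau> u' where t: "iso_centred (nbhd_struct rad (fst W) (u @ v)) \<tau>" "u' \<in> X" "h u'"
        "iso_centred (nbhd_struct rad (fst W) (u' @ v)) \<tau>" unfolding S_def by blast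
      have "u' @ v \<in> tuples (k + l) (univ (fst W))" using t(2) X v by (auto simp: tuples_def)
      then have "sim rad {..<k + l} (assign (u @ v)) (assign (u' @ v))"
        using sim_of_iso[OF t(1,4) uv(2)] by blast
      from h[OF u t(2) this] t(3) show "h u" by simp
    next
      assume "h u"
      obtain \<tau> where "\<tau> \<in> types" "iso_centred (nbhd_struct rad (fst W) (u @ v)) \<tau>"
        using normal_type_exists[OF OKD(1)[OF W] OKD(6)[OF W] uv(2), of rad] unfolding types_def by blast
      with \<open>h u\<close> u show "\<exists>\<tau> \<in> S. iso_centred (nbhd_struct rad (fst W) (u @ v)) \<tau>" unfolding S_def by blast
    qed
    finally show ?thesis .
  qed
  with \<tau>s(2) show ?thesis by blast
qed

text \<open>Element 0 is the default that replaces far parameters: it lies in every nonempty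
  universe \<open>{..<n}\<close>, and a program can contain it as a constant.\<close>

definition near_elems :: "fin_struct \<Rightarrow> (nat list \<times> bool) list \<Rightarrow> nat set" where
  "near_elems B T = insert 0 (gball B (l * (2 * rad + 1)) (\<Union>(u, c) \<in> set T. set u))"

text \<open>Two replacements of a concept for two purposes: an exact one with its own parameters,
  for comparing true errors, and one that agrees on the sample but has near parameters, for
  comparing empirical errors.\<close>

lemma concept_realised:
  assumes W: "W \<in> OK" and C: "C \<in> concepts P \<sigma> k l r w (fst W)"
  shows "\<exists>\<phi> \<in> set \<Phi>. \<exists>v \<in> tuples l (univ (fst W)). \<forall>u \<in> tuples k (univ (fst W)). hyp P (fst W) \<phi> v (\<lambda>_. 0) u = C u"
    and "T \<in> lists (examples k (fst W)) \<Longrightarrow>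
      \<exists>\<phi> \<in> set \<Phi>. \<exists>v \<in> tuples l (near_elems (fst W) T). \<forall>(u, c) \<in> set T. hyp P (fst W) \<phi> v (\<lambda>_. 0) u = C u"
proof -
  interpret finite_structure "fst W" using is_structure_finite_structure[OF OKD(1)[OF W]] .
  obtain \<psi> v \<mu> where C: "C = hyp P (fst W) \<psi> v \<mu>" "wf_form P \<sigma> \<psi>" "fv_form \<psi> \<subseteq> {..<k + l}" "bw_form \<psi> \<le> w"
    "br_form \<psi> \<le> r" and v: "v \<in> tuples l (univ (fst W))" using C unfolding concepts_def mem_Collect_eq by (elim exE conjE) (rule that)
  have loc: "C u = C u'" if "sim rad {..<k + l} (assign (u @ v)) (assign (u' @ v))" for u u'
    unfolding C(1) hyp_eq_sat by (rule locality[OF C(2,4,5,3) that[unfolded rad_def]])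
  have "\<exists>\<phi> \<in> set \<Phi>. \<forall>u \<in> tuples k (univ (fst W)). hyp P (fst W) \<phi> v (\<lambda>_. 0) u = C u"
    by (rule realise[OF W v order_refl]) (rule loc)
  with v show "\<exists>\<phi> \<in> set \<Phi>. \<exists>v \<in> tuples l (univ (fst W)). \<forall>u \<in> tuples k (univ (fst W)). hyp P (fst W) \<phi> v (\<lambda>_. 0) u = C u"
    by blast
  assume T: "T \<in> lists (examples k (fst W))"
  let ?X = "\<Union>(u, c) \<in> set T. set u"
  have T': "u \<in> tuples k (univ (fst W)) \<and> u \<in> tuples k ?X" if "u \<in> fst ` set T" for u
    using that T by (fastforce simp: examples_def tuples_def)
  have X: "?X \<subseteq> univ (fst W)" using T by (fastforce simp: examples_def tuples_def)
  obtain v' where v': "v' \<in> tuples l (near_elems (fst W) T)"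
    "\<And>u u'. u \<in> tuples k ?X \<Longrightarrow> u' \<in> tuples k ?X \<Longrightarrow>
      sim rad {..<k + l} (assign (u @ v')) (assign (u' @ v')) \<Longrightarrow> sim rad {..<k + l} (assign (u @ v)) (assign (u' @ v))"
    by (rule far_parameters[OF X v OKD(7)[OF W], of rad k]) (rule that, simp add: near_elems_def, blast)
  have "near_elems (fst W) T \<subseteq> univ (fst W)"
    using OKD(7)[OF W] gball_subset unfolding near_elems_def by blast
  then have v'U: "v' \<in> tuples l (univ (fst W))" using v'(1) by (auto simp: tuples_def)
  have sub: "fst ` set T \<subseteq> tuples k (univ (fst W))" using T' by blast
  have "\<exists>\<phi> \<in> set \<Phi>. \<forall>u \<in> fst ` set T. hyp P (fst W) \<phi> v' (\<lambda>_. 0) u = C u"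
    by (rule realise[OF W v'U sub], rule loc, rule v'(2)) (use T' in blast)+
  then show "\<exists>\<phi> \<in> set \<Phi>. \<exists>v \<in> tuples l (near_elems (fst W) T). \<forall>(u, c) \<in> set T. hyp P (fst W) \<phi> v (\<lambda>_. 0) u = C u"
    using v'(1) by fastforce
qed

end

section \<open>Learning\<close>

fun tuple_list :: "(world \<Rightarrow> data \<Rightarrow> data) \<Rightarrow> nat \<Rightarrow> world \<Rightarrow> data \<Rightarrow> data" where
  "tuple_list el 0 W x = Node Empty Empty"
| "tuple_list el (Suc j) W x = worlds.cmap (\<lambda>W z. worlds.cmap (\<lambda>W z'. Node (Node (right (left z')) (right z')) Empty) W z
     (dlist (tuple_list el j W (left z)))) W x (dlist (el W x))"

definition form_list :: "'p form list \<Rightarrow> data \<Rightarrow> data" where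
  "form_list fs v = foldr (\<lambda>\<phi>. Node (Node (enc_form \<phi>) v)) fs Empty"

lemma dlist_form_list: "dlist (form_list fs v) = map (\<lambda>\<phi>. Node (enc_form \<phi>) v) fs"
  by (induction fs) (auto simp: form_list_def)

lemma dlist_enc_sample: "dlist (enc_sample T) = map (\<lambda>(u, c). Node (enc_tuple u) (enc_bool c)) T"
  by (induction T) (auto simp: enc_sample_def enc_list_def)

lemma enc_bool_inject [simp]: "enc_bool a = enc_bool b \<longleftrightarrow> a = b"
  by (simp add: enc_bool_def)

context worlds begin

lemma PF_tuple_list: "PF el \<Longrightarrow> PF (tuple_list el j)"
proof (induction j)
  case 0
  have "PF (\<lambda>W x. tuple_list el 0 W x)" unfolding tuple_list.simps by (rule PF_const)
  then show ?case by simp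
next
  case (Suc j)
  have "PF (\<lambda>W x. tuple_list el (Suc j) W x)"
    unfolding tuple_list.simps
    by (intro PF_cmap PF_pair PF_left PF_right PF_id PF_const Suc PF_comp[OF Suc.IH])
  then show ?case by simp
qed

lemma set_tuple_list:
  assumes "set (dlist (el W x)) = Atom ` X"
  shows "set (dlist (tuple_list el j W x)) = enc_tuple ` tuples j X"
proof (induction j)
  case 0
  have "tuples 0 X = {[]}" by (auto simp: tuples_def)
  then show ?case by simp
next
  case (Suc j)
  have "tuples (Suc j) X = (\<Union>a \<in> X. (\<lambda>v. a # v) ` tuples j X)"
    by (auto simp: tuples_def length_Suc_conv)
  then show ?case by (auto simp: set_cmap assms Suc image_UN image_image)
qed

lemma PF_form_list:
  assumes "PF f" shows "PF (\<lambda>W x. form_list fs (f W x))"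
proof (induction fs)
  case Nil
  then show ?case using PF_const[of Empty] by (simp add: form_list_def)
next
  case (Cons \<phi> fs)
  have "PF (\<lambda>W x. Node (Node (enc_form \<phi>) (f W x)) (form_list fs (f W x)))"
    by (intro PF_pair PF_const assms Cons)
  then show ?case by (simp add: form_list_def)
qed

end

context learner begin

text \<open>The formula is wired into the program, hence the arbitrary \<open>c\<close>; codes serve
  only to select among such programs later.\<close>

lemma evaluator_type_form:
  assumes "set \<tau>s \<subseteq> types"
  shows "\<exists>S. PP S \<and> (\<forall>W \<in> OK. \<forall>c. \<forall>v \<in> tuples l (univ (fst W)). \<forall>u \<in> tuples k (univ (fst W)).
    S W (Node (Node c (enc_tuple v)) (enc_tuple u)) \<longleftrightarrow> hyp P (fst W) (type_form \<tau>s) v (\<lambda>_. 0) u)"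
proof -
  have "\<exists>S. PP S \<and> (\<forall>W \<in> OK. \<forall>as \<in> tuples (k + l) (univ (fst W)).
    S W (enc_tuple (rev as)) \<longleftrightarrow> (\<exists>\<tau> \<in> set \<tau>s. iso_centred (nbhd_struct rad (fst W) as) \<tau>))"
    using assms
  proof (induction \<tau>s)
    case Nil
    show ?case by (intro exI[of _ "\<lambda>W x. False"] conjI PP_const) simp
  next
    case (Cons \<tau> \<tau>s)
    then obtain S where S: "PP S" "\<forall>W \<in> OK. \<forall>as \<in> tuples (k + l) (univ (fst W)).
      S W (enc_tuple (rev as)) \<longleftrightarrow> (\<exists>\<tau> \<in> set \<tau>s. iso_centred (nbhd_struct rad (fst W) as) \<tau>)" by auto
    have "\<tau> \<in> types" using Cons.prems by simp
    from PP_sphere[OF typesD[OF this]] obtain S' where S': "PP S'" "\<forall>W \<in> OK. \<forall>as \<in> tuples (k + l) (univ (fst W)).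
      S' W (enc_tuple (rev as)) \<longleftrightarrow> iso_centred (nbhd_struct rad (fst W) as) \<tau>" by auto
    show ?case by (intro exI[of _ "\<lambda>W x. S' W x \<or> S W x"] conjI PP_disj S(1) S'(1)) (use S(2) S'(2) in simp)
  qed
  then obtain S where S: "PP S" "\<forall>W \<in> OK. \<forall>as \<in> tuples (k + l) (univ (fst W)).
    S W (enc_tuple (rev as)) \<longleftrightarrow> (\<exists>\<tau> \<in> set \<tau>s. iso_centred (nbhd_struct rad (fst W) as) \<tau>)" by blast
  \<comment> \<open>Two reversals onto the stack produce the reverse of \<open>u @ v\<close>, the
    form that \<open>PP_sphere\<close> expects.\<close>
  let ?S = "\<lambda>W x. S W (revapp (right (left x)) (revapp (right x) Empty))"
  have "PP ?S" by (intro PP_comp[OF S(1)] PF_revapp PF_left PF_right PF_id PF_const)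
  moreover have "?S W (Node (Node c (enc_tuple v)) (enc_tuple u)) \<longleftrightarrow> hyp P (fst W) (type_form \<tau>s) v (\<lambda>_. 0) u"
    if "W \<in> OK" "v \<in> tuples l (univ (fst W))" "u \<in> tuples k (univ (fst W))" for W c v u
  proof -
    have "revapp (enc_tuple v) (revapp (enc_tuple u) Empty) = enc_tuple (rev (u @ v))"
      using revapp_enc_tuple[of u "[]"] revapp_enc_tuple[of v "rev u"] by simp
    moreover have "u @ v \<in> tuples (k + l) (univ (fst W))" using that by (auto simp: tuples_def)
    ultimately show ?thesis unfolding left.simps right.simps hyp_type_form[OF that(1) assms that(3,2)]
      using S(2) that(1) by metis
  qed
  ultimately show ?thesis by (intro exI[of _ ?S] conjI ballI allI)
qed

text \<open>No formula is interpreted. Its code is compared with the finitely many codes of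
  \<open>\<Phi>\<close>, and \<open>enc_form_inject\<close> ensures that the right evaluator is
  selected.\<close>

lemma evaluator_exists:
  "\<exists>E. PP E \<and> (\<forall>W \<in> OK. \<forall>\<phi> \<in> set \<Phi>. \<forall>v \<in> tuples l (univ (fst W)). \<forall>u \<in> tuples k (univ (fst W)).
    E W (Node (Node (enc_form \<phi>) (enc_tuple v)) (enc_tuple u)) \<longleftrightarrow> hyp P (fst W) \<phi> v (\<lambda>_. 0) u)"
proof -
  have "\<exists>E. PP E \<and> (\<forall>W \<in> OK. \<forall>\<phi> \<in> set fs. \<forall>v \<in> tuples l (univ (fst W)). \<forall>u \<in> tuples k (univ (fst W)).
    E W (Node (Node (enc_form \<phi>) (enc_tuple v)) (enc_tuple u)) \<longleftrightarrow> hyp P (fst W) \<phi> v (\<lambda>_. 0) u)"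
    if "set fs \<subseteq> set \<Phi>" for fs
    using that
  proof (induction fs)
    case Nil
    show ?case by (intro exI[of _ "\<lambda>W x. False"] conjI PP_const) simp
  next
    case (Cons \<phi> fs)
    then obtain E where E: "PP E" "\<forall>W \<in> OK. \<forall>\<phi> \<in> set fs. \<forall>v \<in> tuples l (univ (fst W)). \<forall>u \<in> tuples k (univ (fst W)).
      E W (Node (Node (enc_form \<phi>) (enc_tuple v)) (enc_tuple u)) \<longleftrightarrow> hyp P (fst W) \<phi> v (\<lambda>_. 0) u" by auto
    obtain \<tau>s where \<tau>s: "set \<tau>s \<subseteq> types" "\<phi> = type_form \<tau>s" using \<Phi>_mem[of \<phi>] Cons.prems by auto
    obtain S where S: "PP S" "\<forall>W \<in> OK. \<forall>c. \<forall>v \<in> tuples l (univ (fst W)). \<forall>u \<in> tuples k (univ (fst W)).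
      S W (Node (Node c (enc_tuple v)) (enc_tuple u)) \<longleftrightarrow> hyp P (fst W) \<phi> v (\<lambda>_. 0) u"
      using evaluator_type_form[OF \<tau>s(1)] \<tau>s(2) by blast
    have fo: "is_fo \<phi>" using is_fo_type_form[OF \<tau>s(1)] \<tau>s(2) by simp
    let ?E = "\<lambda>W x. (left (left x) = enc_form \<phi> \<and> S W x) \<or> (left (left x) \<noteq> enc_form \<phi> \<and> E W x)"
    have "PP ?E" by (intro PP_disj PP_conj PP_not PF_same PF_left PF_id PF_const S(1) E(1))
    moreover have "?E W (Node (Node (enc_form \<psi>) (enc_tuple v)) (enc_tuple u)) \<longleftrightarrow> hyp P (fst W) \<psi> v (\<lambda>_. 0) u"
      if "W \<in> OK" "\<psi> \<in> set (\<phi> # fs)" "v \<in> tuples l (univ (fst W))" "u \<in> tuples k (univ (fst W))" for W \<psi> v u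
    proof (cases "\<psi> = \<phi>")
      case True
      then show ?thesis using S(2) that by simp
    next
      case False
      then have "enc_form \<psi> \<noteq> enc_form \<phi>" using enc_form_inject[OF fo] by metis
      then show ?thesis using E(2) that False by simp
    qed
    ultimately show ?case by (intro exI[of _ ?E] conjI ballI)
  qed
  from this[of \<Phi>] show ?thesis by simp
qed

lemma learner_exists:
  "\<exists>f. PF f \<and> (\<forall>W \<in> OK. \<forall>T \<in> lists (examples k (fst W)). \<exists>\<phi> \<in> set \<Phi>. \<exists>v \<in> tuples l (univ (fst W)).
    f W (enc_sample T) = Node (enc_form \<phi>) (enc_tuple v) \<and>
    (\<forall>\<phi>' \<in> set \<Phi>. \<forall>v' \<in> tuples l (near_elems (fst W) T).
      mistakes (hyp P (fst W) \<phi> v (\<lambda>_. 0)) T \<le> mistakes (hyp P (fst W) \<phi>' v' (\<lambda>_. 0)) T))"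
proof -
  obtain E where E: "PP E" "\<forall>W \<in> OK. \<forall>\<phi> \<in> set \<Phi>. \<forall>v \<in> tuples l (univ (fst W)). \<forall>u \<in> tuples k (univ (fst W)).
    E W (Node (Node (enc_form \<phi>) (enc_tuple v)) (enc_tuple u)) \<longleftrightarrow> hyp P (fst W) \<phi> v (\<lambda>_. 0) u"
    using evaluator_exists by blast
  \<comment> \<open>The default element, and the balls around all entries of all examples with the
    radius from \<open>far_parameters\<close>.\<close>
  define el where "el = (\<lambda>W x. Node (Atom 0) (cmap (\<lambda>W y. nlist (l * (2 * rad + 1)) W (left (right y))) W x (dlist x)))"
  define cand where "cand = (\<lambda>W x. cmap (\<lambda>W z. form_list \<Phi> (right z)) W x (dlist (tuple_list el l W x)))"
  define wrong where "wrong = (\<lambda>W z. enc_bool (E W (Node (right (left z)) (left (right z)))) \<noteq> right (right z))"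
  define score where "score = (\<lambda>W y. foldl (\<lambda>acc e. if wrong W (Node y e) then Node Empty acc else acc) Empty (dlist (left y)))"
  define better where "better = (\<lambda>W z. length (dlist (score W (Node (left z) (left (right z))))) <
    length (dlist (score W (Node (left z) (right (right z))))))"
  \<comment> \<open>The search needs a start value that is itself a legal hypothesis.\<close>
  define c0 where "c0 = Node (enc_form (hd \<Phi>)) (enc_tuple (replicate l 0))"
  define f where "f = (\<lambda>W x. foldl (\<lambda>acc e. if better W (Node x (Node e acc)) then e else acc) c0 (dlist (cand W x)))"
  have "PF el" unfolding el_def by (intro PF_pair PF_const PF_cmap PF_comp[OF PF_nlist] PF_left PF_right PF_id)
  then have "PF cand" unfolding cand_def by (intro PF_cmap PF_form_list PF_tuple_list PF_right PF_id)
  have "PP wrong" unfolding wrong_def by (intro PP_not PF_same PP_comp[OF E(1)] PF_pair PF_left PF_right PF_id)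
  then have "PF score" unfolding score_def by (intro PF_count PF_left PF_id)
  then have "PP better"
    unfolding better_def by (intro PP_shorter PF_comp[OF \<open>PF score\<close>] PF_pair PF_left PF_right PF_id)
  then have "PF f" unfolding f_def by (intro PF_select PF_const \<open>PF cand\<close>)
  moreover have "\<exists>\<phi> \<in> set \<Phi>. \<exists>v \<in> tuples l (univ (fst W)). f W (enc_sample T) = Node (enc_form \<phi>) (enc_tuple v) \<and>
      (\<forall>\<phi>' \<in> set \<Phi>. \<forall>v' \<in> tuples l (near_elems (fst W) T).
        mistakes (hyp P (fst W) \<phi> v (\<lambda>_. 0)) T \<le> mistakes (hyp P (fst W) \<phi>' v' (\<lambda>_. 0)) T)"
    if W: "W \<in> OK" and T: "T \<in> lists (examples k (fst W))" for W T
  proof -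
    let ?x = "enc_sample T"
    have T': "set u \<subseteq> univ (fst W)" "u \<in> tuples k (univ (fst W))" if "(u, c) \<in> set T" for u c
      using T that by (auto simp: examples_def tuples_def)
    have "set (dlist (nlist (l * (2 * rad + 1)) W (enc_tuple u))) = Atom ` gball (fst W) (l * (2 * rad + 1)) (set u)"
      if "(u, c) \<in> set T" for u c
      by (rule set_nlist[OF W _ T'(1)[OF that]]) simp
    then have "set (dlist (el W ?x)) = insert (Atom 0) (\<Union>(u, c) \<in> set T. Atom ` gball (fst W) (l * (2 * rad + 1)) (set u))"
      unfolding el_def by (auto simp: set_cmap dlist_enc_sample split: prod.splits)
    also have "\<dots> = Atom ` near_elems (fst W) T"
      by (auto simp: near_elems_def gball_def)
    finally have "set (dlist (tuple_list el l W ?x)) = enc_tuple ` tuples l (near_elems (fst W) T)"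
      by (rule set_tuple_list)
    then have cand: "set (dlist (cand W ?x)) = (\<Union>v \<in> tuples l (near_elems (fst W) T). (\<lambda>\<phi>. Node (enc_form \<phi>) (enc_tuple v)) ` set \<Phi>)"
      unfolding cand_def by (simp add: set_cmap dlist_form_list)
    have nearU: "tuples l (near_elems (fst W) T) \<subseteq> tuples l (univ (fst W))"
      using OKD(7)[OF W] gball_subset[of "fst W"] by (auto simp: near_elems_def tuples_def)
    have score: "length (dlist (score W (Node ?x (Node (enc_form \<phi>) (enc_tuple v))))) = mistakes (hyp P (fst W) \<phi> v (\<lambda>_. 0)) T"
      if "\<phi> \<in> set \<Phi>" "v \<in> tuples l (univ (fst W))" for \<phi> v
    proof -
      let ?y = "Node ?x (Node (enc_form \<phi>) (enc_tuple v))"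
      have "length (dlist (score W ?y)) = length (filter (\<lambda>e. wrong W (Node ?y e)) (map (\<lambda>(u, c). Node (enc_tuple u) (enc_bool c)) T))"
        unfolding score_def length_foldl_count by (simp add: dlist_enc_sample)
      also have "\<dots> = length (filter (\<lambda>(u, c). wrong W (Node ?y (Node (enc_tuple u) (enc_bool c)))) T)"
        by (simp add: filter_map comp_def case_prod_unfold)
      also have "filter (\<lambda>(u, c). wrong W (Node ?y (Node (enc_tuple u) (enc_bool c)))) T =
          filter (\<lambda>(u, c). hyp P (fst W) \<phi> v (\<lambda>_. 0) u \<noteq> c) T"
      proof (rule filter_cong[OF refl])
        fix e assume "e \<in> set T"
        moreover obtain u c where "e = (u, c)" by (cases e)
        ultimately have e: "e = (u, c)" "(u, c) \<in> set T" by simp_all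
        have "E W (Node (Node (enc_form \<phi>) (enc_tuple v)) (enc_tuple u)) \<longleftrightarrow> hyp P (fst W) \<phi> v (\<lambda>_. 0) u"
          using E(2) W that T'(2)[OF e(2)] by blast
        then show "(case e of (u, c) \<Rightarrow> wrong W (Node ?y (Node (enc_tuple u) (enc_bool c)))) =
            (case e of (u, c) \<Rightarrow> hyp P (fst W) \<phi> v (\<lambda>_. 0) u \<noteq> c)"
          by (simp add: e wrong_def)
      qed
      finally show ?thesis by (simp add: mistakes_def)
    qed
    let ?sc = "\<lambda>e. length (dlist (score W (Node ?x e)))"
    have f: "f W ?x = foldl (\<lambda>acc e. if ?sc e < ?sc acc then e else acc) c0 (dlist (cand W ?x))"
      by (simp add: f_def better_def)
    have "hd \<Phi> \<in> set \<Phi>" using \<Phi>_not_Nil by simp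
    moreover have "replicate l 0 \<in> tuples l (univ (fst W))" using OKD(7)[OF W] by (auto simp: tuples_def)
    moreover have "f W ?x \<in> insert c0 (set (dlist (cand W ?x)))" unfolding f by (rule foldl_if_elem)
    ultimately obtain \<phi> v where \<phi>v: "\<phi> \<in> set \<Phi>" "v \<in> tuples l (univ (fst W))" "f W ?x = Node (enc_form \<phi>) (enc_tuple v)"
      using nearU unfolding cand c0_def by blast
    have "mistakes (hyp P (fst W) \<phi> v (\<lambda>_. 0)) T \<le> mistakes (hyp P (fst W) \<phi>' v' (\<lambda>_. 0)) T"
      if "\<phi>' \<in> set \<Phi>" "v' \<in> tuples l (near_elems (fst W) T)" for \<phi>' v'
    proof -
      have "Node (enc_form \<phi>') (enc_tuple v') \<in> insert c0 (set (dlist (cand W ?x)))"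
        using that unfolding cand by blast
      from foldl_if_best[OF this, of ?sc] have "?sc (f W ?x) \<le> ?sc (Node (enc_form \<phi>') (enc_tuple v'))"
        unfolding f .
      then show ?thesis unfolding \<phi>v(3) using score[OF \<phi>v(1,2)] score[OF that(1)] that(2) nearU by auto
    qed
    with \<phi>v show ?thesis by blast
  qed
  ultimately show ?thesis by (intro exI[of _ f] conjI ballI)
qed

end

lemma (in worlds) PF_computes:
  assumes "PF f"
  shows "\<exists>p c. \<forall>W \<in> OK. \<forall>x. \<exists>t. computes (fst W) (snd W) p x (f W x) t \<and> t \<le> sz W x ^ c"
proof -
  obtain p n T where T: "pb T" and p: "computed_by p n T f" using assms by (auto simp: PF_def)
  obtain c where c: "\<forall>W \<in> OK. \<forall>x. T W x \<le> sz W x ^ c" using T by (auto simp: pb_def)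
  have "\<exists>t. computes (fst W) (snd W) p x (f W x) t \<and> t \<le> sz W x ^ c" if W: "W \<in> OK" for W x
  proof -
    obtain t m where "exec (fst W) (snd W) p ((\<lambda>_. Empty)(0 := x)) t m" "m 0 = f W x" "t \<le> T W x"
      by (rule computed_byE[OF p W, of "(\<lambda>_. Empty)(0 := x)" x]) (simp, rule that)
    then show ?thesis using c W order_trans unfolding computes_def by blast
  qed
  then show ?thesis by blast
qed

lemma computes_unique: "computes B nb p x y t \<Longrightarrow> computes B nb p x y' t' \<Longrightarrow> y = y' \<and> t = t'"
  unfolding computes_def using exec_deterministic by blast

lemma mistakes_cong: "(\<And>u c. (u, c) \<in> set T \<Longrightarrow> H u = H' u) \<Longrightarrow> mistakes H T = mistakes H' T"
  unfolding mistakes_def by (rule arg_cong[where f = length], rule filter_cong) auto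

lemma err_cong:
  assumes "set_pmf D \<subseteq> examples k B" "\<And>u. u \<in> tuples k (univ B) \<Longrightarrow> H u = H' u"
  shows "err D H = err D H'"
proof -
  have "{(u, c). H u \<noteq> c} \<inter> set_pmf D = {(u, c). H' u \<noteq> c} \<inter> set_pmf D"
    using assms by (auto simp: examples_def)
  then show ?thesis unfolding err_def by (metis measure_Int_set_pmf)
qed

lemma card_tuples: "finite X \<Longrightarrow> card (tuples j X) = card X ^ j"
  using card_lists_length_eq[of X j] by (simp add: tuples_def conj_commute)

lemma sample_bound_pos:
  assumes "0 < s" "0 < \<epsilon>" "0 < \<delta>" "\<delta> < 1" "1 \<le> card (univ B)"
  shows "0 < sample_bound s B \<epsilon> \<delta>"
proof -
  have "\<delta> < real (card (univ B))" using assms(4,5) by linarith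
  then have "1 < real (card (univ B)) / \<delta>" using assms(3) by simp
  then have "0 < log 2 (real (card (univ B)) / \<delta>) / \<epsilon>\<^sup>2" using assms(2) by simp
  then show ?thesis using assms(1) by (simp add: sample_bound_def)
qed

section \<open>Generalisation and running time of the learner\<close>

context learner begin

text \<open>Minimality is demanded only against parameters near the sample, while \<open>v\<close>
  may be any tuple of the universe. Being a relation, it lets the analysis cover every such output,
  however ties are broken and neighbours are listed.\<close>

definition ERM :: "fin_struct \<Rightarrow> (nat list \<times> bool) list \<Rightarrow> 'p form \<Rightarrow> nat list \<Rightarrow> bool" where
  "ERM B T \<phi> v \<longleftrightarrow> \<phi> \<in> set \<Phi> \<and> v \<in> tuples l (univ B) \<and> T \<in> lists (examples k B) \<and>
    (\<forall>\<phi>' \<in> set \<Phi>. \<forall>v' \<in> tuples l (near_elems B T).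
      mistakes (hyp P B \<phi> v (\<lambda>_. 0)) T \<le> mistakes (hyp P B \<phi>' v' (\<lambda>_. 0)) T)"

text \<open>Makes the set of concepts nonempty, so that their minimal error exists, and supplies the
  rivals in the majority vote. \<open>Truth\<close> has rank and width 0, so this holds even for
  \<open>r = w = 0\<close>.\<close>

lemma constant_concepts:
  assumes W: "W \<in> OK"
  shows "(\<lambda>_. b) \<in> concepts P \<sigma> k l r w (fst W)"
proof -
  let ?\<phi> = "if b then Truth else Neg Truth :: 'p form"
  have "(\<lambda>_. b) = hyp P (fst W) ?\<phi> (replicate l 0) (\<lambda>_. 0)" by (auto simp: hyp_def)
  moreover have "replicate l 0 \<in> tuples l (univ (fst W))" using OKD(7)[OF W] by (auto simp: tuples_def)
  moreover have "wf_form P \<sigma> ?\<phi>" "fv_form ?\<phi> \<subseteq> {..<k + l}" "bw_form ?\<phi> \<le> w" "br_form ?\<phi> \<le> r"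
    by (simp_all add: bw_form_def)
  ultimately show ?thesis unfolding concepts_def by blast
qed

text \<open>There may be infinitely many formulas, but an error depends only on the restriction to
  \<open>k\<close>-tuples over the finite universe. Thus \<open>Min\<close> is a true
  minimum.\<close>

lemma finite_err_concepts:
  assumes W: "W \<in> OK" and D: "set_pmf D \<subseteq> examples k (fst W)"
  shows "finite (err D ` concepts P \<sigma> k l r w (fst W))"
proof (rule finite_subset)
  show "err D ` concepts P \<sigma> k l r w (fst W) \<subseteq> (\<lambda>S. err D (\<lambda>u. u \<in> S)) ` Pow (tuples k (univ (fst W)))"
  proof
    fix e assume "e \<in> err D ` concepts P \<sigma> k l r w (fst W)"
    then obtain C where e: "e = err D C" by blast
    have "err D C = err D (\<lambda>u. u \<in> {u \<in> tuples k (univ (fst W)). C u})" by (rule err_cong[OF D]) simp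
    then show "e \<in> (\<lambda>S. err D (\<lambda>u. u \<in> S)) ` Pow (tuples k (univ (fst W)))" unfolding e by blast
  qed
  show "finite ((\<lambda>S. err D (\<lambda>u. u \<in> S)) ` Pow (tuples k (univ (fst W))))"
    using finite_tuples[OF OKD(5)[OF W]] by simp
qed

text \<open>On the sample the concept coincides with a hypothesis that has near parameters, and
  against those the output is minimal.\<close>

lemma ERM_le_concept:
  assumes W: "W \<in> OK" and erm: "ERM (fst W) T \<phi> v" and C: "C \<in> concepts P \<sigma> k l r w (fst W)"
  shows "mistakes (hyp P (fst W) \<phi> v (\<lambda>_. 0)) T \<le> mistakes C T"
proof -
  have T: "T \<in> lists (examples k (fst W))" using erm by (simp add: ERM_def)
  from concept_realised(2)[OF W C T] obtain \<phi>' v' where *: "\<phi>' \<in> set \<Phi>" "v' \<in> tuples l (near_elems (fst W) T)"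
    "\<forall>(u, c) \<in> set T. hyp P (fst W) \<phi>' v' (\<lambda>_. 0) u = C u" by blast
  have "mistakes (hyp P (fst W) \<phi>' v' (\<lambda>_. 0)) T = mistakes C T" by (rule mistakes_cong) (use *(3) in auto)
  then show ?thesis using erm *(1,2) unfolding ERM_def by metis
qed

lemma generalisation:
  "\<exists>s. \<forall>W \<in> OK. \<forall>\<epsilon> \<delta> D t. 0 < \<epsilon> \<and> \<epsilon> < 1 \<and> 0 < \<delta> \<and> \<delta> < 1 \<and> set_pmf D \<subseteq> examples k (fst W) \<and>
    sample_bound s (fst W) \<epsilon> \<delta> \<le> t \<longrightarrow>
    1 - \<delta> \<le> measure_pmf.prob (replicate_pmf t D) {T. \<forall>\<phi> v. ERM (fst W) T \<phi> v \<longrightarrow>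
      err D (hyp P (fst W) \<phi> v (\<lambda>_. 0)) - Min (err D ` concepts P \<sigma> k l r w (fst W)) \<le> \<epsilon>}"
proof -
  obtain s where s: "0 < s" and size: "\<And>(B :: fin_struct) \<epsilon> \<delta> t N. 0 < \<epsilon> \<Longrightarrow> \<epsilon> < 1 \<Longrightarrow> 0 < \<delta> \<Longrightarrow> \<delta> < 1 \<Longrightarrow>
    sample_bound s B \<epsilon> \<delta> \<le> t \<Longrightarrow> 1 \<le> card (univ B) \<Longrightarrow> 2 \<le> card (univ B) \<or> \<delta> \<le> 3 / 4 \<Longrightarrow>
    real N \<le> real (length \<Phi>) * real (card (univ B)) ^ l \<Longrightarrow> 2 * real N * exp (- real t * \<epsilon>\<^sup>2 / 2) \<le> \<delta>"
    using sample_size[of "length \<Phi>" l] by blast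
  show ?thesis
  proof (intro exI[of _ s] ballI allI impI, elim conjE)
    fix W \<epsilon> \<delta> D t
    assume W: "W \<in> OK" and eps: "0 < \<epsilon>" "\<epsilon> < 1" and del: "0 < \<delta>" "\<delta> < 1"
      and D: "set_pmf D \<subseteq> examples k (fst W)" and t: "sample_bound s (fst W) \<epsilon> \<delta> \<le> t"
    let ?M = "replicate_pmf t D"
    let ?C = "concepts P \<sigma> k l r w (fst W)"
    let ?h = "\<lambda>\<phi> v. hyp P (fst W) \<phi> v (\<lambda>_. 0)"
    let ?good = "{T. \<forall>\<phi> v. ERM (fst W) T \<phi> v \<longrightarrow> err D (?h \<phi> v) - Min (err D ` ?C) \<le> \<epsilon>}"
    have fin: "finite (err D ` ?C)" by (rule finite_err_concepts[OF W D])
    have ne: "err D ` ?C \<noteq> {}" using constant_concepts[OF W] by blast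
    have card1: "1 \<le> card (univ (fst W))" using OKD(2,5)[OF W] by (simp add: Suc_leI card_gt_0_iff)
    have t0: "0 < t" using sample_bound_pos[OF s eps(1) del card1] t by simp
    show "1 - \<delta> \<le> measure_pmf.prob ?M ?good"
    proof (cases "2 \<le> card (univ (fst W)) \<or> \<delta> \<le> 3 / 4")
      case True
      define Hs where "Hs = (\<lambda>(\<phi>, v). ?h \<phi> v) ` (set \<Phi> \<times> tuples l (univ (fst W)))"
      have finT: "finite (tuples l (univ (fst W)))" by (rule finite_tuples[OF OKD(5)[OF W]])
      have finHs: "finite Hs" using finT by (simp add: Hs_def)
      have "card Hs \<le> card (set \<Phi>) * card (univ (fst W)) ^ l"
        unfolding Hs_def using card_image_le[of "set \<Phi> \<times> tuples l (univ (fst W))"] finT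
        by (simp add: card_cartesian_product card_tuples[OF OKD(5)[OF W]])
      also have "\<dots> \<le> length \<Phi> * card (univ (fst W)) ^ l" by (intro mult_right_mono card_length) simp
      finally have "real (card Hs) \<le> real (length \<Phi>) * real (card (univ (fst W))) ^ l"
        by (simp flip: of_nat_power of_nat_mult)
      from uniform_convergence[OF finHs eps(1) t0 size[OF eps del t card1 True this]]
      have "1 - \<delta> \<le> measure_pmf.prob ?M
        {T. \<forall>h \<in> Hs. \<forall>h' \<in> Hs. mistakes h T \<le> mistakes h' T \<longrightarrow> err D h \<le> err D h' + \<epsilon>}" .
      also have "\<dots> \<le> measure_pmf.prob ?M ?good"
      proof (intro measure_pmf.finite_measure_mono subsetI)
        fix T assume T: "T \<in> {T. \<forall>h \<in> Hs. \<forall>h' \<in> Hs. mistakes h T \<le> mistakes h' T \<longrightarrow> err D h \<le> err D h' + \<epsilon>}"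
        have "err D (?h \<phi> v) - Min (err D ` ?C) \<le> \<epsilon>" if erm: "ERM (fst W) T \<phi> v" for \<phi> v
        proof -
          \<comment> \<open>The output makes no more mistakes than the best concept
            \<open>C\<close>, which agrees on all \<open>k\<close>-tuples with a member of
            \<open>Hs\<close>; uniform convergence then compares two members of
            \<open>Hs\<close>.\<close>
          obtain C where C: "C \<in> ?C" "err D C = Min (err D ` ?C)" using Min_in[OF fin ne] by auto
          from concept_realised(1)[OF W C(1)] obtain \<phi>' v' where *: "\<phi>' \<in> set \<Phi>" "v' \<in> tuples l (univ (fst W))"
            "\<forall>u \<in> tuples k (univ (fst W)). ?h \<phi>' v' u = C u" by blast
          have "T \<in> lists (examples k (fst W))" using erm by (simp add: ERM_def)
          then have "mistakes (?h \<phi>' v') T = mistakes C T"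
            by (intro mistakes_cong) (use *(3) in \<open>auto simp: examples_def\<close>)
          then have "mistakes (?h \<phi> v) T \<le> mistakes (?h \<phi>' v') T" using ERM_le_concept[OF W erm C(1)] by simp
          moreover have "?h \<phi> v \<in> Hs" "?h \<phi>' v' \<in> Hs" using erm * by (auto simp: Hs_def ERM_def)
          ultimately have "err D (?h \<phi> v) \<le> err D (?h \<phi>' v') + \<epsilon>" using T by blast
          also have "err D (?h \<phi>' v') = err D C" by (rule err_cong[OF D]) (use *(3) in blast)
          finally show ?thesis using C(2) by simp
        qed
        then show "T \<in> ?good" by blast
      qed simp
      finally show ?thesis .
    next
      case False
      then have N1: "card (univ (fst W)) = 1" and d34: "3 / 4 < \<delta>" using card1 by auto
      then have U: "univ (fst W) = {0}" using OKD(3)[OF W] by auto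
      \<comment> \<open>Over one element there is a single \<open>k\<close>-tuple, so a hypothesis
        amounts to one label.\<close>
      have single: "u = replicate k 0" if "u \<in> tuples k (univ (fst W))" for u
        using that U by (auto simp: tuples_def intro!: replicate_eqI)
      have compl: "measure_pmf.prob D {(u, c). c \<noteq> b} = 1 - measure_pmf.prob D {(u, c). c = b}" for b
      proof -
        have "{(u, c). c \<noteq> b} = UNIV - {(u :: nat list, c). c = b}" by auto
        then show ?thesis using measure_pmf.prob_compl[of "{(u, c). c = b}" D] by simp
      qed
      have "{(u :: nat list, c). c \<noteq> True} = {(u, c). c = False}" by auto
      then have "1 / 2 \<le> measure_pmf.prob D {(u, c). c = True} \<or> 1 / 2 \<le> measure_pmf.prob D {(u, c). c = False}"
        using compl[of True] by (simp only:) linarith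
      then obtain b where b: "1 / 2 \<le> measure_pmf.prob D {(u, c). c = b}" by blast
      have "1 - \<delta> \<le> 1 / 4" using d34 by simp
      also have "1 / 4 \<le> measure_pmf.prob ?M {T. length (filter (\<lambda>x. \<not> snd x = b) T) < length (filter (\<lambda>x. snd x = b) T)}"
        by (rule majority[OF _ t0]) (use b in \<open>simp add: case_prod_unfold\<close>)
      also have "\<dots> \<le> measure_pmf.prob ?M ?good"
      proof (intro measure_pmf.finite_measure_mono subsetI)
        fix T :: "(nat list \<times> bool) list"
        assume "T \<in> {T. length (filter (\<lambda>x. \<not> snd x = b) T) < length (filter (\<lambda>x. snd x = b) T)}"
        then have maj: "length (filter (\<lambda>x. snd x \<noteq> b) T) < length (filter (\<lambda>x. snd x = b) T)" by simp
        have "err D (?h \<phi> v) - Min (err D ` ?C) \<le> \<epsilon>" if erm: "ERM (fst W) T \<phi> v" for \<phi> v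
        proof -
          have T: "T \<in> lists (examples k (fst W))" using erm by (simp add: ERM_def)
          have mist: "mistakes H T = length (filter (\<lambda>x. snd x \<noteq> H (replicate k 0)) T)" for H
            unfolding mistakes_def
            by (rule arg_cong[where f = length], rule filter_cong)
              (use T single in \<open>auto simp: examples_def in_lists_conv_set\<close>)
          \<comment> \<open>Otherwise the constant concept \<open>b\<close> would make fewer
            mistakes than the output.\<close>
          have hb: "?h \<phi> v (replicate k 0) = b"
          proof (rule ccontr)
            assume "?h \<phi> v (replicate k 0) \<noteq> b"
            then have "mistakes (?h \<phi> v) T = length (filter (\<lambda>x. snd x = b) T)" unfolding mist
              by (intro arg_cong[where f = length] filter_cong) auto
            moreover have "mistakes (\<lambda>_. b) T = length (filter (\<lambda>x. snd x \<noteq> b) T)" unfolding mist ..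
            ultimately show False using ERM_le_concept[OF W erm constant_concepts[OF W, of b]] maj by simp
          qed
          have e: "err D H = measure_pmf.prob D {(u, c). c \<noteq> H (replicate k 0)}" for H
          proof -
            have "err D H = err D (\<lambda>_. H (replicate k 0))" by (rule err_cong[OF D]) (use single in auto)
            also have "{(u :: nat list, c). H (replicate k 0) \<noteq> c} = {(u, c). c \<noteq> H (replicate k 0)}" by auto
            then have "err D (\<lambda>_. H (replicate k 0)) = measure_pmf.prob D {(u, c). c \<noteq> H (replicate k 0)}"
              by (simp only: err_def)
            finally show ?thesis .
          qed
          \<comment> \<open>The label \<open>b\<close> has probability at least 1/2, so the output
            is optimal, not merely within \<open>\<epsilon>\<close>.\<close>
          have "err D (?h \<phi> v) \<le> err D C" for C
          proof (cases "C (replicate k 0) = b")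
            case False
            then have "{(u :: nat list, c). c \<noteq> C (replicate k 0)} = {(u, c). c = b}" by auto
            then show ?thesis unfolding e hb using compl[of b] b by simp
          qed (simp add: e hb)
          then have "err D (?h \<phi> v) \<le> Min (err D ` ?C)" by (intro Min.boundedI fin ne) auto
          then show ?thesis using eps by simp
        qed
        then show "T \<in> ?good" by blast
      qed simp
      finally show ?thesis .
    qed
  qed
qed

lemma sz_sample:
  assumes W: "W \<in> OK" and T: "T \<in> lists (examples k (fst W))"
  shows "sz W (enc_sample T) \<le> bits W * (2 + length T * (6 + k))"
proof -
  have b: "bits W \<ge> 2" by (rule bits_ge)
  \<comment> \<open>Per example, a list node, a pair node, the end of the tuple and at most 3 for
    the label make 6; each entry of the tuple costs at most \<open>bits W\<close>.\<close>
  have "dsize (enc_sample T) \<le> 1 + length T * (6 + k * bits W)"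
    using T
  proof (induction T rule: lists.induct)
    case Nil
    then show ?case by (simp add: enc_sample_def enc_list_def)
  next
    case (Cons e T)
    obtain u c where e: "e = (u, c)" by (cases e)
    have u: "length u = k" "set u \<subseteq> univ (fst W)" using Cons(1) by (auto simp: e examples_def tuples_def)
    have "a < card (univ (fst W))" if "a \<in> set u" for a
      using u(2) that OKD(3)[OF W] by (metis lessThan_iff subsetD)
    then have "dsize (enc_tuple u) \<le> 1 + k * bits W"
      using dsize_enc_tuple[of u "card (univ (fst W))"] u(1) by (simp add: bits_def)
    then have "dsize (enc_sample (e # T)) \<le> 6 + k * bits W + dsize (enc_sample T)"
      using dsize_enc_bool[of c] by (simp add: enc_sample_def enc_list_def e)
    then show ?case using Cons(3) by simp
  qed
  moreover have "bits W + (1 + length T * (6 + k * bits W)) \<le> bits W * (2 + length T * (6 + k))"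
  proof -
    have "length T * (6 + k * bits W) \<le> length T * (bits W * (6 + k))"
      using b by (intro mult_left_mono) (auto simp: algebra_simps)
    moreover have "bits W * (2 + length T * (6 + k)) = 2 * bits W + length T * (bits W * (6 + k))"
      by (simp only: distrib_left mult.commute mult.left_commute)
    ultimately show ?thesis using b by linarith
  qed
  ultimately show ?thesis by (simp add: sz_def)
qed

lemma bits_le:
  assumes W: "W \<in> OK"
  shows "real (bits W) \<le> 3 * (1 + log 2 (real (card (univ (fst W)))))" "0 \<le> log 2 (real (card (univ (fst W))))"
proof -
  have c: "1 \<le> card (univ (fst W))" using OKD(2,5)[OF W] by (simp add: Suc_leI card_gt_0_iff)
  then show l: "0 \<le> log 2 (real (card (univ (fst W))))" by simp
  have "real (bits W) \<le> 3 + log 2 (real (card (univ (fst W))))"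
    using c l by (simp add: bits_def floorlog_def)
  then show "real (bits W) \<le> 3 * (1 + log 2 (real (card (univ (fst W)))))" using l by simp
qed

text \<open>\<open>X\<close> is at least 1 because of 1/\<epsilon>. The degree 4 consists of one
  factor for the length of names, one for log(n/\<delta>) and two for the squared
  1/\<epsilon>.\<close>

lemma sample_time:
  assumes W: "W \<in> OK" and T: "T \<in> lists (examples k (fst W))"
    and eps: "0 < \<epsilon>" "\<epsilon> < 1" and del: "0 < \<delta>" "\<delta> < 1" and len: "length T = sample_bound s (fst W) \<epsilon> \<delta>"
    and X: "X = log 2 (real (card (univ (fst W)))) + 1 / \<epsilon> + log 2 (1 / \<delta>)"
  shows "1 \<le> X" "real (sz W (enc_sample T)) \<le> real (6 + 6 * s * (6 + k)) * X ^ 4"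
proof -
  define L where "L = log 2 (real (card (univ (fst W))))"
  have L: "0 \<le> L" "real (bits W) \<le> 3 * (1 + L)" using bits_le[OF W] by (simp_all add: L_def)
  have d: "0 \<le> log 2 (1 / \<delta>)" using del by simp
  have e: "1 \<le> 1 / \<epsilon>" using eps by simp
  define Y where "Y = 1 / \<epsilon>"
  define Z where "Z = log 2 (1 / \<delta>)"
  have YZ: "1 \<le> Y" "0 \<le> Z" using d e by (simp_all only: Y_def Z_def)
  have XL: "X = L + Y + Z" by (simp only: X L_def Y_def Z_def)
  show X1: "1 \<le> X" using L(1) YZ XL by linarith
  have bX: "real (bits W) \<le> 3 * X"
  proof -
    have "1 + L \<le> X" using YZ XL by linarith
    then show ?thesis using L(2) by simp
  qed
  have "card (univ (fst W)) > 0" using OKD(2,5)[OF W] by (simp add: card_gt_0_iff)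
  then have "log 2 (real (card (univ (fst W))) / \<delta>) = L + Z"
    using del by (simp add: L_def Z_def log_divide)
  then have "log 2 (real (card (univ (fst W))) / \<delta>) \<le> X" using YZ XL by linarith
  moreover have "1 / \<epsilon>\<^sup>2 \<le> X\<^sup>2"
  proof -
    have "Y\<^sup>2 \<le> X\<^sup>2" using L(1) YZ XL by (intro power_mono) linarith+
    then show ?thesis by (simp add: Y_def power_divide)
  qed
  ultimately have "log 2 (real (card (univ (fst W))) / \<delta>) * (1 / \<epsilon>\<^sup>2) \<le> X * X\<^sup>2"
    using X1 by (intro mult_mono) auto
  then have "log 2 (real (card (univ (fst W))) / \<delta>) / \<epsilon>\<^sup>2 \<le> X ^ 3" by (simp add: power3_eq_cube power2_eq_square)
  moreover have X3: "1 \<le> X ^ 3" using X1 by (rule one_le_power)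
  ultimately have "real (nat \<lceil>log 2 (real (card (univ (fst W))) / \<delta>) / \<epsilon>\<^sup>2\<rceil>) \<le> 2 * X ^ 3" by linarith
  then have lT: "real (length T) \<le> real s * (2 * X ^ 3)"
    unfolding len sample_bound_def of_nat_mult by (intro mult_left_mono) auto
  have "real (sz W (enc_sample T)) \<le> real (bits W * (2 + length T * (6 + k)))"
    using sz_sample[OF W T] by (simp only: of_nat_le_iff)
  also have "\<dots> = real (bits W) * (2 + real (length T) * real (6 + k))" by (simp add: distrib_left mult.commute)
  also have "\<dots> \<le> (3 * X) * (2 * X ^ 3 + real s * (2 * X ^ 3) * real (6 + k))"
    using bX lT X3 X1 by (intro mult_mono add_mono mult_right_mono) auto
  also have "\<dots> = real (6 + 6 * s * (6 + k)) * X ^ 4" by (simp add: power3_eq_cube power4_eq_xxxx algebra_simps)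
  finally show "real (sz W (enc_sample T)) \<le> real (6 + 6 * s * (6 + k)) * X ^ 4" .
qed

lemma sz_evaluation:
  assumes W: "W \<in> OK" and \<phi>: "\<phi> \<in> set \<Phi>" and v: "v \<in> tuples l (univ (fst W))" and u: "u \<in> tuples k (univ (fst W))"
  shows "sz W (Node (Node (enc_form \<phi>) (enc_tuple v)) (enc_tuple u)) \<le>
    bits W * (5 + sum_list (map (\<lambda>\<phi>. dsize (enc_form \<phi>)) \<Phi>) + l + k)"
proof -
  have tup: "dsize (enc_tuple us) \<le> 1 + j * bits W" if "us \<in> tuples j (univ (fst W))" for us j
  proof -
    have "a < card (univ (fst W))" if "a \<in> set us" for a
      using \<open>us \<in> _\<close> that OKD(3)[OF W] unfolding tuples_def by (metis (mono_tags) lessThan_iff mem_Collect_eq subsetD)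
    then show ?thesis using dsize_enc_tuple[of us "card (univ (fst W))"] that by (simp add: bits_def tuples_def)
  qed
  let ?S = "sum_list (map (\<lambda>\<phi>. dsize (enc_form \<phi>)) \<Phi>)"
  have "dsize (enc_form \<phi>) \<le> ?S" using \<phi> by (intro member_le_sum_list) auto
  moreover have "4 + ?S \<le> bits W * (4 + ?S)" using bits_ge[of W] by simp
  ultimately show ?thesis using tup[OF v] tup[OF u] by (simp add: sz_def algebra_simps)
qed

lemma poly_time:
  fixes X :: real
  assumes "t \<le> z ^ c1" "real z \<le> real A * X ^ e" "1 \<le> X" "A ^ c1 \<le> c" "e * c1 \<le> c"
  shows "real t \<le> real c * X ^ c"
proof -
  have "real t \<le> real z ^ c1" using assms(1) by (simp flip: of_nat_power)
  also have "\<dots> \<le> (real A * X ^ e) ^ c1" using assms(2) by (intro power_mono) auto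
  also have "\<dots> = real (A ^ c1) * X ^ (e * c1)" by (simp add: power_mult_distrib power_mult)
  also have "\<dots> \<le> real c * X ^ c"
    using assms(3-5) by (intro mult_mono power_increasing) auto
  finally show ?thesis .
qed

theorem learnable:
  "\<exists>(s :: nat) (alg :: com) (evaluator :: com) (c :: nat). \<forall>B nb.
    is_structure \<sigma> B \<and> univ B \<noteq> {} \<and> univ B = {..<card (univ B)} \<and>
    gaifman_degree B \<le> d \<and> neighbour_listing B nb \<longrightarrow>
      (\<forall>T \<in> lists (examples k B). \<exists>(\<phi> :: 'p form) v t. returns B nb alg T \<phi> v t \<and>
         sphere_comb P \<sigma> ((2 * w + 1) ^ r) {..<k + l} \<phi> \<and> v \<in> tuples l (univ B)) \<and>
      (\<forall>\<epsilon> \<delta> D t. 0 < \<epsilon> \<and> \<epsilon> < 1 \<and> 0 < \<delta> \<and> \<delta> < 1 \<and> set_pmf D \<subseteq> examples k B \<and>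
         t \<ge> sample_bound s B \<epsilon> \<delta> \<longrightarrow>
         measure_pmf.prob (replicate_pmf t D)
           {T. \<exists>(\<phi> :: 'p form) v n. returns B nb alg T \<phi> v n \<and>
              err D (hyp P B \<phi> v (\<lambda>_. 0)) - Min (err D ` concepts P \<sigma> k l r w B) \<le> \<epsilon>}
         \<ge> 1 - \<delta>) \<and>
      (\<forall>\<epsilon> \<delta>. \<forall>T \<in> lists (examples k B). 0 < \<epsilon> \<and> \<epsilon> < 1 \<and> 0 < \<delta> \<and> \<delta> < 1 \<and>
         length T = sample_bound s B \<epsilon> \<delta> \<longrightarrow>
         (\<exists>(\<phi> :: 'p form) v t. returns B nb alg T \<phi> v t \<and>
            real t \<le> real c * (log 2 (card (univ B)) + 1 / \<epsilon> + log 2 (1 / \<delta>)) ^ c)) \<and>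
      (\<forall>T \<in> lists (examples k B). \<forall>(\<phi> :: 'p form) v t. returns B nb alg T \<phi> v t \<longrightarrow>
         (\<forall>u \<in> tuples k (univ B). \<exists>n. evaluates B nb evaluator \<phi> v u (hyp P B \<phi> v (\<lambda>_. 0) u) n \<and>
            real n \<le> real c * (1 + log 2 (card (univ B))) ^ c))"
proof -
  obtain s where s: "\<forall>W \<in> OK. \<forall>\<epsilon> \<delta> D t. 0 < \<epsilon> \<and> \<epsilon> < 1 \<and> 0 < \<delta> \<and> \<delta> < 1 \<and> set_pmf D \<subseteq> examples k (fst W) \<and>
    sample_bound s (fst W) \<epsilon> \<delta> \<le> t \<longrightarrow>
    1 - \<delta> \<le> measure_pmf.prob (replicate_pmf t D) {T. \<forall>\<phi> v. ERM (fst W) T \<phi> v \<longrightarrow>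
      err D (hyp P (fst W) \<phi> v (\<lambda>_. 0)) - Min (err D ` concepts P \<sigma> k l r w (fst W)) \<le> \<epsilon>}"
    using generalisation by (elim exE)
  obtain f where f: "PF f" "\<forall>W \<in> OK. \<forall>T \<in> lists (examples k (fst W)). \<exists>\<phi> \<in> set \<Phi>. \<exists>v \<in> tuples l (univ (fst W)).
    f W (enc_sample T) = Node (enc_form \<phi>) (enc_tuple v) \<and>
    (\<forall>\<phi>' \<in> set \<Phi>. \<forall>v' \<in> tuples l (near_elems (fst W) T).
      mistakes (hyp P (fst W) \<phi> v (\<lambda>_. 0)) T \<le> mistakes (hyp P (fst W) \<phi>' v' (\<lambda>_. 0)) T)"
    using learner_exists by (elim exE conjE) (rule that)
  obtain alg c1 where alg: "\<forall>W \<in> OK. \<forall>x. \<exists>t. computes (fst W) (snd W) alg x (f W x) t \<and> t \<le> sz W x ^ c1"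
    using PF_computes[OF f(1)] by blast
  obtain E where E: "PP E" "\<forall>W \<in> OK. \<forall>\<phi> \<in> set \<Phi>. \<forall>v \<in> tuples l (univ (fst W)). \<forall>u \<in> tuples k (univ (fst W)).
    E W (Node (Node (enc_form \<phi>) (enc_tuple v)) (enc_tuple u)) \<longleftrightarrow> hyp P (fst W) \<phi> v (\<lambda>_. 0) u"
    using evaluator_exists by (elim exE conjE) (rule that)
  obtain evaluator c2 where ev: "\<forall>W \<in> OK. \<forall>x. \<exists>t. computes (fst W) (snd W) evaluator x (enc_bool (E W x)) t \<and> t \<le> sz W x ^ c2"
    using PF_computes[OF E(1)] by blast
  define A1 where "A1 = 6 + 6 * s * (6 + k)"
  define A2 where "A2 = 3 * (5 + sum_list (map (\<lambda>\<phi>. dsize (enc_form \<phi>)) \<Phi>) + l + k)"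
  \<comment> \<open>\<open>c\<close> acts as coefficient and as exponent. It dominates both for the
    learner, whose input size has degree 4, and for the evaluator, whose input size has degree
    1.\<close>
  define c where "c = A1 ^ c1 + 4 * c1 + A2 ^ c2 + c2"
  show ?thesis
  proof (rule exI[of _ s], rule exI[of _ alg], rule exI[of _ evaluator], rule exI[of _ c], intro allI impI)
    fix B nb
    assume "is_structure \<sigma> B \<and> univ B \<noteq> {} \<and> univ B = {..<card (univ B)} \<and> gaifman_degree B \<le> d \<and> neighbour_listing B nb"
    then have W: "(B, nb) \<in> OK" unfolding worlds_of_def mem_Collect_eq prod.case .
    have run: "\<exists>\<phi> v t. returns B nb alg T \<phi> v t \<and> ERM B T \<phi> v \<and> t \<le> sz (B, nb) (enc_sample T) ^ c1"
      if T: "T \<in> lists (examples k B)" for T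
    proof -
      obtain \<phi> v where "\<phi> \<in> set \<Phi>" "v \<in> tuples l (univ B)" "f (B, nb) (enc_sample T) = Node (enc_form \<phi>) (enc_tuple v)"
        "\<forall>\<phi>' \<in> set \<Phi>. \<forall>v' \<in> tuples l (near_elems B T).
          mistakes (hyp P B \<phi> v (\<lambda>_. 0)) T \<le> mistakes (hyp P B \<phi>' v' (\<lambda>_. 0)) T"
        using f(2)[rule_format, OF W, unfolded fst_conv, OF T] by blast
      moreover obtain t where "computes B nb alg (enc_sample T) (f (B, nb) (enc_sample T)) t" "t \<le> sz (B, nb) (enc_sample T) ^ c1"
        using alg[rule_format, OF W] unfolding fst_conv snd_conv by blast
      ultimately show ?thesis using T unfolding returns_def ERM_def by metis
    qed
    \<comment> \<open>The last claim concerns every formula that \<open>returns\<close> admits.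
      Determinism and the injectivity of codes of first-order formulas leave only the one found by
      \<open>run\<close>.\<close>
    have unique: "\<phi>' = \<phi> \<and> v' = v" if "returns B nb alg T \<phi> v t" "ERM B T \<phi> v" "returns B nb alg T \<phi>' v' t'" for T \<phi> v t v' t' and \<phi>' :: "'p form"
    proof -
      have eq: "enc_form \<phi> = enc_form \<phi>'" "enc_tuple v = enc_tuple v'"
        using computes_unique[OF that(1)[unfolded returns_def] that(3)[unfolded returns_def]] by simp_all
      have "is_fo \<phi>" using that(2) \<Phi>_mem[of \<phi>] is_fo_type_form unfolding ERM_def by blast
      then show ?thesis using enc_form_inject[OF _ eq(1)] eq(2) by simp
    qed
    show "(\<forall>T \<in> lists (examples k B). \<exists>(\<phi> :: 'p form) v t. returns B nb alg T \<phi> v t \<and>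
         sphere_comb P \<sigma> ((2 * w + 1) ^ r) {..<k + l} \<phi> \<and> v \<in> tuples l (univ B)) \<and>
      (\<forall>\<epsilon> \<delta> D t. 0 < \<epsilon> \<and> \<epsilon> < 1 \<and> 0 < \<delta> \<and> \<delta> < 1 \<and> set_pmf D \<subseteq> examples k B \<and>
         t \<ge> sample_bound s B \<epsilon> \<delta> \<longrightarrow>
         measure_pmf.prob (replicate_pmf t D)
           {T. \<exists>(\<phi> :: 'p form) v n. returns B nb alg T \<phi> v n \<and>
              err D (hyp P B \<phi> v (\<lambda>_. 0)) - Min (err D ` concepts P \<sigma> k l r w B) \<le> \<epsilon>}
         \<ge> 1 - \<delta>) \<and>
      (\<forall>\<epsilon> \<delta>. \<forall>T \<in> lists (examples k B). 0 < \<epsilon> \<and> \<epsilon> < 1 \<and> 0 < \<delta> \<and> \<delta> < 1 \<and>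
         length T = sample_bound s B \<epsilon> \<delta> \<longrightarrow>
         (\<exists>(\<phi> :: 'p form) v t. returns B nb alg T \<phi> v t \<and>
            real t \<le> real c * (log 2 (card (univ B)) + 1 / \<epsilon> + log 2 (1 / \<delta>)) ^ c)) \<and>
      (\<forall>T \<in> lists (examples k B). \<forall>(\<phi> :: 'p form) v t. returns B nb alg T \<phi> v t \<longrightarrow>
         (\<forall>u \<in> tuples k (univ B). \<exists>n. evaluates B nb evaluator \<phi> v u (hyp P B \<phi> v (\<lambda>_. 0) u) n \<and>
            real n \<le> real c * (1 + log 2 (card (univ B))) ^ c))"
    proof (intro conjI ballI allI impI; (elim conjE)?)
      fix T assume "T \<in> lists (examples k B)"
      from run[OF this] obtain \<phi> v t where "returns B nb alg T \<phi> v t" "ERM B T \<phi> v" by blast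
      moreover from this(2) have "sphere_comb P \<sigma> ((2 * w + 1) ^ r) {..<k + l} \<phi>" "v \<in> tuples l (univ B)"
        using \<Phi>_mem[of \<phi>] sphere_comb_type_form unfolding ERM_def by blast+
      ultimately show "\<exists>(\<phi> :: 'p form) v t. returns B nb alg T \<phi> v t \<and>
         sphere_comb P \<sigma> ((2 * w + 1) ^ r) {..<k + l} \<phi> \<and> v \<in> tuples l (univ B)" by blast
    next
      fix \<epsilon> \<delta> D t
      assume *: "0 < \<epsilon>" "\<epsilon> < 1" "0 < \<delta>" "\<delta> < 1" and D: "set_pmf D \<subseteq> examples k B" and t: "sample_bound s B \<epsilon> \<delta> \<le> t"
      let ?M = "replicate_pmf t D"
      let ?good = "{T. \<forall>\<phi> v. ERM B T \<phi> v \<longrightarrow> err D (hyp P B \<phi> v (\<lambda>_. 0)) - Min (err D ` concepts P \<sigma> k l r w B) \<le> \<epsilon>}"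
      have "1 - \<delta> \<le> measure_pmf.prob ?M ?good"
        using s[rule_format, OF W, unfolded fst_conv, of \<epsilon> \<delta> D t] * D t by blast
      \<comment> \<open>On the support, \<open>T\<close> is a list of genuine examples, for which
        the program is known to halt with a minimiser.\<close>
      also have "\<dots> = measure_pmf.prob ?M (?good \<inter> set_pmf ?M)" by (rule measure_Int_set_pmf[symmetric])
      also have "\<dots> \<le> measure_pmf.prob ?M {T. \<exists>(\<phi> :: 'p form) v n. returns B nb alg T \<phi> v n \<and>
              err D (hyp P B \<phi> v (\<lambda>_. 0)) - Min (err D ` concepts P \<sigma> k l r w B) \<le> \<epsilon>}"
      proof (intro measure_pmf.finite_measure_mono subsetI)
        fix T assume T: "T \<in> ?good \<inter> set_pmf ?M"
        then have "T \<in> lists (examples k B)" using D by (auto simp: set_replicate_pmf in_lists_conv_set)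
        from run[OF this] obtain \<phi> v n where "returns B nb alg T \<phi> v n" "ERM B T \<phi> v" by blast
        with T show "T \<in> {T. \<exists>(\<phi> :: 'p form) v n. returns B nb alg T \<phi> v n \<and>
              err D (hyp P B \<phi> v (\<lambda>_. 0)) - Min (err D ` concepts P \<sigma> k l r w B) \<le> \<epsilon>}" by blast
      qed simp
      finally show "1 - \<delta> \<le> measure_pmf.prob ?M {T. \<exists>(\<phi> :: 'p form) v n. returns B nb alg T \<phi> v n \<and>
              err D (hyp P B \<phi> v (\<lambda>_. 0)) - Min (err D ` concepts P \<sigma> k l r w B) \<le> \<epsilon>}" .
    next
      fix \<epsilon> \<delta> T
      assume T: "T \<in> lists (examples k B)" and *: "0 < \<epsilon>" "\<epsilon> < 1" "0 < \<delta>" "\<delta> < 1" "length T = sample_bound s B \<epsilon> \<delta>"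
      let ?X = "log 2 (card (univ B)) + 1 / \<epsilon> + log 2 (1 / \<delta>)"
      from run[OF T] obtain \<phi> :: "'p form" and v t where r: "returns B nb alg T \<phi> v t" "t \<le> sz (B, nb) (enc_sample T) ^ c1" by blast
      have "real t \<le> real c * ?X ^ c"
        by (rule poly_time[OF r(2) sample_time(2)[OF W, unfolded fst_conv, OF T *(1-5) refl, folded A1_def]
              sample_time(1)[OF W, unfolded fst_conv, OF T *(1-5) refl]]) (simp_all add: c_def)
      with r(1) show "\<exists>(\<phi> :: 'p form) v t. returns B nb alg T \<phi> v t \<and> real t \<le> real c * ?X ^ c" by blast
    next
      fix T v t u and \<phi> :: "'p form"
      assume T: "T \<in> lists (examples k B)" and ret: "returns B nb alg T \<phi> v t" and u: "u \<in> tuples k (univ B)"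
      from run[OF T] obtain \<phi>' v' t' where r: "returns B nb alg T \<phi>' v' t'" "ERM B T \<phi>' v'" by blast
      have "ERM B T \<phi> v" using unique[OF r ret] r(2) by simp
      then have \<phi>v: "\<phi> \<in> set \<Phi>" "v \<in> tuples l (univ B)" by (simp_all add: ERM_def)
      let ?x = "Node (Node (enc_form \<phi>) (enc_tuple v)) (enc_tuple u)"
      obtain n where n: "computes B nb evaluator ?x (enc_bool (E (B, nb) ?x)) n" "n \<le> sz (B, nb) ?x ^ c2"
        using ev[rule_format, OF W] unfolding fst_conv snd_conv by blast
      have "E (B, nb) ?x = hyp P B \<phi> v (\<lambda>_. 0) u"
        using E(2)[rule_format, OF W \<phi>v(1), unfolded fst_conv, OF \<phi>v(2) u] .
      then have "evaluates B nb evaluator \<phi> v u (hyp P B \<phi> v (\<lambda>_. 0) u) n"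
        using n(1) by (simp add: evaluates_def)
      moreover have "real n \<le> real c * (1 + log 2 (card (univ B))) ^ c"
      proof (rule poly_time[OF n(2)])
        have "real (sz (B, nb) ?x) \<le> real (bits (B, nb)) * real (5 + sum_list (map (\<lambda>\<phi>. dsize (enc_form \<phi>)) \<Phi>) + l + k)"
          using sz_evaluation[OF W \<phi>v(1), unfolded fst_conv, OF \<phi>v(2) u] by (simp only: of_nat_mult[symmetric] of_nat_le_iff)
        also have "\<dots> \<le> (3 * (1 + log 2 (card (univ B)))) * real (5 + sum_list (map (\<lambda>\<phi>. dsize (enc_form \<phi>)) \<Phi>) + l + k)"
          using bits_le(1)[OF W] by (intro mult_right_mono) simp_all
        also have "\<dots> = real A2 * (1 + log 2 (card (univ B))) ^ 1"
          by (simp only: A2_def of_nat_mult of_nat_numeral power_one_right mult.assoc mult.left_commute mult.commute)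
        finally show "real (sz (B, nb) ?x) \<le> real A2 * (1 + log 2 (card (univ B))) ^ 1" .
        show "1 \<le> 1 + log 2 (card (univ B))" using bits_le(2)[OF W] by simp
      qed (simp_all add: c_def)
      ultimately show "\<exists>n. evaluates B nb evaluator \<phi> v u (hyp P B \<phi> v (\<lambda>_. 0) u) n \<and>
          real n \<le> real c * (1 + log 2 (card (univ B))) ^ c" by blast
    qed
  qed
qed

end

theorem theorem10:
  fixes P :: "'p numpred" and \<sigma> :: signature and d k l r w :: nat
  assumes "is_numpred P"
  shows "\<exists>(s :: nat) (alg :: com) (evaluator :: com) (c :: nat). \<forall>B nb.
    is_structure \<sigma> B \<and> univ B \<noteq> {} \<and> univ B = {..<card (univ B)} \<and>
    gaifman_degree B \<le> d \<and> neighbour_listing B nb \<longrightarrow>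
      (\<forall>T \<in> lists (examples k B). \<exists>(\<phi> :: 'p form) v t. returns B nb alg T \<phi> v t \<and>
         sphere_comb P \<sigma> ((2 * w + 1) ^ r) {..<k + l} \<phi> \<and> v \<in> tuples l (univ B)) \<and>
      (\<forall>\<epsilon> \<delta> D t. 0 < \<epsilon> \<and> \<epsilon> < 1 \<and> 0 < \<delta> \<and> \<delta> < 1 \<and> set_pmf D \<subseteq> examples k B \<and>
         t \<ge> sample_bound s B \<epsilon> \<delta> \<longrightarrow>
         measure_pmf.prob (replicate_pmf t D)
           {T. \<exists>(\<phi> :: 'p form) v n. returns B nb alg T \<phi> v n \<and>
              err D (hyp P B \<phi> v (\<lambda>_. 0)) - Min (err D ` concepts P \<sigma> k l r w B) \<le> \<epsilon>}
         \<ge> 1 - \<delta>) \<and>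
      (\<forall>\<epsilon> \<delta>. \<forall>T \<in> lists (examples k B). 0 < \<epsilon> \<and> \<epsilon> < 1 \<and> 0 < \<delta> \<and> \<delta> < 1 \<and>
         length T = sample_bound s B \<epsilon> \<delta> \<longrightarrow>
         (\<exists>(\<phi> :: 'p form) v t. returns B nb alg T \<phi> v t \<and>
            real t \<le> real c * (log 2 (card (univ B)) + 1 / \<epsilon> + log 2 (1 / \<delta>)) ^ c)) \<and>
      (\<forall>T \<in> lists (examples k B). \<forall>(\<phi> :: 'p form) v t. returns B nb alg T \<phi> v t \<longrightarrow>
         (\<forall>u \<in> tuples k (univ B). \<exists>n. evaluates B nb evaluator \<phi> v u (hyp P B \<phi> v (\<lambda>_. 0) u) n \<and>
            real n \<le> real c * (1 + log 2 (card (univ B))) ^ c))"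
  by (rule learner.learnable)

end
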